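(* For all $1\le a\le N$ and $1\le m\le n$ one has, as operators on $V^{\otimes n}$-valued functions of $(x,y)$, $$[\,D_a(x\,|\,y),\ \Delta_m^{-1}Q_m(x\,|\,y)\,]=0 .$$ Hence the system of equations for a $V^{\otimes n}$-valued function $f(x\,|\,y)$ $$\Delta_m f(x\,|\,y)=Q_m(x\,|\,y)f(x\,|\,y)\quad(1\le m\le n),\qquad D_a(x\,|\,y)f(x\,|\,y)=0\quad(1\le a\le N)$$ is compatible.
   Context: Let $n,N$ be positive integers and $c,k,\alpha,\beta$ generic non-zero complex numbers. $V=\bigoplus_{a=1}^N(\mathbb{C}v_a\oplus\mathbb{C}v_{\bar a})$ is the $2N$-dimensional space with basis $v_1,\dots,v_N,v_{\bar1},\dots,v_{\bar N}$. Variables: $x=(x_1,\dots,x_N)\in(\mathbb{C}^\times)^N$, $y=(y_1,\dots,y_n)\in\mathbb{C}^n$. All operator-valued functions below are rational in $(x,y)$, and identities are identities of rational functions. Subscripts on $R,K$ and superscripts $u^{(j)}$ indicate the tensor factors of $V^{\otimes n}$ on which an operator acts. Difference part. $R(\lambda)=\frac{\lambda+kP}{\lambda+k}$ on $V^{\otimes2}$, with $P(u\otimes v)=v\otimes u$. $T(x)\in\mathrm{End}(V)$: $T(x)v_a=x_a^{-1}v_{\bar a}$, $T(x)v_{\bar a}=x_av_a$. $K(\lambda\,|\,x,\beta)=\frac{\lambda T(x)+\beta}{\lambda+\beta}$. $\underline{1}=(1,\dots,1)\in(\mathbb{C}^\times)^N$, and $K(\lambda\,|\,\underline1,\alpha)=\frac{\lambda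 T(\underline1)+\alpha}{\lambda+\alpha}$. For $1\le m\le n$, $$\begin{aligned}Q_m(x\,|\,y)=\;&R_{m,m-1}(y_m-y_{m-1}-c)\cdots R_{m,1}(y_m-y_1-c)\,K_m(y_m-c/2\,|\,x,\beta)\\&\times R_{1,m}(y_1+y_m)\cdots R_{m-1,m}(y_{m-1}+y_m)\,R_{m,m+1}(y_m+y_{m+1})\cdots R_{m,n}(y_m+y_n)\\&\times K_m(y_m\,|\,\underline1,\alpha)\,R_{m,n}(y_m-y_n)\cdots R_{m,m+1}(y_m-y_{m+1}).\end{aligned}$$ $\Delta_m$ is the shift $(\Delta_mf)(x\,|\,y)=f(x\,|\,y_1,\dots,y_m-c,\dots,y_n)$. Differential part. $e_{ab}$ ($a,b\in\{1,\dots,N,\bar1,\dots,\bar N\}$) are the matrix units, $e_{ab}v_p=\delta_{bp}v_a$. For $1\le a,b\le N$: $E_{ab}=e_{ab}+e_{\bar a\bar b}$, $\overline E_{ab}=e_{a\bar b}+e_{\bar ab}$, and $$\mathbf X_{ab}=\sum_{1\le i<j\le n}\bigl(e_{ab}^{(i)}E_{ba}^{(j)}+e_{\bar b\bar a}^{(i)}E_{ab}^{(j)}\bigr),\quad \mathbf Y_{ab}=\sum_{1\le i<j\le n}\bigl(e_{a\bar b}^{(i)}\overline E_{ba}^{(j)}+e_{b\bar a}^{(i)}\overline E_{ab}^{(j)}\bigr),\quad \mathbf Z_{ab}=\sum_{1\le i<j\le n}\bigl(e_{\bar ab}^{(i)}\overline E_{ba}^{(j)}+e_{\bar ba}^{(i)}\overline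 E_{ab}^{(j)}\bigr).$$ $$A_a(y)=\sum_{j=1}^ny_j\bigl(e_{aa}^{(j)}-e_{\bar a\bar a}^{(j)}\bigr)+2\alpha\sum_{j=1}^ne_{a\bar a}^{(j)}+k\Bigl(-\sum_{p=1}^{a-1}\mathbf X_{pa}+\sum_{p=a+1}^N\mathbf X_{ap}+\sum_{p=1}^N\mathbf Y_{ap}\Bigr),$$ $$B_a(x)=2\,\frac{\alpha+\beta x_a}{x_a^2-1}\sum_{j=1}^n\overline E_{aa}^{(j)}+k\Bigl\{\sum_{p=1}^{a-1}\frac{x_a}{x_a-x_p}(\mathbf X_{ap}+\mathbf X_{pa})+\sum_{p=a+1}^N\frac{x_p}{x_a-x_p}(\mathbf X_{ap}+\mathbf X_{pa})+\sum_{p=1}^N\frac{1}{x_ax_p-1}(\mathbf Y_{ap}+\mathbf Z_{ap})\Bigr\},$$ $L_a(x\,|\,y)=A_a(y)+B_a(x)$ and $D_a(x\,|\,y)=c\,x_a\frac{\partial}{\partial x_a}+L_a(x\,|\,y)$. Compatible means that the operators $D_a(x\,|\,y)$ $(1\le a\le N)$ and $\Delta_m^{-1}Q_m(x\,|\,y)$ $(1\le m\le n)$ commute pairwise. *)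

theory Defs
  imports "HOL-Analysis.Analysis"
begin

text \<open>
  The indices \<open>1, \<dots>, N\<close> and the tensor positions \<open>1, \<dots>, n\<close> are the elements of two finite
  linearly ordered types \<open>'N\<close> and \<open>'n\<close>. The basis of \<open>V\<close> is indexed by \<open>'N + 'N\<close>, where
  \<open>Inl a\<close> stands for \<open>v\<^sub>a\<close> and \<open>Inr a\<close> for \<open>v\<close> with index \<open>a\<close> barred. The basis of the
  \<open>n\<close>-th tensor power of \<open>V\<close> is indexed by the functions \<open>I :: 'n \<Rightarrow> 'N + 'N\<close>
  (\<open>I\<close> stands for the tensor product of the \<open>v\<close> with index \<open>I j\<close> over all positions \<open>j\<close>).
  Operators are matrices acting on columns.
\<close>

type_synonym 'm point = "complex ^ 'm"
type_synonym 'N idx = "'N + 'N"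
type_synonym ('N, 'n) tensor = "complex ^ ('n \<Rightarrow> 'N idx)"
type_synonym ('N, 'n) tensor_op = "complex ^ ('n \<Rightarrow> 'N idx) ^ ('n \<Rightarrow> 'N idx)"
type_synonym ('N, 'n) tensor_fun = "'N point \<Rightarrow> 'n point \<Rightarrow> ('N, 'n) tensor"

definition smat :: "complex \<Rightarrow> complex ^ 'q::finite ^ 'p::finite \<Rightarrow> complex ^ 'q ^ 'p" (infixr "*m" 70)
  where "z *m M = (\<chi> i j. z * M $ i $ j)"

definition munit :: "'p::finite \<Rightarrow> 'p \<Rightarrow> complex ^ 'p ^ 'p"
  where "munit a b = (\<chi> p q. if p = a \<and> q = b then 1 else 0)"

definition at1 :: "'n::finite \<Rightarrow> complex ^ 'N::finite idx ^ 'N idx \<Rightarrow> ('N, 'n) tensor_op"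
  where "at1 j M = (\<chi> I J. if \<forall>l. l \<noteq> j \<longrightarrow> I l = J l then M $ I j $ J j else 0)"

text \<open>Only used for \<open>i \<noteq> j\<close>; the first factor of the two-site operator acts at \<open>i\<close>, the
  second at \<open>j\<close>.\<close>

definition at2 :: "'n::finite \<Rightarrow> 'n \<Rightarrow> complex ^ ('N::finite idx \<times> 'N idx) ^ ('N idx \<times> 'N idx) \<Rightarrow> ('N, 'n) tensor_op"
  where "at2 i j M = (\<chi> I J. if \<forall>l. l \<noteq> i \<and> l \<noteq> j \<longrightarrow> I l = J l
                             then M $ (I i, I j) $ (J i, J j) else 0)"


subsection \<open>Difference part\<close>

definition flip :: "complex ^ ('N::finite idx \<times> 'N idx) ^ ('N idx \<times> 'N idx)"
  where "flip = (\<chi> p q. if p = (snd q, fst q) then 1 else 0)"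

definition Rmat :: "complex \<Rightarrow> complex \<Rightarrow> complex ^ ('N::finite idx \<times> 'N idx) ^ ('N idx \<times> 'N idx)"
  where "Rmat k z = (1 / (z + k)) *m (z *m mat 1 + k *m flip)"

definition Tmat :: "('N::finite) point \<Rightarrow> complex ^ 'N idx ^ 'N idx"
  where "Tmat x = (\<chi> p q. case (p, q) of
           (Inr b, Inl a) \<Rightarrow> if a = b then inverse (x $ a) else 0
         | (Inl b, Inr a) \<Rightarrow> if a = b then x $ a else 0
         | _ \<Rightarrow> 0)"

definition Kmat :: "complex \<Rightarrow> ('N::finite) point \<Rightarrow> complex \<Rightarrow> complex ^ 'N idx ^ 'N idx"
  where "Kmat z x b = (1 / (z + b)) *m (z *m Tmat x + b *m mat 1)"

definition oprod :: "('n::finite \<Rightarrow> ('N::finite, 'n) tensor_op) \<Rightarrow> 'n list \<Rightarrow> ('N, 'n) tensor_op"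
  where "oprod F js = foldr (\<lambda>j M. F j ** M) js (mat 1)"

definition sites_below :: "'n::{finite,linorder} \<Rightarrow> 'n list"
  where "sites_below m = sorted_list_of_set {j. j < m}"

definition sites_above :: "'n::{finite,linorder} \<Rightarrow> 'n list"
  where "sites_above m = sorted_list_of_set {j. m < j}"

definition Qmat :: "complex \<Rightarrow> complex \<Rightarrow> complex \<Rightarrow> complex \<Rightarrow> 'n::{finite,linorder} \<Rightarrow> ('N::finite) point \<Rightarrow> 'n point
    \<Rightarrow> ('N, 'n) tensor_op"
  where "Qmat c k \<alpha> \<beta> m x y =
       oprod (\<lambda>j. at2 m j (Rmat k (y $ m - y $ j - c))) (rev (sites_below m))
    ** at1 m (Kmat (y $ m - c / 2) x \<beta>)
    ** oprod (\<lambda>j. at2 j m (Rmat k (y $ j + y $ m))) (sites_below m)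
    ** oprod (\<lambda>j. at2 m j (Rmat k (y $ m + y $ j))) (sites_above m)
    ** at1 m (Kmat (y $ m) (\<chi> a. 1) \<alpha>)
    ** oprod (\<lambda>j. at2 m j (Rmat k (y $ m - y $ j))) (rev (sites_above m))"

definition Delta :: "complex \<Rightarrow> 'n::finite \<Rightarrow> ('N::finite, 'n) tensor_fun \<Rightarrow> ('N, 'n) tensor_fun"
  where "Delta c m f = (\<lambda>x y. f x (y - axis m c))"

definition Delta_inv :: "complex \<Rightarrow> 'n::finite \<Rightarrow> ('N::finite, 'n) tensor_fun \<Rightarrow> ('N, 'n) tensor_fun"
  where "Delta_inv c m f = (\<lambda>x y. f x (y + axis m c))"

lemma Delta_Delta_inv: "Delta c m (Delta_inv c m f) = f" "Delta_inv c m (Delta c m f) = f"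
  by (simp_all add: Delta_def Delta_inv_def)

definition DeltaQ :: "complex \<Rightarrow> complex \<Rightarrow> complex \<Rightarrow> complex \<Rightarrow> 'n::{finite,linorder}
    \<Rightarrow> ('N::finite, 'n) tensor_fun \<Rightarrow> ('N, 'n) tensor_fun"
  where "DeltaQ c k \<alpha> \<beta> m f = Delta_inv c m (\<lambda>x y. Qmat c k \<alpha> \<beta> m x y *v f x y)"


subsection \<open>Differential part\<close>

definition Emat :: "'N::finite \<Rightarrow> 'N \<Rightarrow> complex ^ 'N idx ^ 'N idx"
  where "Emat a b = munit (Inl a) (Inl b) + munit (Inr a) (Inr b)"

definition Ebarmat :: "'N::finite \<Rightarrow> 'N \<Rightarrow> complex ^ 'N idx ^ 'N idx"
  where "Ebarmat a b = munit (Inl a) (Inr b) + munit (Inr a) (Inl b)"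

definition Xop :: "'N::finite \<Rightarrow> 'N \<Rightarrow> ('N, 'n::{finite,linorder}) tensor_op"
  where "Xop a b = (\<Sum>(i, j)\<in>{(i, j). i < j}.
      at1 i (munit (Inl a) (Inl b)) ** at1 j (Emat b a)
    + at1 i (munit (Inr b) (Inr a)) ** at1 j (Emat a b))"

definition Yop :: "'N::finite \<Rightarrow> 'N \<Rightarrow> ('N, 'n::{finite,linorder}) tensor_op"
  where "Yop a b = (\<Sum>(i, j)\<in>{(i, j). i < j}.
      at1 i (munit (Inl a) (Inr b)) ** at1 j (Ebarmat b a)
    + at1 i (munit (Inl b) (Inr a)) ** at1 j (Ebarmat a b))"

definition Zop :: "'N::finite \<Rightarrow> 'N \<Rightarrow> ('N, 'n::{finite,linorder}) tensor_op"
  where "Zop a b = (\<Sum>(i, j)\<in>{(i, j). i < j}.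
      at1 i (munit (Inr a) (Inl b)) ** at1 j (Ebarmat b a)
    + at1 i (munit (Inr b) (Inl a)) ** at1 j (Ebarmat a b))"

definition Aop :: "complex \<Rightarrow> complex \<Rightarrow> 'N::{finite,linorder} \<Rightarrow> ('n::{finite,linorder}) point
    \<Rightarrow> ('N, 'n) tensor_op"
  where "Aop k \<alpha> a y =
      (\<Sum>j\<in>UNIV. (y $ j) *m at1 j (munit (Inl a) (Inl a) - munit (Inr a) (Inr a)))
    + (2 * \<alpha>) *m (\<Sum>j\<in>UNIV. at1 j (munit (Inl a) (Inr a)))
    + k *m (- (\<Sum>p\<in>{p. p < a}. Xop p a) + (\<Sum>p\<in>{p. a < p}. Xop a p) + (\<Sum>p\<in>UNIV. Yop a p))"

definition Bop :: "complex \<Rightarrow> complex \<Rightarrow> complex \<Rightarrow> 'N::{finite,linorder} \<Rightarrow> 'N point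
    \<Rightarrow> ('N, 'n::{finite,linorder}) tensor_op"
  where "Bop k \<alpha> \<beta> a x =
      (2 * ((\<alpha> + \<beta> * x $ a) / ((x $ a)\<^sup>2 - 1))) *m (\<Sum>j\<in>UNIV. at1 j (Ebarmat a a))
    + k *m ((\<Sum>p\<in>{p. p < a}. (x $ a / (x $ a - x $ p)) *m (Xop a p + Xop p a))
          + (\<Sum>p\<in>{p. a < p}. (x $ p / (x $ a - x $ p)) *m (Xop a p + Xop p a))
          + (\<Sum>p\<in>UNIV. (1 / (x $ a * x $ p - 1)) *m (Yop a p + Zop a p)))"

definition Lop :: "complex \<Rightarrow> complex \<Rightarrow> complex \<Rightarrow> 'N::{finite,linorder} \<Rightarrow> 'N point \<Rightarrow> ('n::{finite,linorder}) point
    \<Rightarrow> ('N, 'n) tensor_op"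
  where "Lop k \<alpha> \<beta> a x y = Aop k \<alpha> a y + Bop k \<alpha> \<beta> a x"

definition pderiv_x :: "'N::finite \<Rightarrow> ('N, 'n::finite) tensor_fun \<Rightarrow> ('N, 'n) tensor_fun"
  where "pderiv_x a f = (\<lambda>x y. \<chi> I. deriv (\<lambda>t. f (x + axis a t) y $ I) 0)"

definition Dop :: "complex \<Rightarrow> complex \<Rightarrow> complex \<Rightarrow> complex \<Rightarrow> 'N::{finite,linorder}
    \<Rightarrow> ('N, 'n::{finite,linorder}) tensor_fun \<Rightarrow> ('N, 'n) tensor_fun"
  where "Dop c k \<alpha> \<beta> a f =
    (\<lambda>x y. (c * x $ a) *s pderiv_x a f x y + Lop k \<alpha> \<beta> a x y *v f x y)"


subsection \<open>Operators on functions and compatibility\<close>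

text \<open>The coefficients are rational, and division by zero is a total operation here, so identities
  are claimed away from the poles only. The next two predicates say that no denominator occurring
  in \<open>Bop\<close> and \<open>Tmat\<close>, respectively in \<open>Qmat\<close>, vanishes.\<close>

definition regular_x :: "('N::finite) point \<Rightarrow> bool"
  where "regular_x x \<longleftrightarrow>
    (\<forall>a. x $ a \<noteq> 0 \<and> (x $ a)\<^sup>2 \<noteq> 1 \<and> (\<forall>p. x $ a * x $ p \<noteq> 1) \<and> (\<forall>p. p \<noteq> a \<longrightarrow> x $ a \<noteq> x $ p))"

definition regular_Q :: "complex \<Rightarrow> complex \<Rightarrow> complex \<Rightarrow> complex \<Rightarrow> 'n::{finite,linorder} \<Rightarrow> 'n point \<Rightarrow> bool"
  where "regular_Q c k \<alpha> \<beta> m y \<longleftrightarrow>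
      (\<forall>j<m. y $ m - y $ j - c + k \<noteq> 0)
    \<and> y $ m - c / 2 + \<beta> \<noteq> 0
    \<and> (\<forall>j. j \<noteq> m \<longrightarrow> y $ m + y $ j + k \<noteq> 0)
    \<and> y $ m + \<alpha> \<noteq> 0
    \<and> (\<forall>j>m. y $ m - y $ j + k \<noteq> 0)"

text \<open>Domains on which all the operators \<open>Dop\<close> and \<open>DeltaQ\<close> are defined: they avoid the poles, are
  open in the \<open>x\<close>-direction and are closed under the shifts performed by \<open>Delta_inv\<close>. The largest
  one is the set of all \<open>(x, y)\<close> such that \<open>x\<close> is regular and every \<open>y'\<close> in \<open>y + c \<nat>\<^sup>n\<close> is regular
  for every \<open>Qmat\<close>. It is dense, so that an identity between rational functions that holds on it holds
  identically. Smaller domains leave room for functions with further poles or with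
  branches in \<open>x\<close>.\<close>

definition admissible_domain :: "complex \<Rightarrow> complex \<Rightarrow> complex \<Rightarrow> complex
    \<Rightarrow> (('N::finite) point \<times> ('n::{finite,linorder}) point) set \<Rightarrow> bool"
  where "admissible_domain c k \<alpha> \<beta> \<Omega> \<longleftrightarrow>
      (\<forall>y. open {x. (x, y) \<in> \<Omega>})
    \<and> (\<forall>(x, y)\<in>\<Omega>. regular_x x \<and> (\<forall>m. regular_Q c k \<alpha> \<beta> m y \<and> (x, y + axis m c) \<in> \<Omega>))"

text \<open>The function space on which the operators act: functions that are holomorphic in \<open>x\<close>
  (complex differentiable in all \<open>x\<close>-variables jointly). The dependence on \<open>y\<close> is arbitrary, as only
  shifts act on \<open>y\<close>.\<close>

definition fun_space :: "(('N::finite) point \<times> ('n::finite) point) set \<Rightarrow> ('N, 'n) tensor_fun set"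
  where "fun_space \<Omega> = {f. \<forall>(x, y)\<in>\<Omega>. \<exists>f'. ((\<lambda>x. f x y) has_derivative f') (at x)
                                      \<and> (\<forall>z v. f' (z *s v) = z *s f' v)}"

definition commutator :: "(('N::finite, 'n::finite) tensor_fun \<Rightarrow> ('N, 'n) tensor_fun)
    \<Rightarrow> (('N, 'n) tensor_fun \<Rightarrow> ('N, 'n) tensor_fun) \<Rightarrow> ('N, 'n) tensor_fun \<Rightarrow> ('N, 'n) tensor_fun"
  where "commutator S T f = (\<lambda>x y. S (T f) x y - T (S f) x y)"

definition commute_on :: "(('N::finite) point \<times> ('n::finite) point) set
    \<Rightarrow> (('N, 'n) tensor_fun \<Rightarrow> ('N, 'n) tensor_fun) \<Rightarrow> (('N, 'n) tensor_fun \<Rightarrow> ('N, 'n) tensor_fun) \<Rightarrow> bool"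
  where "commute_on \<Omega> S T \<longleftrightarrow> (\<forall>f\<in>fun_space \<Omega>. \<forall>(x, y)\<in>\<Omega>. commutator S T f x y = 0)"

definition compatible :: "(('N::finite) point \<times> ('n::finite) point) set
    \<Rightarrow> (('N, 'n) tensor_fun \<Rightarrow> ('N, 'n) tensor_fun) set \<Rightarrow> bool"
  where "compatible \<Omega> Ops \<longleftrightarrow> (\<forall>S\<in>Ops. \<forall>T\<in>Ops. commute_on \<Omega> S T)"

end

theory Submission
  imports Defs "HOL-Complex_Analysis.Cauchy_Integral_Formula"
begin

text \<open>
  Let the operators depend on an order of the sites. Exchanging two neighbouring sites conjugates
  them by an \<open>R\<close>-matrix; if a site comes last, \<open>K(y | 1, \<alpha>)\<close> reverses the sign of its \<open>y\<close> in \<open>L\<^sub>a\<close>, and if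
  it comes first, \<open>K(y | x, \<beta>)\<close> does so up to a shift by \<open>c\<close> that is produced by the derivative in
  \<open>x\<^sub>a\<close>. These three facts are local computations. Since \<open>Q\<^sub>m\<close> carries the site \<open>m\<close> to the last
  position, then to the first one and back, they give \<open>[D\<^sub>a, \<Delta>\<^sub>m\<^sup>-\<^sup>1 Q\<^sub>m] = 0\<close>.

  The difference operators for two sites are brought by gauge transformations to the case that
  these two sites come first, where the claim is the reflection equation for a dressed \<open>K\<close>-matrix.

  For \<open>[D\<^sub>a, D\<^sub>b] = 0\<close> one needs that \<open>x\<^sub>a \<partial>\<^sub>a L\<^sub>b\<close> is symmetric in \<open>a, b\<close> and that \<open>C = [L\<^sub>a, L\<^sub>b]\<close> vanishes.
  The latter needs no computation with three sites. \<open>C\<close> is affine in \<open>y\<close> and inherits the three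
  intertwining relations (with \<open>c = 0\<close>). Hence its coefficients commute, up to sign, with \<open>T(1)\<close> and \<open>T(x)\<close> at
  every site, so they are diagonal, as \<open>T(1) T(x)\<close> has distinct eigenvalues. The coefficient of \<open>y\<^sub>q\<close>
  is a sum of commutators with diagonal matrices, so its diagonal is zero as well. The constant term then commutes
  with all transpositions and all \<open>T(1)\<close>, so that its eigenspaces are preserved by \<open>L\<^sub>a\<close> and \<open>L\<^sub>b\<close>; as the trace of
  a commutator, each of its eigenvalues is zero.
\<close>

subsection \<open>The ring of square matrices\<close>

text \<open>In \<open>L_a\<close> each parameter \<open>y_j\<close> stands in front of
  \<open>h_mat a\<close> at its own site, so carrying a site along means carrying its parameter
  along. Seen this way, K(y | 1, \<alpha>) sends the parameter y to -y, and K(y - c/2 | x, \<beta>)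
  sends -y to y - c. The composite of the two reflections is the shift that belongs to the site.
  This explains the c/2 in the argument of K and the c in the leftmost R-factors, which act after
  the second reflection. The c itself comes from the fact that \<open>x_a\<close> times the
  derivative of T(x) in \<open>x_a\<close> is \<open>h_mat a * T x\<close>.

  The pair terms of \<open>L_a\<close> treat the first and the second site differently. This
  asymmetry forces the detour over arbitrary orders of the sites, and it is also what makes the
  detour useful: T(1) is compatible with the second factor only and T(x) with the first only, so
  each boundary matrix can be used at one end of the order. All intertwining relations are
  polynomial in the parameters once the denominators of R and K are removed; evaluating them at
  special parameters then isolates single coefficients.\<close>

typedef 'i opr = "UNIV :: (complex ^ 'i::finite ^ 'i) set"
  morphisms mat_of opr_of by simp

setup_lifting type_definition_opr

lemma smat_entry [simp]: "(z *m M) $ i $ j = z * M $ i $ j"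
  by (simp add: smat_def)

lemma matrix_add_rdistrib: "(A + B) ** C = A ** C + B ** (C :: 'a::semiring_1 ^ 'r ^ 'q)"
  by (simp add: vec_eq_iff matrix_matrix_mult_def distrib_right sum.distrib)

text \<open>On a type of its own the matrix product can be the \<open>*\<close> of a
  \<open>ring_1\<close>, so that the generic rules for noncommutative rings normalize operator
  identities.\<close>

instantiation opr :: (finite) ring_1
begin
lift_definition zero_opr :: "'a opr" is 0 .
lift_definition one_opr :: "'a opr" is "mat 1" .
lift_definition plus_opr :: "'a opr \<Rightarrow> 'a opr \<Rightarrow> 'a opr" is "(+)" .
lift_definition minus_opr :: "'a opr \<Rightarrow> 'a opr \<Rightarrow> 'a opr" is "(-)" .
lift_definition uminus_opr :: "'a opr \<Rightarrow> 'a opr" is uminus .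
lift_definition times_opr :: "'a opr \<Rightarrow> 'a opr \<Rightarrow> 'a opr" is "(**)" .
instance
proof
  show "(0::'a opr) \<noteq> 1"
    by transfer (auto simp: vec_eq_iff mat_def)
qed (transfer; simp add: matrix_mul_assoc matrix_add_ldistrib matrix_add_rdistrib)+
end

lift_definition cscale :: "complex \<Rightarrow> 'i::finite opr \<Rightarrow> 'i opr" (infixr "\<odot>" 75) is smat .

lift_definition ent :: "'i::finite opr \<Rightarrow> 'i \<Rightarrow> 'i \<Rightarrow> complex" is "\<lambda>M i j. M $ i $ j" .

lemma opr_eqI: "(\<And>i j. ent A i j = ent B i j) \<Longrightarrow> A = B"
  by transfer (simp add: vec_eq_iff)

lemma ent_simps [simp]:
  "ent 0 i j = 0"
  "ent (A + B) i j = ent A i j + ent B i j"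
  "ent (A - B) i j = ent A i j - ent B i j"
  "ent (- A) i j = - ent A i j"
  "ent (z \<odot> A) i j = z * ent A i j"
  by (transfer; simp)+

lemma ent_one: "ent 1 i j = (if i = j then 1 else 0)"
  by transfer (simp add: mat_def)

lemma ent_mult: "ent (A * B) i j = (\<Sum>k\<in>UNIV. ent A i k * ent B k j)"
  by transfer (simp add: matrix_matrix_mult_def)

lemma ent_opr_of: "ent (opr_of M) i j = M $ i $ j"
  by (simp add: ent.rep_eq opr_of_inverse)

lemma ent_sum: "ent (sum f S) i j = (\<Sum>s\<in>S. ent (f s) i j)"
  by (induction S rule: infinite_finite_induct) auto

lemma cscale_simps [simp]:
  "z \<odot> 0 = 0" "0 \<odot> A = 0" "1 \<odot> A = A"
  "(-1) \<odot> A = - A"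
  "(- z) \<odot> A = - (z \<odot> A)"
  "z \<odot> (- A) = - (z \<odot> A)"
  "z \<odot> (w \<odot> A) = (z * w) \<odot> A"
  "(z \<odot> A) * B = z \<odot> (A * B)"
  "A * (z \<odot> B) = z \<odot> (A * B)"
  by (rule opr_eqI; simp add: ent_mult sum_distrib_left mult_ac)+

lemma cscale_distrib:
  "z \<odot> (A + B) = z \<odot> A + z \<odot> B"
  "z \<odot> (A - B) = z \<odot> A - z \<odot> B"
  "(z + w) \<odot> A = z \<odot> A + w \<odot> A"
  "(z - w) \<odot> A = z \<odot> A - w \<odot> A"
  by (rule opr_eqI; simp add: algebra_simps)+

lemma cscale_sum: "z \<odot> sum f S = (\<Sum>s\<in>S. z \<odot> f s)"
  by (induction S rule: infinite_finite_induct) (auto simp: cscale_distrib)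

lemma opr_of_simps:
  "opr_of 0 = 0" "opr_of (mat 1) = 1"
  "opr_of (M + M') = opr_of M + opr_of M'"
  "opr_of (M - M') = opr_of M - opr_of M'"
  "opr_of (- M) = - opr_of M"
  "opr_of (M ** M') = opr_of M * opr_of M'"
  "opr_of (z *m M) = z \<odot> opr_of M"
  by (rule opr_eqI; simp add: ent_opr_of ent_one ent_mult matrix_matrix_mult_def mat_def)+

lemma opr_of_sum: "opr_of (sum f S) = (\<Sum>s\<in>S. opr_of (f s))"
  by (induction S rule: infinite_finite_induct) (auto simp: opr_of_simps)

subsection \<open>Operators at one site and permutations of two sites\<close>

definition site :: "'n::finite \<Rightarrow> ('N::finite idx) opr \<Rightarrow> ('n \<Rightarrow> 'N idx) opr"
  where "site j M = opr_of (at1 j (mat_of M))"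

lemma opr_of_at1: "opr_of (at1 j M) = site j (opr_of M)"
  by (simp add: site_def opr_of_inverse)

lemma ent_site: "ent (site j M) I J = (if \<forall>l. l \<noteq> j \<longrightarrow> I l = J l then ent M (I j) (J j) else 0)"
  by (auto simp: site_def ent.rep_eq opr_of_inverse at1_def)

text \<open>A one-site operator connects \<open>I\<close> only with tuples \<open>I(j := u)\<close>.
  This collapses the sum over all tuples in a matrix product to a sum over one basis index.\<close>

lemma sum_agree_off:
  fixes f :: "('n::finite \<Rightarrow> 'b::finite) \<Rightarrow> complex"
  shows "(\<Sum>J\<in>UNIV. if \<forall>l. l \<noteq> j \<longrightarrow> I l = J l then f J else 0) = (\<Sum>u\<in>UNIV. f (I(j := u)))"
proof -
  have "(\<Sum>J\<in>UNIV. if \<forall>l. l \<noteq> j \<longrightarrow> I l = J l then f J else 0)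
      = (\<Sum>J\<in>range (\<lambda>u. I(j := u)). if \<forall>l. l \<noteq> j \<longrightarrow> I l = J l then f J else 0)"
  proof (rule sum.mono_neutral_right)
    show "\<forall>J\<in>UNIV - range (\<lambda>u. I(j := u)). (if \<forall>l. l \<noteq> j \<longrightarrow> I l = J l then f J else 0) = 0"
    proof
      fix J assume J: "J \<in> UNIV - range (\<lambda>u. I(j := u))"
      have "J = I(j := J j)" if "\<forall>l. l \<noteq> j \<longrightarrow> I l = J l" using that by auto
      with J show "(if \<forall>l. l \<noteq> j \<longrightarrow> I l = J l then f J else 0) = 0" by (metis DiffD2 rangeI)
    qed
  qed auto
  also have "\<dots> = (\<Sum>u\<in>UNIV. f (I(j := u)))"
    by (subst sum.reindex) (auto simp: inj_on_def fun_upd_eqD intro!: sum.cong)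
  finally show ?thesis .
qed

lemma ent_site_mult: "ent (site j M * A) I K = (\<Sum>u\<in>UNIV. ent M (I j) u * ent A (I(j := u)) K)"
proof -
  have "ent (site j M * A) I K
      = (\<Sum>J\<in>UNIV. if \<forall>l. l \<noteq> j \<longrightarrow> I l = J l then ent M (I j) (J j) * ent A J K else 0)"
    by (auto simp: ent_mult ent_site intro!: sum.cong)
  then show ?thesis by (simp add: sum_agree_off)
qed

lemma ent_mult_site: "ent (A * site j M) I K = (\<Sum>u\<in>UNIV. ent A I (K(j := u)) * ent M u (K j))"
proof -
  have "ent (A * site j M) I K
      = (\<Sum>J\<in>UNIV. if \<forall>l. l \<noteq> j \<longrightarrow> K l = J l then ent A I J * ent M (J j) (K j) else 0)"
    by (auto simp: ent_mult ent_site intro!: sum.cong)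
  then show ?thesis by (simp add: sum_agree_off)
qed

lemma site_mult: "site j M * site j N = site j (M * N)"
proof (rule opr_eqI)
  fix I J :: "'a \<Rightarrow> 'b idx"
  define b where "b \<longleftrightarrow> (\<forall>l. l \<noteq> j \<longrightarrow> I l = J l)"
  have 1: "ent (site j N) (I(j := u)) J = (if b then ent N u (J j) else 0)" for u
    by (auto simp: ent_site b_def)
  have 2: "ent (site j (M * N)) I J = (if b then ent (M * N) (I j) (J j) else 0)"
    by (auto simp: ent_site b_def)
  show "ent (site j M * site j N) I J = ent (site j (M * N)) I J"
    unfolding ent_site_mult 1 2 by (simp add: ent_mult)
qed

lemma ent_site_site:
  assumes "i \<noteq> j"
  shows "ent (site i M * site j N) I K =
    (if \<forall>l. l \<noteq> i \<and> l \<noteq> j \<longrightarrow> I l = K l then ent M (I i) (K i) * ent N (I j) (K j) else 0)"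
proof -
  have "ent (site i M * site j N) I K = (\<Sum>u\<in>UNIV. if u = K i then
     (if \<forall>l. l \<noteq> i \<and> l \<noteq> j \<longrightarrow> I l = K l then ent M (I i) (K i) * ent N (I j) (K j) else 0) else 0)"
    unfolding ent_site_mult ent_site using assms by (intro sum.cong) auto
  then show ?thesis by simp
qed

lemma site_commute: "i \<noteq> j \<Longrightarrow> site i M * site j N = site j N * site i M"
  by (rule opr_eqI) (auto simp: ent_site_site)

lemma site_linear:
  "site j 0 = 0" "site j (M + N) = site j M + site j N" "site j (M - N) = site j M - site j N"
  "site j (- M) = - site j M" "site j (z \<odot> M) = z \<odot> site j M"
  by (rule opr_eqI; auto simp: ent_site algebra_simps)+

lemma site_one: "site j 1 = 1"
proof (rule opr_eqI)
  fix I J :: "'a \<Rightarrow> 'b idx"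
  have "I = J \<longleftrightarrow> (\<forall>l. l \<noteq> j \<longrightarrow> I l = J l) \<and> I j = J j" by (auto simp: fun_eq_iff)
  then show "ent (site j 1) I J = ent 1 I J" by (auto simp: ent_site ent_one)
qed

section \<open>Transpositions of two tensor factors\<close>

lift_definition permop :: "'n::finite \<Rightarrow> 'n \<Rightarrow> ('n \<Rightarrow> ('N::finite) idx) opr"
  is "\<lambda>i j. \<chi> I J. if I \<circ> Transposition.transpose i j = J then 1 else 0" .

lemma ent_permop: "ent (permop i j) I J = (if I \<circ> Transposition.transpose i j = J then 1 else 0)"
  by transfer simp

lemma comp_transpose_eq_iff:
  "I \<circ> Transposition.transpose i j = J \<longleftrightarrow> I = J \<circ> Transposition.transpose i j"
  by (metis comp_assoc comp_id transpose_comp_involutory)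

lemma opr_of_at2_flip:
  assumes "i \<noteq> j"
  shows "opr_of (at2 i j flip) = permop i j"
proof (rule opr_eqI)
  fix I J :: "'a \<Rightarrow> 'b idx"
  have "I \<circ> Transposition.transpose i j = J \<longleftrightarrow>
    (\<forall>l. l \<noteq> i \<and> l \<noteq> j \<longrightarrow> I l = J l) \<and> I i = J j \<and> I j = J i"
    unfolding comp_transpose_eq_iff using assms
    by (auto simp: fun_eq_iff Transposition.transpose_def)
  then show "ent (opr_of (at2 i j flip)) I J = ent (permop i j) I J"
    by (auto simp: ent_opr_of at2_def flip_def ent_permop)
qed

lemma ent_permop_mult: "ent (permop i j * A) I K = ent A (I \<circ> Transposition.transpose i j) K"
proof -
  have "ent (permop i j * A) I K = (\<Sum>J\<in>UNIV. if J = I \<circ> Transposition.transpose i j then ent A J K else 0)"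
    unfolding ent_mult ent_permop by (intro sum.cong) auto
  then show ?thesis by simp
qed

lemma ent_mult_permop: "ent (A * permop i j) I K = ent A I (K \<circ> Transposition.transpose i j)"
proof -
  have "ent (A * permop i j) I K = (\<Sum>J\<in>UNIV. if J = K \<circ> Transposition.transpose i j then ent A I J else 0)"
    unfolding ent_mult ent_permop comp_transpose_eq_iff by (intro sum.cong) auto
  then show ?thesis by simp
qed

lemma permop_commute: "permop i j = permop j i"
  by (rule opr_eqI) (simp add: ent_permop transpose_commute)

lemma permop_square: "permop i j * permop i j = 1"
  by (rule opr_eqI) (simp add: ent_permop_mult ent_permop ent_one comp_assoc)

lemma permop_site: "permop i j * site q M = site (Transposition.transpose i j q) M * permop i j"
proof (rule opr_eqI)
  fix I J :: "'a \<Rightarrow> 'b idx"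
  let ?t = "Transposition.transpose i j"
  have "(\<forall>l. l \<noteq> ?t q \<longrightarrow> I l = (J \<circ> ?t) l) \<longleftrightarrow> (\<forall>l. l \<noteq> q \<longrightarrow> (I \<circ> ?t) l = J l)"
    by (metis comp_apply transpose_involutory)
  then show "ent (permop i j * site q M) I J = ent (site (?t q) M * permop i j) I J"
    by (auto simp: ent_permop_mult ent_mult_permop ent_site)
qed

lemma permop_site_simps:
  "permop i j * site i M = site j M * permop i j"
  "permop i j * site j M = site i M * permop i j"
  "q \<noteq> i \<Longrightarrow> q \<noteq> j \<Longrightarrow> permop i j * site q M = site q M * permop i j"
  by (simp_all add: permop_site)

text \<open>With \<open>permop_square\<close>, these relations of the symmetric group on three
  letters are all that the Yang-Baxter equation needs.\<close>

lemma permop_permop: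
  assumes "i \<noteq> j" "j \<noteq> k" "i \<noteq> k"
  shows "permop i j * permop j k = permop j k * permop i k"
    "permop i j * permop i k = permop j k * permop i j"
proof -
  have 1: "Transposition.transpose i j \<circ> Transposition.transpose j k = Transposition.transpose j k \<circ> Transposition.transpose i k"
    "Transposition.transpose i j \<circ> Transposition.transpose i k = Transposition.transpose j k \<circ> Transposition.transpose i j"
    using assms by (auto simp: fun_eq_iff Transposition.transpose_def)
  show "permop i j * permop j k = permop j k * permop i k"
    by (rule opr_eqI) (simp add: ent_permop_mult ent_permop comp_assoc 1)
  show "permop i j * permop i k = permop j k * permop i j"
    by (rule opr_eqI) (simp add: ent_permop_mult ent_permop comp_assoc 1)
qed

lemma permop_permop_disjoint:
  assumes "{i, j} \<inter> {k, l} = {}"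
  shows "permop i j * permop k l = permop k l * permop i j"
proof -
  have 1: "Transposition.transpose i j \<circ> Transposition.transpose k l = Transposition.transpose k l \<circ> Transposition.transpose i j"
    using assms by (auto simp: fun_eq_iff Transposition.transpose_def)
  show ?thesis
    by (rule opr_eqI) (simp add: ent_permop_mult ent_permop comp_assoc 1)
qed

subsection \<open>One-site and two-site operators\<close>

definition e :: "'N::finite idx \<Rightarrow> 'N idx \<Rightarrow> 'N idx opr"
  where "e u v = opr_of (munit u v)"

fun bar :: "'N idx \<Rightarrow> 'N idx"
  where "bar (Inl a) = Inr a" | "bar (Inr a) = Inl a"

lemma bar_bar [simp]: "bar (bar u) = u"
  by (cases u) auto

lemma ent_e: "ent (e u v) p q = (if p = u \<and> q = v then 1 else 0)"
  by (simp add: e_def ent_opr_of munit_def)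

lemma e_mult: "e u v * e w z = (if v = w then e u z else 0)"
proof (rule opr_eqI)
  fix p q
  have "ent (e u v * e w z) p q = (\<Sum>k\<in>UNIV. if k = v then (if p = u \<and> v = w \<and> q = z then 1 else 0) else 0)"
    unfolding ent_mult ent_e by (intro sum.cong) auto
  then show "ent (e u v * e w z) p q = ent (if v = w then e u z else 0) p q"
    by (auto simp: ent_e)
qed

section \<open>The reflection matrices T(x)\<close>

definition T :: "'N::finite point \<Rightarrow> 'N idx opr"
  where "T x = opr_of (Tmat x)"

text \<open>The factor by which T(x) maps the basis vector with index \<open>u\<close> to the one
  with index \<open>bar u\<close>. The same numbers are the eigenvalues of T(1) T(x).\<close>

fun tc :: "'N::finite point \<Rightarrow> 'N idx \<Rightarrow> complex"
  where "tc x (Inl a) = inverse (x $ a)" | "tc x (Inr a) = x $ a"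

lemma ent_T: "ent (T x) p q = (if p = bar q then tc x q else 0)"
  by (cases p; cases q) (auto simp: T_def ent_opr_of Tmat_def)

lemma T_e: "T x * e u v = tc x u \<odot> e (bar u) v"
proof (rule opr_eqI)
  fix p q
  have "ent (T x * e u v) p q = (\<Sum>k\<in>UNIV. if k = u then (if p = bar u \<and> q = v then tc x u else 0) else 0)"
    unfolding ent_mult ent_e ent_T by (intro sum.cong) auto
  then show "ent (T x * e u v) p q = ent (tc x u \<odot> e (bar u) v) p q"
    by (auto simp: ent_e)
qed

lemma e_T: "e u v * T x = tc x (bar v) \<odot> e u (bar v)"
proof (rule opr_eqI)
  fix p q
  have "ent (e u v * T x) p q = (\<Sum>k\<in>UNIV. if k = v then (if p = u \<and> v = bar q then tc x q else 0) else 0)"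
    unfolding ent_mult ent_e ent_T by (intro sum.cong) auto
  moreover have "v = bar q \<longleftrightarrow> q = bar v" by auto
  ultimately show "ent (e u v * T x) p q = ent (tc x (bar v) \<odot> e u (bar v)) p q"
    by (auto simp: ent_e)
qed

lemma T_square:
  assumes "\<And>a. x $ a \<noteq> 0"
  shows "T x * T x = 1"
proof (rule opr_eqI)
  fix p q
  have "ent (T x * T x) p q = (\<Sum>k\<in>UNIV. if k = bar q then (if p = q then tc x (bar q) * tc x q else 0) else 0)"
    unfolding ent_mult ent_T by (intro sum.cong) auto
  also have "tc x (bar q) * tc x q = 1"
    using assms by (cases q) auto
  finally show "ent (T x * T x) p q = ent 1 p q"
    by (auto simp: ent_one)
qed

abbreviation ones :: "'N::finite point"
  where "ones \<equiv> \<chi> a. 1"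

lemma tc_ones [simp]: "tc ones u = 1"
  by (cases u) auto

definition E_mat :: "'N::finite \<Rightarrow> 'N \<Rightarrow> 'N idx opr"
  where "E_mat a b = e (Inl a) (Inl b) + e (Inr a) (Inr b)"

definition Ebar_mat :: "'N::finite \<Rightarrow> 'N \<Rightarrow> 'N idx opr"
  where "Ebar_mat a b = e (Inl a) (Inr b) + e (Inr a) (Inl b)"

text \<open>This matrix has two roles: it is the coefficient of \<open>y_j\<close> in
  \<open>L_a\<close>, and it describes the derivative of T(x), since \<open>x_a\<close>
  dT(x)/d\<open>x_a\<close> = \<open>h_mat a * T x\<close>. The interplay of the two turns a
  derivative in x into a shift in y.\<close>

definition h_mat :: "'N::finite \<Rightarrow> 'N idx opr"
  where "h_mat a = e (Inl a) (Inl a) - e (Inr a) (Inr a)"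

lemma T_ones_E_mat: "T ones * E_mat a b = E_mat a b * T ones" "T ones * Ebar_mat a b = Ebar_mat a b * T ones"
  by (simp_all add: E_mat_def Ebar_mat_def distrib_left distrib_right T_e e_T)

lemma T_h_mat:
  assumes "x $ a \<noteq> 0"
  shows "T x * h_mat a = - (h_mat a * T x)"
  using assms by (simp add: h_mat_def algebra_simps T_e e_T)

definition X_pair :: "'N::finite \<Rightarrow> 'N \<Rightarrow> 'n::finite \<Rightarrow> 'n \<Rightarrow> ('n \<Rightarrow> 'N idx) opr"
  where "X_pair a b i j = site i (e (Inl a) (Inl b)) * site j (E_mat b a) + site i (e (Inr b) (Inr a)) * site j (E_mat a b)"

definition Y_pair :: "'N::finite \<Rightarrow> 'N \<Rightarrow> 'n::finite \<Rightarrow> 'n \<Rightarrow> ('n \<Rightarrow> 'N idx) opr"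
  where "Y_pair a b i j = site i (e (Inl a) (Inr b)) * site j (Ebar_mat b a) + site i (e (Inl b) (Inr a)) * site j (Ebar_mat a b)"

definition Z_pair :: "'N::finite \<Rightarrow> 'N \<Rightarrow> 'n::finite \<Rightarrow> 'n \<Rightarrow> ('n \<Rightarrow> 'N idx) opr"
  where "Z_pair a b i j = site i (e (Inr a) (Inl b)) * site j (Ebar_mat b a) + site i (e (Inr b) (Inl a)) * site j (Ebar_mat a b)"

text \<open>For regular \<open>x\<close> the sums over \<open>p < a\<close> and over \<open>p > a\<close> in \<open>Aop\<close> and \<open>Bop\<close> combine to a single
  sum in which the order of the indices no longer appears.\<close>

definition pair_term :: "'N::finite point \<Rightarrow> 'N \<Rightarrow> 'n::finite \<Rightarrow> 'n \<Rightarrow> ('n \<Rightarrow> 'N idx) opr"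
  where "pair_term x a i j =
    (\<Sum>p\<in>- {a}. (1 / (x $ a - x $ p)) \<odot> (x $ a \<odot> X_pair a p i j + x $ p \<odot> X_pair p a i j))
  + (\<Sum>p\<in>UNIV. (1 / (x $ a * x $ p - 1)) \<odot> ((x $ a * x $ p) \<odot> Y_pair a p i j + Z_pair a p i j))"

lemma permop_pair_term: "permop i j * pair_term x a u v = pair_term x a (Transposition.transpose i j u) (Transposition.transpose i j v) * permop i j"
proof -
  have *: "permop i j * (site u A * site v B) =
      site (Transposition.transpose i j u) A * (site (Transposition.transpose i j v) B * permop i j)"
    for A B :: "'b idx opr"
    by (subst mult.assoc[symmetric], subst permop_site, subst mult.assoc, subst permop_site, rule refl)
  show ?thesis
    by (simp add: pair_term_def X_pair_def Y_pair_def Z_pair_def distrib_left distrib_right sum_distrib_left sum_distrib_right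
        * mult.assoc)
qed

lemma commute_rules:
  fixes A :: "'i::finite opr"
  shows "A * B = B * A \<Longrightarrow> A * C = C * A \<Longrightarrow> A * (B + C) = (B + C) * A"
    "A * B = B * A \<Longrightarrow> A * (z \<odot> B) = (z \<odot> B) * A"
    "(\<And>s. s \<in> S \<Longrightarrow> A * f s = f s * A) \<Longrightarrow> A * sum f S = sum f S * A"
  by (simp_all add: distrib_left distrib_right sum_distrib_left sum_distrib_right)

lemma commute_mult:
  fixes A :: "'a::semigroup_mult"
  assumes "A * B = B * A" "A * C = C * A"
  shows "A * (B * C) = (B * C) * A"
proof -
  have "A * (B * C) = B * (A * C)" by (simp add: assms(1) mult.assoc[symmetric])
  then show ?thesis by (simp add: assms(2) mult.assoc)
qed

lemma site_commute':
  assumes "q = i \<Longrightarrow> A * M = M * A"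
  shows "site q A * site i M = site i M * site q A"
  using assms by (cases "q = i") (simp_all add: site_mult site_commute)

lemma T_ones_pair_term:
  assumes "q \<noteq> i"
  shows "site q (T ones) * pair_term x a i j = pair_term x a i j * site q (T ones)"
  unfolding pair_term_def X_pair_def Y_pair_def Z_pair_def
  using assms by (intro commute_rules commute_mult site_commute'; simp add: T_ones_E_mat)

text \<open>This and \<open>T_ones_pair_term\<close> say that the first tensor factor of \<open>pair_term x\<close> lies in the centralizer of
  \<open>T x\<close> and the second one in the centralizer of \<open>T ones\<close>.\<close>

lemma T_pair_term:
  assumes "q \<noteq> j" "\<And>a. x $ a \<noteq> 0"
  shows "site q (T x) * pair_term x a i j = pair_term x a i j * site q (T x)"
proof -
  \<comment> \<open>Collecting the operators with the same second factor shows where the weights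
    come from: each first factor is, up to a scalar, the symmetrization M + T(x) M T(x) of a matrix
    unit M.\<close>
  have 1: "x $ a \<odot> X_pair a p i j + x $ p \<odot> X_pair p a i j =
      site i (x $ a \<odot> e (Inl a) (Inl p) + x $ p \<odot> e (Inr a) (Inr p)) * site j (E_mat p a)
    + site i (x $ a \<odot> e (Inr p) (Inr a) + x $ p \<odot> e (Inl p) (Inl a)) * site j (E_mat a p)" for p
    by (simp add: X_pair_def site_linear algebra_simps cscale_distrib)
  have 2: "(x $ a * x $ p) \<odot> Y_pair a p i j + Z_pair a p i j =
      site i ((x $ a * x $ p) \<odot> e (Inl a) (Inr p) + e (Inr a) (Inl p)) * site j (Ebar_mat p a)
    + site i ((x $ a * x $ p) \<odot> e (Inl p) (Inr a) + e (Inr p) (Inl a)) * site j (Ebar_mat a p)" for p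
    by (simp add: Y_pair_def Z_pair_def site_linear algebra_simps cscale_distrib)
  have 3: "T x * (x $ a \<odot> e (Inl a) (Inl p) + x $ p \<odot> e (Inr a) (Inr p))
      = (x $ a \<odot> e (Inl a) (Inl p) + x $ p \<odot> e (Inr a) (Inr p)) * T x" (is "?thesis1 p")
    "T x * (x $ a \<odot> e (Inr p) (Inr a) + x $ p \<odot> e (Inl p) (Inl a))
      = (x $ a \<odot> e (Inr p) (Inr a) + x $ p \<odot> e (Inl p) (Inl a)) * T x" (is "?thesis2 p")
    "T x * ((x $ a * x $ p) \<odot> e (Inl a) (Inr p) + e (Inr a) (Inl p))
      = ((x $ a * x $ p) \<odot> e (Inl a) (Inr p) + e (Inr a) (Inl p)) * T x" (is "?thesis3 p")
    "T x * ((x $ a * x $ p) \<odot> e (Inl p) (Inr a) + e (Inr p) (Inl a))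
      = ((x $ a * x $ p) \<odot> e (Inl p) (Inr a) + e (Inr p) (Inl a)) * T x" (is "?thesis4 p") for p
  proof -
    have inv: "inverse (x $ a) * (x $ a * x $ p) = x $ p" "inverse (x $ p) * (x $ a * x $ p) = x $ a"
      "x $ p * x $ a = x $ a * x $ p" "x $ a * inverse (x $ a) = 1" "x $ p * inverse (x $ p) = 1" "x $ a * (x $ p * inverse (x $ p)) = x $ a" "x $ a * x $ p * inverse (x $ p) = x $ a"
      "x $ a * (x $ p * inverse (x $ a)) = x $ p" "x $ a * x $ p * inverse (x $ a) = x $ p"
      using assms(2)[of a] assms(2)[of p] by (simp_all add: field_simps)
    show "?thesis1 p" "?thesis2 p" "?thesis3 p" "?thesis4 p"
      by (simp_all add: distrib_left distrib_right T_e e_T inv add.commute)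
  qed
  show ?thesis
    unfolding pair_term_def 1 2 using assms(1)
    by (intro 3 commute_rules commute_mult site_commute') simp_all
qed

text \<open>This is one row of the expansion of the flip as the sum of all \<open>e u v\<close>
  tensor \<open>e v u\<close>. It serves to recognize a permutation in the sums over p inside
  \<open>pair_term\<close>.\<close>

lemma site_e_permop:
  assumes "i \<noteq> j"
  shows "site i (e u u) * permop i j = (\<Sum>v\<in>UNIV. site i (e u v) * site j (e v u))"
proof (rule opr_eqI)
  fix I J :: "'a \<Rightarrow> 'b idx"
  have "(\<forall>l. l \<noteq> i \<longrightarrow> I l = (J \<circ> Transposition.transpose i j) l)
     \<longleftrightarrow> (\<forall>l. l \<noteq> i \<and> l \<noteq> j \<longrightarrow> I l = J l) \<and> I j = J i"
    using assms by (auto simp: Transposition.transpose_def)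
  then have "ent (site i (e u u) * permop i j) I J =
     (if (\<forall>l. l \<noteq> i \<and> l \<noteq> j \<longrightarrow> I l = J l) \<and> I j = J i \<and> I i = u \<and> J j = u then 1 else 0)"
    by (auto simp: ent_mult_permop ent_site ent_e)
  also have "\<dots> = (\<Sum>v\<in>UNIV. if v = J i then
     (if (\<forall>l. l \<noteq> i \<and> l \<noteq> j \<longrightarrow> I l = J l) \<and> I j = J i \<and> I i = u \<and> J j = u then 1 else 0) else 0)"
    by simp
  also have "\<dots> = (\<Sum>v\<in>UNIV. ent (site i (e u v) * site j (e v u)) I J)"
    by (intro sum.cong) (auto simp: ent_site_site[OF assms] ent_e)
  finally show "ent (site i (e u u) * permop i j) I J = ent (\<Sum>v\<in>UNIV. site i (e u v) * site j (e v u)) I J"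
    by (simp add: ent_sum)
qed

lemma sum_idx: "(\<Sum>v\<in>(UNIV :: ('N::finite) idx set). f v) = (\<Sum>p\<in>UNIV. f (Inl p)) + (\<Sum>p\<in>UNIV. f (Inr p))"
  unfolding UNIV_Plus_UNIV[symmetric] by (subst sum.Plus) auto

text \<open>Exchanging the sites changes \<open>X_pair a p\<close> and \<open>X_pair p a\<close> by
  opposite amounts, and likewise \<open>Y_pair\<close> and \<open>Z_pair\<close>. The numerators
  therefore become multiples of the denominators, and all dependence on x cancels. What remains is a
  sum of \<open>e u v\<close> tensor \<open>e v u\<close> over all v, that is, a
  permutation.\<close>

lemma pair_term_antisym:
  fixes x :: "'N::finite point" and i j :: "'n::finite"
  assumes "i \<noteq> j" "regular_x x"
  shows "pair_term x a i j - pair_term x a j i = (site i (h_mat a) - site j (h_mat a)) * permop i j"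
proof -
  define F where "F = (\<lambda>u v :: 'N idx. site i (e u v) * site j (e v u))"
  define S where "S p = F (Inl a) (Inl p) - F (Inl p) (Inl a) + F (Inr p) (Inr a) - F (Inr a) (Inr p)" for p
  define U where "U p = F (Inl a) (Inr p) - F (Inr p) (Inl a) + F (Inl p) (Inr a) - F (Inr a) (Inl p)" for p
  have ji: "site j A * site i B = site i B * site j A" for A B :: "'N idx opr"
    using assms(1) by (simp add: site_commute)
  have x1: "X_pair a p i j - X_pair a p j i = S p" for p
    by (simp add: X_pair_def S_def F_def E_mat_def site_linear ji algebra_simps)
  have x2: "X_pair p a i j - X_pair p a j i = - S p" for p
    by (simp add: X_pair_def S_def F_def E_mat_def site_linear ji algebra_simps)
  have y: "Y_pair a p i j - Y_pair a p j i = U p" for p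
    by (simp add: Y_pair_def U_def F_def Ebar_mat_def site_linear ji algebra_simps)
  have z: "Z_pair a p i j - Z_pair a p j i = - U p" for p
    by (simp add: Z_pair_def U_def F_def Ebar_mat_def site_linear ji algebra_simps)
  have 1: "(1 / (x $ a - x $ p)) \<odot> (x $ a \<odot> X_pair a p i j + x $ p \<odot> X_pair p a i j)
     - (1 / (x $ a - x $ p)) \<odot> (x $ a \<odot> X_pair a p j i + x $ p \<odot> X_pair p a j i) = S p" if "p \<noteq> a" for p
  proof -
    have "x $ a \<noteq> x $ p" using assms(2) that unfolding regular_x_def by blast
    have "(1 / (x $ a - x $ p)) \<odot> (x $ a \<odot> X_pair a p i j + x $ p \<odot> X_pair p a i j)
     - (1 / (x $ a - x $ p)) \<odot> (x $ a \<odot> X_pair a p j i + x $ p \<odot> X_pair p a j i)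
      = (1 / (x $ a - x $ p)) \<odot> (x $ a \<odot> (X_pair a p i j - X_pair a p j i) + x $ p \<odot> (X_pair p a i j - X_pair p a j i))"
      unfolding cscale_distrib by (simp add: algebra_simps)
    also have "\<dots> = (1 / (x $ a - x $ p)) \<odot> ((x $ a - x $ p) \<odot> S p)"
      by (simp add: x1 x2 cscale_distrib)
    finally show ?thesis using \<open>x $ a \<noteq> x $ p\<close> by simp
  qed
  have 2: "(1 / (x $ a * x $ p - 1)) \<odot> ((x $ a * x $ p) \<odot> Y_pair a p i j + Z_pair a p i j)
     - (1 / (x $ a * x $ p - 1)) \<odot> ((x $ a * x $ p) \<odot> Y_pair a p j i + Z_pair a p j i) = U p" for p
  proof -
    have "x $ a * x $ p \<noteq> 1" using assms(2) unfolding regular_x_def by blast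
    have "(1 / (x $ a * x $ p - 1)) \<odot> ((x $ a * x $ p) \<odot> Y_pair a p i j + Z_pair a p i j)
     - (1 / (x $ a * x $ p - 1)) \<odot> ((x $ a * x $ p) \<odot> Y_pair a p j i + Z_pair a p j i)
      = (1 / (x $ a * x $ p - 1)) \<odot> ((x $ a * x $ p) \<odot> (Y_pair a p i j - Y_pair a p j i) + (Z_pair a p i j - Z_pair a p j i))"
      unfolding cscale_distrib by (simp add: algebra_simps)
    also have "\<dots> = (1 / (x $ a * x $ p - 1)) \<odot> ((x $ a * x $ p - 1) \<odot> U p)"
      by (simp add: y z cscale_distrib)
    finally show ?thesis using \<open>x $ a * x $ p \<noteq> 1\<close> by simp
  qed
  have "pair_term x a i j - pair_term x a j i = (\<Sum>p\<in>- {a}. S p) + (\<Sum>p\<in>UNIV. U p)"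
    unfolding pair_term_def add_diff_add sum_subtractf[symmetric] using 1 2 by (intro arg_cong2[of _ _ _ _ "(+)"] sum.cong) auto
  \<comment> \<open>The summand for p = a vanishes, so p may run over all indices, as in the
    expansion of the flip.\<close>
  also have "(\<Sum>p\<in>- {a}. S p) = (\<Sum>p\<in>UNIV. S p)"
  proof -
    have "S a = 0" by (simp add: S_def)
    then show ?thesis by (simp add: sum.remove[of UNIV a S] Compl_eq_Diff_UNIV)
  qed
  also have "\<dots> + (\<Sum>p\<in>UNIV. U p) = (site i (h_mat a) - site j (h_mat a)) * permop i j"
  proof -
    have i: "site i (e u u) * permop i j = (\<Sum>v\<in>UNIV. F u v)" for u
      using site_e_permop[OF assms(1)] by (simp add: F_def)
    have j: "site j (e u u) * permop i j = (\<Sum>v\<in>UNIV. F v u)" for u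
      using site_e_permop[of j i u] assms(1) by (simp add: F_def ji permop_commute[of j i])
    show ?thesis
      by (simp add: h_mat_def site_linear left_diff_distrib i j) (simp add: sum_idx S_def U_def sum.distrib sum_subtractf)
  qed
  finally show ?thesis .
qed

definition site_term :: "complex \<Rightarrow> complex \<Rightarrow> 'N::finite point \<Rightarrow> 'N \<Rightarrow> 'N idx opr"
  where "site_term \<alpha> \<beta> x a = (2 * \<alpha>) \<odot> e (Inl a) (Inr a) + (2 * ((\<alpha> + \<beta> * x $ a) / ((x $ a)\<^sup>2 - 1))) \<odot> Ebar_mat a a"

text \<open>\<open>Ebar_mat a a\<close> commutes with T(1); the defect comes only from the summand
  with 2 \<alpha>.\<close>

lemma T_ones_site_term: "T ones * site_term \<alpha> \<beta> x a = site_term \<alpha> \<beta> x a * T ones - (2 * \<alpha>) \<odot> h_mat a"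
  by (simp add: site_term_def Ebar_mat_def h_mat_def algebra_simps T_e e_T cscale_distrib)

text \<open>This relation determines the coefficient in \<open>Bop\<close>. If b denotes the factor
  of \<open>Ebar_mat a a\<close>, the commutator with T(x) is (b \<open>x_a\<close> - (b + 2
  \<alpha>) / \<open>x_a\<close>) times \<open>h_mat a\<close>, and setting this factor equal to 2
  \<beta> gives b.\<close>

lemma T_site_term:
  assumes "regular_x x"
  shows "T x * site_term \<alpha> \<beta> x a = site_term \<alpha> \<beta> x a * T x + (2 * \<beta>) \<odot> h_mat a"
proof -
  define b where "b = 2 * ((\<alpha> + \<beta> * x $ a) / ((x $ a)\<^sup>2 - 1))"
  have nz: "x $ a \<noteq> 0" "(x $ a)\<^sup>2 \<noteq> 1" using assms by (auto simp: regular_x_def)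
  have "b * ((x $ a)\<^sup>2 - 1) = 2 * (\<alpha> + \<beta> * x $ a)"
    using nz by (simp add: b_def)
  then have b: "b * x $ a = b / x $ a + 2 * \<alpha> / x $ a + 2 * \<beta>"
    using nz by (simp add: field_simps power2_eq_square)
  have b': "\<beta> * (2 * t) = b * (x $ a * t) - b * (inverse (x $ a) * t) - \<alpha> * (2 * (inverse (x $ a) * t))" for t
  proof -
    have "\<beta> * (2 * t) = (b * x $ a - b / x $ a - 2 * \<alpha> / x $ a) * t" by (simp add: b)
    then show ?thesis by (simp add: algebra_simps divide_inverse)
  qed
  have site_term: "site_term \<alpha> \<beta> x a = (2 * \<alpha>) \<odot> e (Inl a) (Inr a) + b \<odot> Ebar_mat a a"
    by (simp add: site_term_def b_def)
  show ?thesis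
    unfolding site_term Ebar_mat_def h_mat_def
    by (rule opr_eqI) (simp add: distrib_left distrib_right T_e e_T algebra_simps b')
qed

subsection \<open>The differential part for an arbitrary order of the sites\<close>

primrec order_pairs :: "'a list \<Rightarrow> ('a \<times> 'a) set"
  where "order_pairs [] = {}" | "order_pairs (m # xs) = {m} \<times> set xs \<union> order_pairs xs"

lemma order_pairs_append: "order_pairs (xs @ ys) = order_pairs xs \<union> order_pairs ys \<union> set xs \<times> set ys"
  by (induction xs) auto

lemma order_pairs_subset: "order_pairs xs \<subseteq> set xs \<times> set xs"
  by (induction xs) auto

text \<open>The order enters as a set of pairs rather than as a list: exchanging two neighbours then
  replaces the single pair (i, j) by (j, i).\<close>

definition L_order :: "complex \<Rightarrow> complex \<Rightarrow> complex \<Rightarrow> ('n \<times> 'n) set \<Rightarrow> 'N::finite point \<Rightarrow> 'N \<Rightarrow> 'n::finite point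
    \<Rightarrow> ('n \<Rightarrow> 'N idx) opr"
  where "L_order k \<alpha> \<beta> S x a y = (\<Sum>j\<in>UNIV. y $ j \<odot> site j (h_mat a) + site j (site_term \<alpha> \<beta> x a))
    + k \<odot> (\<Sum>(i, j)\<in>S. pair_term x a i j)"

text \<open>The numerators of R and K satisfy the intertwining relations for every spectral
  parameter, poles included, so the parameter may be specialized freely.\<close>

definition R_num :: "complex \<Rightarrow> 'n::finite \<Rightarrow> 'n \<Rightarrow> complex \<Rightarrow> ('n \<Rightarrow> 'N::finite idx) opr"
  where "R_num k i j z = z \<odot> 1 + k \<odot> permop i j"

definition R_site :: "complex \<Rightarrow> 'n::finite \<Rightarrow> 'n \<Rightarrow> complex \<Rightarrow> ('n \<Rightarrow> 'N::finite idx) opr"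
  where "R_site k i j z = (1 / (z + k)) \<odot> R_num k i j z"

definition K_num :: "'n::finite \<Rightarrow> complex \<Rightarrow> 'N::finite point \<Rightarrow> complex \<Rightarrow> ('n \<Rightarrow> 'N idx) opr"
  where "K_num j z x b = z \<odot> site j (T x) + b \<odot> 1"

definition K_site :: "'n::finite \<Rightarrow> complex \<Rightarrow> 'N::finite point \<Rightarrow> complex \<Rightarrow> ('n \<Rightarrow> 'N idx) opr"
  where "K_site j z x b = (1 / (z + b)) \<odot> K_num j z x b"

lemma R_site_commute: "R_site k i j z = R_site k j i z"
  by (simp add: R_site_def R_num_def permop_commute)

text \<open>Two terms have to cancel: k (y - z) (r - r') from the scalar part of R, and -k (y - z)
  (h - h') P from moving P past the terms with h and h'. The hypothesis on r - r' says that they do.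
  \<open>W\<close> stands for everything that is symmetric in the two sites.\<close>

lemma swap_identity:
  fixes P :: "'i::finite opr"
  assumes "P * W = W * P" "P * h = h' * P" "P * h' = h * P" "P * r = r' * P" "r - r' = (h - h') * P"
  shows "((y - z) \<odot> 1 + k \<odot> P) * (y \<odot> h + z \<odot> h' + W + k \<odot> r)
    = (y \<odot> h + z \<odot> h' + W + k \<odot> r') * ((y - z) \<odot> 1 + k \<odot> P)"
proof -
  have "r = r' + (h * P - h' * P)" using assms(5) by (simp add: algebra_simps)
  then have r: "z \<odot> r = z \<odot> r' + z \<odot> (h * P) - z \<odot> (h' * P)" for z
    by (simp add: cscale_distrib)
  show ?thesis
    by (simp add: distrib_left distrib_right left_diff_distrib right_diff_distrib assms(1-4) cscale_distrib)
      (simp add: algebra_simps r)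
qed

lemma R_num_L_order_swap:
  fixes x :: "'N::finite point" and i j :: "'n::finite"
  assumes "regular_x x" "i \<noteq> j"
    and D: "\<And>u v. (u, v) \<in> D \<Longrightarrow> (Transposition.transpose i j u, Transposition.transpose i j v) \<in> D"
    and nD: "(i, j) \<notin> D" "(j, i) \<notin> D"
  shows "R_num k i j (y $ i - y $ j) * L_order k \<alpha> \<beta> (insert (i, j) D) x a y
    = L_order k \<alpha> \<beta> (insert (j, i) D) x a y * R_num k i j (y $ i - y $ j)"
proof -
  let ?t = "Transposition.transpose i j" and ?P = "permop i j :: ('n \<Rightarrow> 'N idx) opr"
  define M where "M = (\<Sum>q\<in>UNIV - {i} - {j}. y $ q \<odot> site q (h_mat a) + site q (site_term \<alpha> \<beta> x a))"
  define Rs where "Rs = (\<Sum>(u, v)\<in>D. pair_term x a u v)"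
  define W where "W = site i (site_term \<alpha> \<beta> x a) + site j (site_term \<alpha> \<beta> x a) + M + k \<odot> Rs"
  have sum: "(\<Sum>q\<in>UNIV. y $ q \<odot> site q (h_mat a) + site q (site_term \<alpha> \<beta> x a)) =
    y $ i \<odot> site i (h_mat a) + y $ j \<odot> site j (h_mat a) + site i (site_term \<alpha> \<beta> x a) + site j (site_term \<alpha> \<beta> x a) + M"
    using assms(2) by (simp add: M_def sum.remove[of UNIV i] sum.remove[of "UNIV - {i}" j] ac_simps)
  have L1: "L_order k \<alpha> \<beta> (insert (i, j) D) x a y
      = y $ i \<odot> site i (h_mat a) + y $ j \<odot> site j (h_mat a) + W + k \<odot> pair_term x a i j"
    unfolding L_order_def sum using nD by (simp add: W_def Rs_def cscale_distrib ac_simps)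
  have L2: "L_order k \<alpha> \<beta> (insert (j, i) D) x a y
      = y $ i \<odot> site i (h_mat a) + y $ j \<odot> site j (h_mat a) + W + k \<odot> pair_term x a j i"
    unfolding L_order_def sum using nD by (simp add: W_def Rs_def cscale_distrib ac_simps)
  have PM: "?P * M = M * ?P"
    unfolding M_def by (intro commute_rules) (auto simp: permop_site_simps)
  have "?P * Rs = (\<Sum>(u, v)\<in>D. pair_term x a (?t u) (?t v)) * ?P"
    by (simp add: Rs_def sum_distrib_left sum_distrib_right permop_pair_term case_prod_beta)
  also have "(\<Sum>(u, v)\<in>D. pair_term x a (?t u) (?t v)) = Rs"
    unfolding Rs_def
    by (rule sum.reindex_bij_witness[of _ "\<lambda>(u, v). (?t u, ?t v)" "\<lambda>(u, v). (?t u, ?t v)"])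
      (auto simp: D)
  finally have PR: "?P * Rs = Rs * ?P" .
  have PW: "?P * W = W * ?P"
    by (simp add: W_def distrib_left distrib_right PM PR permop_site_simps add.commute)
  show ?thesis
    unfolding L1 L2 R_num_def
    using swap_identity[OF PW permop_site_simps(1) permop_site_simps(2), of "pair_term x a i j" "pair_term x a j i"]
      pair_term_antisym[OF assms(2,1)] permop_pair_term[of i j x a i j]
    by (simp add: cscale_simps)
qed

text \<open>For neighbours i and j, every other site stands in the same relation to both, so the
  remaining pairs form a set that is invariant under the transposition.\<close>

lemma R_num_L_order_list_swap:
  fixes x :: "'N::finite point" and i j :: "'n::finite"
  assumes "regular_x x" "distinct (us @ i # j # vs)"
  shows "R_num k i j (y $ i - y $ j) * L_order k \<alpha> \<beta> (order_pairs (us @ i # j # vs)) x a y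
    = L_order k \<alpha> \<beta> (order_pairs (us @ j # i # vs)) x a y * R_num k i j (y $ i - y $ j)"
proof -
  define D where "D = order_pairs us \<union> order_pairs vs \<union> set us \<times> set vs \<union> set us \<times> {i, j} \<union> {i, j} \<times> set vs"
  have eq: "order_pairs (us @ i # j # vs) = insert (i, j) D" "order_pairs (us @ j # i # vs) = insert (j, i) D"
    by (auto simp: order_pairs_append D_def)
  have ij: "i \<noteq> j" "i \<notin> set us" "i \<notin> set vs" "j \<notin> set us" "j \<notin> set vs" using assms(2) by auto
  show ?thesis unfolding eq
  proof (rule R_num_L_order_swap[OF assms(1) ij(1)])
    show "(i, j) \<notin> D" "(j, i) \<notin> D"
      using ij order_pairs_subset[of us] order_pairs_subset[of vs] by (auto simp: D_def)
    let ?t = "Transposition.transpose i j"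
    have t: "?t q = q" if "q \<in> set us \<union> set vs" for q
      using ij that by (auto simp: Transposition.transpose_def)
    fix u v assume "(u, v) \<in> D"
    then consider "(u, v) \<in> order_pairs us" | "(u, v) \<in> order_pairs vs" | "u \<in> set us" "v \<in> set vs"
      | "u \<in> set us" "v \<in> {i, j}" | "u \<in> {i, j}" "v \<in> set vs"
      unfolding D_def by blast
    then show "(?t u, ?t v) \<in> D"
    proof cases
      case 1
      then have "?t u = u" "?t v = v" using order_pairs_subset[of us] by (auto simp: t)
      with 1 show ?thesis by (simp add: D_def)
    next
      case 2
      then have "?t u = u" "?t v = v" using order_pairs_subset[of vs] by (auto simp: t)
      with 2 show ?thesis by (simp add: D_def)
    qed (auto simp: t D_def)
  qed
qed

definition upd :: "'n::finite point \<Rightarrow> 'n \<Rightarrow> complex \<Rightarrow> 'n point"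
  where "upd y n w = (\<chi> j. if j = n then w else y $ j)"

lemma upd_simps [simp]: "upd y n w $ n = w" "j \<noteq> n \<Longrightarrow> upd y n w $ j = y $ j"
  by (simp_all add: upd_def)

lemma upd_upd [simp]: "upd (upd y n w) n w' = upd y n w'" "upd y n (y $ n) = y"
  by (simp_all add: upd_def vec_eq_iff)

lemma L_order_split:
  "L_order k \<alpha> \<beta> S x a (upd y n w) = w \<odot> site n (h_mat a) + site n (site_term \<alpha> \<beta> x a)
    + (L_order k \<alpha> \<beta> S x a (upd y n 0) - site n (site_term \<alpha> \<beta> x a))"
  by (simp add: L_order_def sum.remove[of UNIV n] upd_def)

lemma rest_commute:
  assumes "\<And>q i j. (i, j) \<in> S \<Longrightarrow> site n A * pair_term x a i j = pair_term x a i j * site n A"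
  shows "site n A * (L_order k \<alpha> \<beta> S x a (upd y n 0) - site n (site_term \<alpha> \<beta> x a))
    = (L_order k \<alpha> \<beta> S x a (upd y n 0) - site n (site_term \<alpha> \<beta> x a)) * site n A"
proof -
  have eq: "L_order k \<alpha> \<beta> S x a (upd y n 0) - site n (site_term \<alpha> \<beta> x a) =
     (\<Sum>j\<in>UNIV - {n}. y $ j \<odot> site j (h_mat a) + site j (site_term \<alpha> \<beta> x a)) + k \<odot> (\<Sum>(i, j)\<in>S. pair_term x a i j)"
    by (simp add: L_order_def sum.remove[of UNIV n])
  show ?thesis
    unfolding eq using assms by (intro commute_rules site_commute) (auto intro!: commute_rules)
qed

text \<open>Since T reverses the sign of h, the terms quadratic in z agree. The defect -2 \<alpha> z
  h of m accounts for the change of \<alpha> z h into -\<alpha> z h.\<close>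

lemma last_identity:
  fixes T :: "'i::finite opr"
  assumes "T * W = W * T" "T * h = - (h * T)" "T * m = m * T - (2 * \<alpha>) \<odot> h"
  shows "(z \<odot> T + \<alpha> \<odot> 1) * (z \<odot> h + m + W) = (- z \<odot> h + m + W) * (z \<odot> T + \<alpha> \<odot> 1)"
proof -
  have "(z \<odot> T + \<alpha> \<odot> 1) * (z \<odot> h + m + W) - (- z \<odot> h + m + W) * (z \<odot> T + \<alpha> \<odot> 1) = 0"
    by (simp add: distrib_left distrib_right left_diff_distrib right_diff_distrib assms cscale_distrib)
      (rule opr_eqI, simp)
  then show ?thesis by simp
qed

text \<open>The summand c z h T is the contribution of the derivative. It moves the centre of the
  reflection from 0 to -c/2, so that -(z + c/2) becomes z - c/2. With z = y - c/2 these two values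
  are -y and y - c.\<close>

lemma first_identity:
  fixes T :: "'i::finite opr"
  assumes "T * W = W * T" "T * h = - (h * T)" "T * m = m * T + (2 * \<beta>) \<odot> h"
  shows "(c * z) \<odot> (h * T) + ((z - c / 2) \<odot> h + m + W) * (z \<odot> T + \<beta> \<odot> 1)
    = (z \<odot> T + \<beta> \<odot> 1) * (- (z + c / 2) \<odot> h + m + W)"
proof -
  have "(c * z) \<odot> (h * T) + ((z - c / 2) \<odot> h + m + W) * (z \<odot> T + \<beta> \<odot> 1)
    - (z \<odot> T + \<beta> \<odot> 1) * (- (z + c / 2) \<odot> h + m + W) = 0"
    by (simp add: distrib_left distrib_right left_diff_distrib right_diff_distrib assms cscale_distrib)
      (rule opr_eqI, simp add: field_simps)
  then show ?thesis by simp
qed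

text \<open>The last site occurs only as second component of a pair, where all operators commute
  with T(1); only its one-site terms react to the boundary matrix.\<close>

lemma K_num_L_order_last:
  fixes x :: "'N::finite point" and n :: "'n::finite"
  assumes "distinct (us @ [n])"
  shows "K_num n z ones \<alpha> * L_order k \<alpha> \<beta> (order_pairs (us @ [n])) x a (upd y n z)
    = L_order k \<alpha> \<beta> (order_pairs (us @ [n])) x a (upd y n (- z)) * K_num n z ones \<alpha>"
proof -
  define W where "W = L_order k \<alpha> \<beta> (order_pairs (us @ [n])) x a (upd y n 0) - site n (site_term \<alpha> \<beta> x a)"
  have TW: "site n (T ones) * W = W * site n (T ones)"
    unfolding W_def
  proof (rule rest_commute)
    fix i j assume "(i, j) \<in> order_pairs (us @ [n])"
    then have "n \<noteq> i" using assms order_pairs_subset[of us] by (auto simp: order_pairs_append)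
    then show "site n (T ones) * pair_term x a i j = pair_term x a i j * site n (T ones)" by (rule T_ones_pair_term)
  qed
  have Th: "site n (T ones) * site n (h_mat a) = - (site n (h_mat a) * site n (T ones))"
    by (simp add: site_mult T_h_mat site_linear)
  have Tm: "site n (T ones) * site n (site_term \<alpha> \<beta> x a) = site n (site_term \<alpha> \<beta> x a) * site n (T ones) - (2 * \<alpha>) \<odot> site n (h_mat a)"
    by (simp add: site_mult T_ones_site_term site_linear)
  show ?thesis
    unfolding L_order_split[of _ _ _ _ _ _ y n z] L_order_split[of _ _ _ _ _ _ y n "- z"] W_def[symmetric] K_num_def
    by (simp add: last_identity[OF TW Th Tm, simplified])
qed

text \<open>For \<open>c = 0\<close> the derivative term disappears; this case enters the proof of \<open>[L\<^sub>a, L\<^sub>b] = 0\<close>.\<close>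

lemma K_num_L_order_first:
  fixes x :: "'N::finite point" and n :: "'n::finite"
  assumes "distinct (n # us)" "regular_x x"
  shows "(c * z) \<odot> site n (h_mat a * T x) + L_order k \<alpha> \<beta> (order_pairs (n # us)) x a (upd y n (z - c / 2)) * K_num n z x \<beta>
    = K_num n z x \<beta> * L_order k \<alpha> \<beta> (order_pairs (n # us)) x a (upd y n (- (z + c / 2)))"
proof -
  have x0: "x $ b \<noteq> 0" for b using assms(2) by (auto simp: regular_x_def)
  define W where "W = L_order k \<alpha> \<beta> (order_pairs (n # us)) x a (upd y n 0) - site n (site_term \<alpha> \<beta> x a)"
  have TW: "site n (T x) * W = W * site n (T x)"
    unfolding W_def
  proof (rule rest_commute)
    fix i j assume "(i, j) \<in> order_pairs (n # us)"
    then have "n \<noteq> j" using assms order_pairs_subset[of us] by auto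
    then show "site n (T x) * pair_term x a i j = pair_term x a i j * site n (T x)" using x0 by (rule T_pair_term)
  qed
  have Th: "site n (T x) * site n (h_mat a) = - (site n (h_mat a) * site n (T x))"
    by (simp add: site_mult T_h_mat x0 site_linear)
  have Tm: "site n (T x) * site n (site_term \<alpha> \<beta> x a) = site n (site_term \<alpha> \<beta> x a) * site n (T x) + (2 * \<beta>) \<odot> site n (h_mat a)"
    by (simp add: site_mult T_site_term[OF assms(2)] site_linear)
  show ?thesis
    unfolding L_order_split[of _ _ _ _ _ _ y n "z - c / 2"] L_order_split[of _ _ _ _ _ _ y n "- (z + c / 2)"] W_def[symmetric] K_num_def
      cscale_simps(8,9) first_identity[OF TW Th Tm, symmetric]
    by (simp add: cscale_distrib site_mult)
qed

lemma R_site_L_order_list_swap: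
  fixes x :: "'N::finite point" and i j :: "'n::finite"
  assumes "regular_x x" "distinct (us @ i # j # vs)"
  shows "R_site k i j (y $ i - y $ j) * L_order k \<alpha> \<beta> (order_pairs (us @ i # j # vs)) x a y
    = L_order k \<alpha> \<beta> (order_pairs (us @ j # i # vs)) x a y * R_site k i j (y $ i - y $ j)"
  by (simp add: R_site_def R_num_L_order_list_swap[OF assms])

lemma K_site_L_order_last:
  fixes x :: "'N::finite point" and n :: "'n::finite"
  assumes "distinct (us @ [n])"
  shows "K_site n z ones \<alpha> * L_order k \<alpha> \<beta> (order_pairs (us @ [n])) x a (upd y n z)
    = L_order k \<alpha> \<beta> (order_pairs (us @ [n])) x a (upd y n (- z)) * K_site n z ones \<alpha>"
  by (simp add: K_site_def K_num_L_order_last[OF assms])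

lemma K_site_L_order_first:
  fixes x :: "'N::finite point" and n :: "'n::finite"
  assumes "distinct (n # us)" "regular_x x"
  shows "(c * z / (z + \<beta>)) \<odot> site n (h_mat a * T x) + L_order k \<alpha> \<beta> (order_pairs (n # us)) x a (upd y n (z - c / 2)) * K_site n z x \<beta>
    = K_site n z x \<beta> * L_order k \<alpha> \<beta> (order_pairs (n # us)) x a (upd y n (- (z + c / 2)))"
  unfolding K_site_def cscale_simps(8,9) K_num_L_order_first[OF assms, symmetric] by (simp add: cscale_distrib)

subsection \<open>The differential and the difference part commute\<close>

definition Rprod :: "complex \<Rightarrow> 'n::finite \<Rightarrow> 'n list \<Rightarrow> ('n \<Rightarrow> complex) \<Rightarrow> ('n \<Rightarrow> 'N::finite idx) opr"
  where "Rprod k m js f = prod_list (map (\<lambda>j. R_site k m j (f j)) js)"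

lemma Rprod_simps [simp]:
  "Rprod k m [] f = 1" "Rprod k m (j # js) f = R_site k m j (f j) * Rprod k m js f"
  "Rprod k m (js @ js') f = Rprod k m js f * Rprod k m js' f"
  by (simp_all add: Rprod_def)

lemma Rprod_cong: "(\<And>j. j \<in> set js \<Longrightarrow> f j = g j) \<Longrightarrow> Rprod k m js f = Rprod k m js g"
  by (simp add: Rprod_def cong: map_cong)

lemma mult_move:
  fixes A :: "'a::semigroup_mult"
  assumes "A * L = L' * A" "B * L' = L'' * B"
  shows "(B * A) * L = L'' * (B * A)"
  by (metis assms mult.assoc)

lemma Rprod_L_order_right:
  fixes x :: "'N::finite point" and m :: "'n::finite"
  assumes "regular_x x" "distinct (us @ m # vs @ ws)"
  shows "Rprod k m (rev vs) (\<lambda>j. y $ m - y $ j) * L_order k \<alpha> \<beta> (order_pairs (us @ m # vs @ ws)) x a y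
    = L_order k \<alpha> \<beta> (order_pairs (us @ vs @ m # ws)) x a y * Rprod k m (rev vs) (\<lambda>j. y $ m - y $ j)"
  using assms(2)
proof (induction vs arbitrary: us)
  case Nil
  then show ?case by simp
next
  case (Cons v vs)
  have 1: "R_site k m v (y $ m - y $ v) * L_order k \<alpha> \<beta> (order_pairs (us @ m # v # vs @ ws)) x a y
    = L_order k \<alpha> \<beta> (order_pairs (us @ v # m # vs @ ws)) x a y * R_site k m v (y $ m - y $ v)"
    by (rule R_site_L_order_list_swap[OF assms(1)]) (use Cons.prems in simp)
  have 2: "Rprod k m (rev vs) (\<lambda>j. y $ m - y $ j) * L_order k \<alpha> \<beta> (order_pairs (us @ v # m # vs @ ws)) x a y
    = L_order k \<alpha> \<beta> (order_pairs (us @ v # vs @ m # ws)) x a y * Rprod k m (rev vs) (\<lambda>j. y $ m - y $ j)"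
    using Cons.IH[of "us @ [v]"] Cons.prems by auto
  show ?case
    using mult_move[OF 1 2] by simp
qed

lemma Rprod_L_order_left:
  fixes x :: "'N::finite point" and m :: "'n::finite"
  assumes "regular_x x" "distinct (us @ m # vs)"
  shows "Rprod k m us (\<lambda>j. y $ j - y $ m) * L_order k \<alpha> \<beta> (order_pairs (us @ m # vs)) x a y
    = L_order k \<alpha> \<beta> (order_pairs (m # us @ vs)) x a y * Rprod k m us (\<lambda>j. y $ j - y $ m)"
  using assms(2)
proof (induction us arbitrary: vs rule: rev_induct)
  case Nil
  then show ?case by simp
next
  case (snoc u us)
  have 1: "R_site k m u (y $ u - y $ m) * L_order k \<alpha> \<beta> (order_pairs (us @ u # m # vs)) x a y
    = L_order k \<alpha> \<beta> (order_pairs (us @ m # u # vs)) x a y * R_site k m u (y $ u - y $ m)"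
    unfolding R_site_commute[of k m u]
    by (rule R_site_L_order_list_swap[OF assms(1)]) (use snoc.prems in simp)
  have 2: "Rprod k m us (\<lambda>j. y $ j - y $ m) * L_order k \<alpha> \<beta> (order_pairs (us @ m # u # vs)) x a y
    = L_order k \<alpha> \<beta> (order_pairs (m # us @ u # vs)) x a y * Rprod k m us (\<lambda>j. y $ j - y $ m)"
    using snoc.IH[of "u # vs"] snoc.prems by auto
  show ?case
    using mult_move[OF 1 2] by simp
qed

definition Q_left :: "complex \<Rightarrow> complex \<Rightarrow> 'n list \<Rightarrow> 'n::finite \<Rightarrow> 'n point \<Rightarrow> ('n \<Rightarrow> 'N::finite idx) opr"
  where "Q_left c k us m y = Rprod k m (rev us) (\<lambda>j. y $ m - y $ j - c)"

definition Q_right :: "complex \<Rightarrow> complex \<Rightarrow> 'n list \<Rightarrow> 'n::finite \<Rightarrow> 'n list \<Rightarrow> 'n point \<Rightarrow> ('n \<Rightarrow> 'N::finite idx) opr"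
  where "Q_right k \<alpha> us m vs y = Rprod k m (us @ vs) (\<lambda>j. y $ m + y $ j) * K_site m (y $ m) ones \<alpha>
    * Rprod k m (rev vs) (\<lambda>j. y $ m - y $ j)"

text \<open>The factorization isolates the only factor that depends on x.\<close>

definition Q_split :: "complex \<Rightarrow> complex \<Rightarrow> complex \<Rightarrow> complex \<Rightarrow> 'n list \<Rightarrow> 'n::finite \<Rightarrow> 'n list \<Rightarrow> 'N::finite point \<Rightarrow> 'n point
    \<Rightarrow> ('n \<Rightarrow> 'N idx) opr"
  where "Q_split c k \<alpha> \<beta> us m vs x y = Q_left c k us m y * K_site m (y $ m - c / 2) x \<beta> * Q_right k \<alpha> us m vs y"

text \<open>After the reflection at the end of the order, \<open>m\<close> travels to the front with
  parameter -\<open>y_m\<close>. The difference of parameters is then \<open>y_j\<close> -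
  (-\<open>y_m\<close>), which is why sums occur in the second product.\<close>

lemma Q_right_L_order:
  fixes x :: "'N::finite point" and m :: "'n::finite"
  assumes "regular_x x" "distinct (us @ m # vs)"
  shows "Q_right k \<alpha> us m vs y * L_order k \<alpha> \<beta> (order_pairs (us @ m # vs)) x a y
    = L_order k \<alpha> \<beta> (order_pairs (m # us @ vs)) x a (upd y m (- (y $ m))) * Q_right k \<alpha> us m vs y"
proof -
  let ?y = "upd y m (- (y $ m))"
  have 1: "Rprod k m (rev vs) (\<lambda>j. y $ m - y $ j) * L_order k \<alpha> \<beta> (order_pairs (us @ m # vs)) x a y
    = L_order k \<alpha> \<beta> (order_pairs ((us @ vs) @ [m])) x a y * Rprod k m (rev vs) (\<lambda>j. y $ m - y $ j)"
    using Rprod_L_order_right[OF assms(1), of us m vs "[]"] assms(2) by simp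
  have 2: "K_site m (y $ m) ones \<alpha> * L_order k \<alpha> \<beta> (order_pairs ((us @ vs) @ [m])) x a y
    = L_order k \<alpha> \<beta> (order_pairs ((us @ vs) @ [m])) x a ?y * K_site m (y $ m) ones \<alpha>"
    using K_site_L_order_last[where us = "us @ vs" and n = m and z = "y $ m" and y = y] assms(2) by auto
  have 3: "Rprod k m (us @ vs) (\<lambda>j. y $ m + y $ j) = Rprod k m (us @ vs) (\<lambda>j. ?y $ j - ?y $ m)"
    using assms(2) by (intro Rprod_cong) (auto simp: upd_def)
  have 4: "Rprod k m (us @ vs) (\<lambda>j. y $ m + y $ j) * L_order k \<alpha> \<beta> (order_pairs ((us @ vs) @ [m])) x a ?y
    = L_order k \<alpha> \<beta> (order_pairs (m # us @ vs)) x a ?y * Rprod k m (us @ vs) (\<lambda>j. y $ m + y $ j)"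
    unfolding 3 using Rprod_L_order_left[OF assms(1), where us = "us @ vs" and m = m and vs = "[]" and y = ?y] assms(2) by auto
  show ?thesis
    unfolding Q_right_def by (rule mult_move[OF 1 mult_move[OF 2 4]])
qed

text \<open>The second reflection has left \<open>m\<close> with parameter \<open>y_m\<close> - c,
  so the differences on the way back to its place are \<open>y_m\<close> - \<open>y_j\<close> -
  c.\<close>

lemma Q_left_L_order:
  fixes x :: "'N::finite point" and m :: "'n::finite"
  assumes "regular_x x" "distinct (us @ m # vs)"
  shows "Q_left c k us m y * L_order k \<alpha> \<beta> (order_pairs (m # us @ vs)) x a (upd y m (y $ m - c))
    = L_order k \<alpha> \<beta> (order_pairs (us @ m # vs)) x a (upd y m (y $ m - c)) * Q_left c k us m y"
proof -
  let ?y = "upd y m (y $ m - c)"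
  have 1: "Q_left c k us m y = Rprod k m (rev us) (\<lambda>j. ?y $ m - ?y $ j)"
    unfolding Q_left_def using assms(2) by (intro Rprod_cong) (auto simp: upd_def)
  show ?thesis
    unfolding 1 using Rprod_L_order_right[OF assms(1), where us = "[]" and m = m and vs = us and ws = vs and y = ?y] assms(2) by auto
qed

text \<open>The first summand is c \<open>x_a\<close> times the derivative of \<open>Q_split\<close>
  in \<open>x_a\<close>, so this is the commutation of \<open>Dop\<close> with \<open>DeltaQ\<close>
  stripped of the function they act on.\<close>

lemma Q_split_L_order:
  fixes x :: "'N::finite point" and m :: "'n::finite"
  assumes "regular_x x" "distinct (us @ m # vs)"
  shows "Q_left c k us m y * ((c * (y $ m - c / 2) / (y $ m - c / 2 + \<beta>)) \<odot> site m (h_mat a * T x)) * Q_right k \<alpha> us m vs y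
      + L_order k \<alpha> \<beta> (order_pairs (us @ m # vs)) x a (upd y m (y $ m - c)) * Q_split c k \<alpha> \<beta> us m vs x y
    = Q_split c k \<alpha> \<beta> us m vs x y * L_order k \<alpha> \<beta> (order_pairs (us @ m # vs)) x a y"
proof -
  define L where "L = L_order k \<alpha> \<beta> (order_pairs (m # us @ vs)) x a (upd y m (y $ m - c))"
  define D where "D = (c * (y $ m - c / 2) / (y $ m - c / 2 + \<beta>)) \<odot> site m (h_mat a * T x)"
  define K where "K = K_site m (y $ m - c / 2) x \<beta>"
  have "L_order k \<alpha> \<beta> (order_pairs (us @ m # vs)) x a (upd y m (y $ m - c)) * Q_split c k \<alpha> \<beta> us m vs x y
      = Q_left c k us m y * (L * K) * Q_right k \<alpha> us m vs y"
    by (simp add: Q_split_def L_def K_def Q_left_L_order[OF assms, symmetric] mult.assoc[symmetric])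
  moreover have "Q_split c k \<alpha> \<beta> us m vs x y * L_order k \<alpha> \<beta> (order_pairs (us @ m # vs)) x a y
      = Q_left c k us m y * (K * L_order k \<alpha> \<beta> (order_pairs (m # us @ vs)) x a (upd y m (- (y $ m)))) * Q_right k \<alpha> us m vs y"
    by (simp add: Q_split_def K_def Q_right_L_order[OF assms] mult.assoc)
  moreover have "D + L * K = K * L_order k \<alpha> \<beta> (order_pairs (m # us @ vs)) x a (upd y m (- (y $ m)))"
    using K_site_L_order_first[of m "us @ vs" x c "y $ m - c / 2" \<beta> a k \<alpha> y] assms
    by (auto simp: D_def L_def K_def)
  ultimately show ?thesis
    unfolding D_def[symmetric] by (metis distrib_left distrib_right)
qed


subsection \<open>The differential parts commute\<close>

text \<open>Any site can be carried to either end: at the last place it can be tested against T(1),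
  at the first place against T(x).\<close>

lemma adjacent_invariant:
  assumes "\<And>us i j vs. distinct (us @ i # j # vs) \<Longrightarrow> set (us @ i # j # vs) = U
      \<Longrightarrow> \<phi> (us @ i # j # vs) = \<phi> (us @ j # i # vs)"
    and "distinct (us @ n # vs)" "set (us @ n # vs) = U"
  shows "\<phi> (us @ n # vs) = \<phi> (us @ vs @ [n])" "\<phi> (us @ n # vs) = \<phi> (n # us @ vs)"
proof -
  show "\<phi> (us @ n # vs) = \<phi> (us @ vs @ [n])"
    using assms(2,3)
  proof (induction vs arbitrary: us)
    case (Cons v vs)
    have "\<phi> (us @ n # v # vs) = \<phi> ((us @ [v]) @ n # vs)"
      using assms(1)[of us n v vs] Cons.prems by simp
    also have "\<dots> = \<phi> ((us @ [v]) @ vs @ [n])" by (rule Cons.IH) (use Cons.prems in auto)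
    finally show ?case by simp
  qed simp
  show "\<phi> (us @ n # vs) = \<phi> (n # us @ vs)"
    using assms(2,3)
  proof (induction us arbitrary: vs rule: rev_induct)
    case (snoc u us)
    have "\<phi> (us @ u # n # vs) = \<phi> (us @ n # u # vs)"
      using assms(1)[of us u n vs] snoc.prems by simp
    also have "\<dots> = \<phi> (n # us @ u # vs)" by (rule snoc.IH) (use snoc.prems in auto)
    finally show ?case by simp
  qed simp
qed

definition comm :: "'r::ring \<Rightarrow> 'r \<Rightarrow> 'r"
  where "comm A B = A * B - B * A"

lemma push_left: "(t::'r::ring) * A = A * t + Z \<Longrightarrow> t * (A * B) = A * (t * B) + Z * B"
  by (metis distrib_right mult.assoc)

text \<open>Intended for t at a site other than that of \<open>ha\<close> and \<open>hb\<close>: the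
  defects \<open>ga\<close>, \<open>gb\<close> then live at the site of t and drop out of the
  commutators.\<close>

lemma comm_commute_simple:
  fixes t :: "'i::finite opr"
  assumes h: "t * ha = ha * t" "t * hb = hb * t"
    and L: "t * La = La * t + g \<odot> ga" "t * Lb = Lb * t + g \<odot> gb"
    and c: "ha * gb = gb * ha" "hb * ga = ga * hb"
  shows "t * (comm ha Lb + comm La hb) = (comm ha Lb + comm La hb) * t"
proof -
  have 1: "t * (ha * B) = ha * (t * B)" "t * (hb * B) = hb * (t * B)"
    "t * (La * B) = La * (t * B) + g \<odot> (ga * B)" "t * (Lb * B) = Lb * (t * B) + g \<odot> (gb * B)" for B
    using push_left[OF L(1), of B] push_left[OF L(2), of B] h
    by (simp_all add: mult.assoc[symmetric])
  show ?thesis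
    by (simp add: comm_def distrib_left distrib_right left_diff_distrib right_diff_distrib 1 h L c mult.assoc)
qed

text \<open>Intended for t at the same site as \<open>ha\<close> and \<open>hb\<close>: the defects
  are multiples of \<open>ha\<close> and \<open>hb\<close> themselves, and these commute.\<close>

lemma comm_anticommute_simple:
  fixes t :: "'i::finite opr"
  assumes h: "t * ha = - (ha * t)" "t * hb = - (hb * t)"
    and L: "t * La = La * t + g \<odot> ha" "t * Lb = Lb * t + g \<odot> hb"
    and c: "ha * hb = hb * ha"
  shows "t * (comm ha Lb + comm La hb) = - ((comm ha Lb + comm La hb) * t)"
proof -
  have 1: "t * (ha * B) = - (ha * (t * B))" "t * (hb * B) = - (hb * (t * B))"
    "t * (La * B) = La * (t * B) + g \<odot> (ha * B)" "t * (Lb * B) = Lb * (t * B) + g \<odot> (hb * B)" for B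
    using push_left[OF L(1), of B] push_left[OF L(2), of B] h
    by (simp_all add: mult.assoc[symmetric])
  show ?thesis
    by (simp add: comm_def distrib_left distrib_right left_diff_distrib right_diff_distrib 1 h L c mult.assoc)
qed

text \<open>The defect of the commutator is g times a coefficient of y. This is why those
  coefficients must be shown to vanish before the constant term is treated.\<close>

lemma comm_commute_L:
  fixes t :: "'i::finite opr"
  assumes L: "t * La = La * t + g \<odot> ha" "t * Lb = Lb * t + g \<odot> hb"
    and K: "comm ha Lb + comm La hb = 0"
  shows "t * comm La Lb = comm La Lb * t"
proof -
  have 1: "t * (La * B) = La * (t * B) + g \<odot> (ha * B)" "t * (Lb * B) = Lb * (t * B) + g \<odot> (hb * B)" for B
    using push_left[OF L(1), of B] push_left[OF L(2), of B] by simp_all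
  have "t * comm La Lb = comm La Lb * t + g \<odot> (comm ha Lb + comm La hb)"
    by (simp add: comm_def distrib_left distrib_right left_diff_distrib right_diff_distrib 1 L mult.assoc cscale_distrib)
  then show ?thesis by (simp add: K)
qed

lemma comm_linear:
  fixes B :: "'i::finite opr"
  shows "comm (A + A') B = comm A B + comm A' B" "comm B (A + A') = comm B A + comm B A'"
    "comm (z \<odot> A) B = z \<odot> comm A B" "comm B (z \<odot> A) = z \<odot> comm B A"
    "comm (sum f S) B = (\<Sum>s\<in>S. comm (f s) B)" "comm B (sum f S) = (\<Sum>s\<in>S. comm B (f s))"
  by (simp_all add: comm_def distrib_left distrib_right sum_distrib_left sum_distrib_right cscale_distrib sum_subtractf)

definition L_zero :: "complex \<Rightarrow> complex \<Rightarrow> complex \<Rightarrow> 'N::finite point \<Rightarrow> 'n::finite list \<Rightarrow> 'N \<Rightarrow> ('n \<Rightarrow> 'N idx) opr"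
  where "L_zero k \<alpha> \<beta> x xs a = L_order k \<alpha> \<beta> (order_pairs xs) x a 0"

lemma L_order_L_zero: "L_order k \<alpha> \<beta> (order_pairs xs) x a y = (\<Sum>j\<in>UNIV. y $ j \<odot> site j (h_mat a)) + L_zero k \<alpha> \<beta> x xs a"
  by (simp add: L_zero_def L_order_def sum.distrib)

lemma L_order_L_zero_upd: "L_order k \<alpha> \<beta> (order_pairs xs) x a (upd 0 n z) = z \<odot> site n (h_mat a) + L_zero k \<alpha> \<beta> x xs a"
proof -
  have "(\<Sum>j\<in>UNIV. upd 0 n z $ j \<odot> site j (h_mat a)) = (\<Sum>j\<in>UNIV. if j = n then z \<odot> site n (h_mat a) else 0)"
    by (intro sum.cong) (auto simp: upd_def)
  then show ?thesis by (simp add: L_order_L_zero)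
qed

lemma ent_h_mat: "ent (h_mat a) p q = (if p = q then ent (h_mat a) p p else 0)"
  by (auto simp: h_mat_def ent_e)

lemma h_mat_commute: "h_mat a * h_mat b = h_mat b * h_mat a"
  by (simp add: h_mat_def algebra_simps e_mult)

lemma site_h_mat_commute: "site i (h_mat a) * site j (h_mat b) = site j (h_mat b) * site i (h_mat a)"
  by (rule site_commute') (rule h_mat_commute)

text \<open>The exchange relation holds for every difference z of the two parameters. At z = 0 only
  the permutation part of R survives; z = 1 then yields the identity part.\<close>

lemma L_zero_swap:
  fixes x :: "'N::finite point" and i j :: "'n::finite"
  assumes "k \<noteq> 0" "regular_x x" "distinct (us @ i # j # vs)"
  shows "permop i j * L_zero k \<alpha> \<beta> x (us @ i # j # vs) a = L_zero k \<alpha> \<beta> x (us @ j # i # vs) a * permop i j"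
    "L_zero k \<alpha> \<beta> x (us @ j # i # vs) a = L_zero k \<alpha> \<beta> x (us @ i # j # vs) a + k \<odot> comm (permop i j) (site i (h_mat a))"
proof -
  let ?L = "L_zero k \<alpha> \<beta> x (us @ i # j # vs) a" and ?L' = "L_zero k \<alpha> \<beta> x (us @ j # i # vs) a"
  have ij: "i \<noteq> j" using assms(3) by auto
  have *: "R_num k i j z * (z \<odot> site i (h_mat a) + ?L) = (z \<odot> site i (h_mat a) + ?L') * R_num k i j z" for z
    using R_num_L_order_list_swap[OF assms(2,3), of k "upd 0 i z" \<alpha> \<beta> a] ij by (simp add: L_order_L_zero_upd)
  have "k \<odot> (permop i j * ?L) = k \<odot> (?L' * permop i j)"
    using *[of 0] by (simp add: R_num_def)
  then have "(1 / k) \<odot> (k \<odot> (permop i j * ?L)) = (1 / k) \<odot> (k \<odot> (?L' * permop i j))" by simp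
  then show 1: "permop i j * ?L = ?L' * permop i j" using assms(1) by simp
  show "?L' = ?L + k \<odot> comm (permop i j) (site i (h_mat a))"
    using *[of 1] by (simp add: R_num_def distrib_left distrib_right 1 comm_def cscale_distrib algebra_simps)
qed

lemma T_L_zero:
  fixes x :: "'N::finite point" and n :: "'n::finite"
  assumes "distinct (us @ [n])"
  shows "site n (T ones) * L_zero k \<alpha> \<beta> x (us @ [n]) a
    = L_zero k \<alpha> \<beta> x (us @ [n]) a * site n (T ones) + (- 2 * \<alpha>) \<odot> site n (h_mat a)"
proof -
  let ?T = "site n (T ones)" and ?L = "L_zero k \<alpha> \<beta> x (us @ [n]) a" and ?h = "site n (h_mat a)"
  have Th: "?T * ?h = - (?h * ?T)" by (simp add: site_mult T_h_mat site_linear)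
  have "(?T + \<alpha> \<odot> 1) * (?h + ?L) = (- ?h + ?L) * (?T + \<alpha> \<odot> 1)"
    using K_num_L_order_last[OF assms, of 1 \<alpha> k \<beta> x a 0] by (simp add: L_order_L_zero_upd K_num_def)
  then have "?T * ?L + \<alpha> \<odot> ?h = ?L * ?T - \<alpha> \<odot> ?h"
    by (simp add: distrib_left distrib_right left_diff_distrib Th cscale_distrib) (simp add: add.commute)
  then have "?T * ?L = ?L * ?T - (\<alpha> \<odot> ?h + \<alpha> \<odot> ?h)" by (simp add: algebra_simps)
  then show ?thesis by (simp add: cscale_distrib(3)[symmetric])
qed

lemma T_L_zero_first:
  fixes x :: "'N::finite point" and n :: "'n::finite"
  assumes "distinct (n # us)" "regular_x x"
  shows "site n (T x) * L_zero k \<alpha> \<beta> x (n # us) a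
    = L_zero k \<alpha> \<beta> x (n # us) a * site n (T x) + (2 * \<beta>) \<odot> site n (h_mat a)"
proof -
  let ?T = "site n (T x)" and ?L = "L_zero k \<alpha> \<beta> x (n # us) a" and ?h = "site n (h_mat a)"
  have Th: "?T * ?h = - (?h * ?T)" using assms(2) by (simp add: site_mult T_h_mat site_linear regular_x_def)
  have "(?h + ?L) * (?T + \<beta> \<odot> 1) = (?T + \<beta> \<odot> 1) * (- ?h + ?L)"
    using K_num_L_order_first[OF assms, of 0 1 a k \<alpha> \<beta> 0] unfolding L_order_L_zero_upd K_num_def by simp
  then have "?L * ?T + \<beta> \<odot> ?h = ?T * ?L - \<beta> \<odot> ?h"
    by (simp add: distrib_left distrib_right left_diff_distrib right_diff_distrib Th cscale_distrib)
  then have "?T * ?L = ?L * ?T + (\<beta> \<odot> ?h + \<beta> \<odot> ?h)" by (simp add: algebra_simps)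
  then show ?thesis by (simp add: cscale_distrib(3)[symmetric])
qed

text \<open>\<open>T ones * T x\<close> is diagonal with distinct eigenvalues for regular \<open>x\<close>.\<close>

lemma diagonal_if_commute:
  fixes x :: "'N::finite point" and C :: "('n::finite \<Rightarrow> 'N idx) opr"
  assumes "regular_x x"
    and comm: "\<And>m. site m (T ones) * (site m (T x) * C) = C * (site m (T ones) * site m (T x))"
    and "I \<noteq> J"
  shows "ent C I J = 0"
proof -
  obtain m where m: "I m \<noteq> J m" using assms(3) by blast
  have nz: "x $ a \<noteq> 0" "x $ a * x $ b \<noteq> 1" "b \<noteq> a \<Longrightarrow> x $ a \<noteq> x $ b" for a b
    using assms(1) by (auto simp: regular_x_def)
  have inj: "tc x p \<noteq> tc x q" if "p \<noteq> q" for p q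
    using that nz by (cases p; cases q) (auto simp: field_simps)
  have D: "ent (T ones * T x) p q = (if p = q then tc x q else 0)" for p q
  proof -
    have "ent (T ones * T x) p q = (\<Sum>k\<in>UNIV. if k = bar q then (if p = q then tc x q else 0) else 0)"
      unfolding ent_mult ent_T by (intro sum.cong) auto
    then show ?thesis by simp
  qed
  let ?S = "site m (T ones * T x)"
  have "?S * C = C * ?S" using comm[of m] by (simp add: site_mult[symmetric] mult.assoc)
  then have "ent (?S * C) I J = ent (C * ?S) I J" by simp
  then have "tc x (I m) * ent C I J = ent C I J * tc x (J m)"
    by (simp add: ent_site_mult ent_mult_site D if_distrib[of "\<lambda>z. z * _"] if_distrib[of "\<lambda>z. _ * z"] cong: if_cong)
  then have "(tc x (I m) - tc x (J m)) * ent C I J = 0" by (simp add: algebra_simps)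
  with inj[OF m] show ?thesis by simp
qed


lemma comm_eq_0_iff: "comm A B = 0 \<longleftrightarrow> A * B = B * A"
  by (simp add: comm_def)

lemma comm_comm_0:
  assumes "h * P = P * h" "h * B = B * (h::'r::ring)"
  shows "comm h (comm P B) = 0"
  using commute_mult[OF assms] commute_mult[OF assms(2,1)]
  by (simp add: comm_def left_diff_distrib right_diff_distrib)

lemma comm_jacobi:
  assumes "h * g = g * (h::'r::ring)"
  shows "comm h (comm P g) + comm (comm P h) g = 0"
proof -
  have "h * (g * B) = g * (h * B)" for B by (simp add: assms mult.assoc[symmetric])
  then show ?thesis by (simp add: comm_def algebra_simps assms)
qed

text \<open>The coefficient of \<open>y\<^sub>q\<close> in \<open>[L\<^sub>a, L\<^sub>b]\<close>.\<close>

definition comm_coeff :: "complex \<Rightarrow> complex \<Rightarrow> complex \<Rightarrow> 'N::finite point \<Rightarrow> 'N \<Rightarrow> 'N \<Rightarrow> 'n::finite list \<Rightarrow> 'n \<Rightarrow> ('n \<Rightarrow> 'N idx) opr"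
  where "comm_coeff k \<alpha> \<beta> x a b xs q = comm (site q (h_mat a)) (L_zero k \<alpha> \<beta> x xs b) + comm (L_zero k \<alpha> \<beta> x xs a) (site q (h_mat b))"

text \<open>By \<open>L_zero_swap\<close> the exchange adds k [P, \<open>h_i\<close>] to L, so the
  coefficient changes by a sum of double commutators. For q among the two sites they cancel by the
  Jacobi identity; otherwise each one vanishes, as \<open>h_q\<close> commutes with P.\<close>

lemma comm_coeff_swap:
  fixes x :: "'N::finite point" and i j :: "'n::finite"
  assumes "k \<noteq> 0" "regular_x x" "distinct (us @ i # j # vs)"
  shows "comm_coeff k \<alpha> \<beta> x a b (us @ i # j # vs) q = comm_coeff k \<alpha> \<beta> x a b (us @ j # i # vs) q"
proof -
  define h where "h = (\<lambda>a j. site j (h_mat a) :: ('n \<Rightarrow> 'N idx) opr)"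
  define P where "P = (permop i j :: ('n \<Rightarrow> 'N idx) opr)"
  have h_mat: "h a i * h b j = h b j * h a i" for a b i j
    unfolding h_def by (rule site_h_mat_commute)
  have J: "comm (h a q) (comm P (h b i)) + comm (comm P (h a i)) (h b q) = 0"
  proof -
    consider "q = i" | "q = j" | "q \<noteq> i" "q \<noteq> j" by blast
    then show ?thesis
    proof cases
      case 1
      then show ?thesis using comm_jacobi[OF h_mat] by simp
    next
      case 2
      \<comment> \<open>P commutes with the sum of \<open>h\<close> over both sites, which reduces
        the case of j to that of i.\<close>
      have "comm P (h c i) = - comm P (h c j)" for c
        by (simp add: comm_def h_def P_def permop_site_simps)
      then have "comm (h a q) (comm P (h b i)) + comm (comm P (h a i)) (h b q)
        = - (comm (h a j) (comm P (h b j)) + comm (comm P (h a j)) (h b j))"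
        using 2 by (simp add: comm_def[of _ "- _"] comm_def[of "- _"] comm_def[of "h _ _" "comm _ _"] comm_def[of "comm _ _"])
      then show ?thesis using comm_jacobi[OF h_mat] by simp
    next
      case 3
      then have P: "h c q * P = P * h c q" for c
        by (simp add: h_def P_def permop_site_simps)
      have "comm (h a q) (comm P (h b i)) = 0"
        by (rule comm_comm_0[OF P h_mat])
      moreover have "comm (h b q) (comm P (h a i)) = 0"
        by (rule comm_comm_0[OF P h_mat])
      ultimately show ?thesis unfolding comm_eq_0_iff by (simp add: comm_def)
    qed
  qed
  have "comm_coeff k \<alpha> \<beta> x a b (us @ j # i # vs) q = comm_coeff k \<alpha> \<beta> x a b (us @ i # j # vs) q
    + k \<odot> (comm (h a q) (comm P (h b i)) + comm (comm P (h a i)) (h b q))"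
    unfolding comm_coeff_def L_zero_swap(2)[OF assms] comm_linear h_def P_def
    by (simp add: cscale_distrib algebra_simps)
  with J show ?thesis by simp
qed

lemma ent_comm_site_h_mat: "ent (comm (site j (h_mat a)) B) I I = 0" "ent (comm B (site j (h_mat a))) I I = 0"
proof -
  have "ent (site j (h_mat a) * B) I I = ent (h_mat a) (I j) (I j) * ent B I I"
    unfolding ent_site_mult by (subst ent_h_mat) (simp add: if_distrib[of "\<lambda>z. z * _"] cong: if_cong)
  moreover have "ent (B * site j (h_mat a)) I I = ent B I I * ent (h_mat a) (I j) (I j)"
    unfolding ent_mult_site by (subst ent_h_mat) (simp add: if_distrib[of "\<lambda>z. _ * z"] cong: if_cong)
  ultimately show "ent (comm (site j (h_mat a)) B) I I = 0" "ent (comm B (site j (h_mat a))) I I = 0"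
    by (simp_all add: comm_def)
qed

lemma comm_coeff_eq_0:
  fixes x :: "'N::finite point" and xs :: "'n::finite list"
  assumes "k \<noteq> 0" "regular_x x" "distinct xs" "set xs = UNIV"
  shows "comm_coeff k \<alpha> \<beta> x a b xs q = 0"
proof (rule opr_eqI)
  fix I J
  define C where "C = comm_coeff k \<alpha> \<beta> x a b xs q"
  have "site m (T ones) * (site m (T x) * C) = C * (site m (T ones) * site m (T x))" for m
  proof -
    obtain us vs where xs: "xs = us @ m # vs" using assms(4) by (metis UNIV_I split_list)
    have dist: "distinct (us @ m # vs)" "set (us @ m # vs) = UNIV" using assms(3,4) xs by auto
    have last: "C = comm_coeff k \<alpha> \<beta> x a b ((us @ vs) @ [m]) q"
      using adjacent_invariant(1)[where \<phi> = "\<lambda>xs. comm_coeff k \<alpha> \<beta> x a b xs q", OF comm_coeff_swap[OF assms(1,2)] dist] by (simp add: xs C_def)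
    have first: "C = comm_coeff k \<alpha> \<beta> x a b (m # us @ vs) q"
      using adjacent_invariant(2)[where \<phi> = "\<lambda>xs. comm_coeff k \<alpha> \<beta> x a b xs q", OF comm_coeff_swap[OF assms(1,2)] dist] by (simp add: xs C_def)
    have d: "distinct ((us @ vs) @ [m])" "distinct (m # us @ vs)" using dist by auto
    note T1 = T_L_zero[OF d(1), of k \<alpha> \<beta> x]
    note T2 = T_L_zero_first[OF d(2) assms(2), of k \<alpha> \<beta>]
    have x0: "x $ a \<noteq> 0" for a using assms(2) by (auto simp: regular_x_def)
    show ?thesis
    proof (cases "q = m")
      case True
      \<comment> \<open>Each of T(1) and T(x) contributes a sign; their product still commutes with
        \<open>C\<close>, and only the product is needed for diagonality.\<close>
      have "site m (T ones) * C = - (C * site m (T ones))"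
        unfolding last comm_coeff_def True
        by (rule comm_anticommute_simple[OF _ _ T1 T1]) (simp_all add: site_mult T_h_mat site_linear h_mat_commute)
      moreover have "site m (T x) * C = - (C * site m (T x))"
        unfolding first comm_coeff_def True
        by (rule comm_anticommute_simple[OF _ _ T2 T2]) (simp_all add: site_mult T_h_mat x0 site_linear h_mat_commute)
      ultimately show ?thesis by (simp add: mult.assoc[symmetric])
    next
      case False
      have "site m (T ones) * C = C * site m (T ones)"
        unfolding last comm_coeff_def
        by (rule comm_commute_simple[OF _ _ T1 T1]) (use False in \<open>simp_all add: site_commute\<close>)
      moreover have "site m (T x) * C = C * site m (T x)"
        unfolding first comm_coeff_def
        by (rule comm_commute_simple[OF _ _ T2 T2]) (use False in \<open>simp_all add: site_commute\<close>)
      ultimately show ?thesis by (simp add: mult.assoc[symmetric])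
    qed
  qed
  then have "ent C I J = 0" if "I \<noteq> J"
    using diagonal_if_commute[OF assms(2)] that by blast
  moreover have "ent C I I = 0"
    by (simp add: C_def comm_coeff_def ent_comm_site_h_mat)
  ultimately show "ent (comm_coeff k \<alpha> \<beta> x a b xs q) I J = ent 0 I J"
    by (cases "I = J") (auto simp: C_def)
qed

lemma comm_L_order:
  fixes x :: "'N::finite point" and y :: "'n::finite point"
  shows "comm (L_order k \<alpha> \<beta> (order_pairs xs) x a y) (L_order k \<alpha> \<beta> (order_pairs xs) x b y)
    = (\<Sum>j\<in>UNIV. y $ j \<odot> comm_coeff k \<alpha> \<beta> x a b xs j) + comm (L_zero k \<alpha> \<beta> x xs a) (L_zero k \<alpha> \<beta> x xs b)"
proof -
  have "comm (site i (h_mat a)) (site j (h_mat b)) = 0" for i j :: 'n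
    unfolding comm_eq_0_iff by (rule site_h_mat_commute)
  then show ?thesis
    by (simp add: L_order_L_zero comm_linear comm_coeff_def cscale_distrib sum.distrib)
qed

text \<open>A diagonal matrix that commutes with the transpositions and with the \<open>site m (T ones)\<close>
  is constant on the index sets that \<open>L_order\<close> connects.\<close>

definition symmetric_fun :: "(('n \<Rightarrow> 'N::finite idx) \<Rightarrow> complex) \<Rightarrow> bool"
  where "symmetric_fun \<phi> \<longleftrightarrow> (\<forall>I m. \<phi> (I(m := bar (I m))) = \<phi> I)
    \<and> (\<forall>I i j. i \<noteq> j \<longrightarrow> \<phi> (I \<circ> Transposition.transpose i j) = \<phi> I)"

text \<open>Block diagonality with respect to the level sets of \<phi>, phrased through entries so
  that no basis has to be reordered.\<close>

definition preserves :: "('i \<Rightarrow> complex) \<Rightarrow> 'i::finite opr \<Rightarrow> bool"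
  where "preserves \<phi> A \<longleftrightarrow> (\<forall>I J. \<phi> I \<noteq> \<phi> J \<longrightarrow> ent A I J = 0)"

fun base :: "'N idx \<Rightarrow> 'N"
  where "base (Inl a) = a" | "base (Inr a) = a"

lemma base_eqD: "base u = base v \<Longrightarrow> u = v \<or> u = bar v"
  by (cases u; cases v) auto

lemma symmetric_fun_upd:
  assumes "symmetric_fun \<phi>" "base u = base (I m)"
  shows "\<phi> (I(m := u)) = \<phi> I"
  using base_eqD[OF assms(2)] assms(1) by (auto simp: symmetric_fun_def)

lemma preserves_linear:
  "preserves \<phi> A \<Longrightarrow> preserves \<phi> B \<Longrightarrow> preserves \<phi> (A + B)"
  "preserves \<phi> A \<Longrightarrow> preserves \<phi> B \<Longrightarrow> preserves \<phi> (A - B)"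
  "preserves \<phi> A \<Longrightarrow> preserves \<phi> (z \<odot> A)"
  "(\<And>s. s \<in> S \<Longrightarrow> preserves \<phi> (f s)) \<Longrightarrow> preserves \<phi> (sum f S)"
  by (simp_all add: preserves_def ent_sum)

lemma preserves_site_e:
  fixes \<phi> :: "('n::finite \<Rightarrow> 'N::finite idx) \<Rightarrow> complex"
  assumes "symmetric_fun \<phi>" "base u = base v"
  shows "preserves \<phi> (site m (e u v))"
  unfolding preserves_def
proof (intro allI impI, rule ccontr)
  fix I J assume "\<phi> I \<noteq> \<phi> J" and "ent (site m (e u v)) I J \<noteq> 0"
  from this(2) have *: "I = J(m := u)" "J m = v"
    by (auto simp: ent_site ent_e fun_eq_iff split: if_splits)
  then have "\<phi> I = \<phi> J" using symmetric_fun_upd[OF assms(1), of u J m] assms(2) by simp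
  with \<open>\<phi> I \<noteq> \<phi> J\<close> show False ..
qed

text \<open>Up to bars, such an operator exchanges the indices at the two sites, and \<phi> is blind
  to both bars and transpositions. The intermediate tuple \<open>J'\<close> separates the two
  moves.\<close>

lemma preserves_site_e_site_e:
  fixes \<phi> :: "('n::finite \<Rightarrow> 'N::finite idx) \<Rightarrow> complex"
  assumes "symmetric_fun \<phi>" "base u = base z" "base v = base w" "i \<noteq> j"
  shows "preserves \<phi> (site i (e u v) * site j (e w z))"
  unfolding preserves_def
proof (intro allI impI, rule ccontr)
  fix I J assume "\<phi> I \<noteq> \<phi> J" and "ent (site i (e u v) * site j (e w z)) I J \<noteq> 0"
  from this(2) have *: "\<And>l. l \<noteq> i \<Longrightarrow> l \<noteq> j \<Longrightarrow> I l = J l" "I i = u" "J i = v" "I j = w" "J j = z"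
    by (auto simp: ent_site_site[OF assms(4)] ent_e split: if_splits)
  define J' where "J' = J \<circ> Transposition.transpose i j"
  have J': "J' i = z" "J' j = v" "\<And>l. l \<noteq> i \<Longrightarrow> l \<noteq> j \<Longrightarrow> J' l = J l"
    using assms(4) * by (auto simp: J'_def Transposition.transpose_def)
  have I: "I = (J'(i := u))(j := w)"
    using * J' assms(4) by (auto simp: fun_eq_iff)
  have "\<phi> I = \<phi> J'"
    unfolding I using symmetric_fun_upd[OF assms(1), of w "J'(i := u)" j]
      symmetric_fun_upd[OF assms(1), of u J' i] J' assms by simp
  also have "\<dots> = \<phi> J"
    using assms(1,4) by (simp add: J'_def symmetric_fun_def)
  finally show False using \<open>\<phi> I \<noteq> \<phi> J\<close> by simp
qed

lemma preserves_L_order: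
  fixes \<phi> :: "('n::finite \<Rightarrow> 'N::finite idx) \<Rightarrow> complex"
  assumes "symmetric_fun \<phi>" "distinct xs"
  shows "preserves \<phi> (L_order k \<alpha> \<beta> (order_pairs xs) x a y)"
proof -
  have "i \<noteq> j" if "(i, j) \<in> order_pairs xs" for i j
    using that assms(2) order_pairs_subset by (induction xs) fastforce+
  then have "preserves \<phi> (\<Sum>(i, j)\<in>order_pairs xs. pair_term x a i j)"
    unfolding pair_term_def X_pair_def Y_pair_def Z_pair_def E_mat_def Ebar_mat_def site_linear distrib_left
    by (auto intro!: preserves_linear preserves_site_e_site_e[OF assms(1)])
  moreover have "preserves \<phi> (site j (h_mat a))" "preserves \<phi> (site j (site_term \<alpha> \<beta> x a))" for j
    unfolding h_mat_def site_term_def Ebar_mat_def site_linear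
    by (auto intro!: preserves_linear preserves_site_e[OF assms(1)])
  ultimately show ?thesis
    unfolding L_order_def by (auto intro!: preserves_linear(1,3) preserves_linear(4)[of UNIV])
qed

text \<open>Taking the trace over one level set of the diagonal leaves the trace of a commutator of
  two blocks, which is zero; all summands are equal, so in characteristic zero each of them
  vanishes.\<close>

lemma diagonal_comm_eq_0:
  fixes A B :: "'i::finite opr"
  assumes diag: "\<And>I J. I \<noteq> J \<Longrightarrow> ent (comm A B) I J = 0"
    and pres: "preserves (\<lambda>I. ent (comm A B) I I) A" "preserves (\<lambda>I. ent (comm A B) I I) B"
  shows "comm A B = 0"
proof (rule opr_eqI)
  fix I J
  define \<phi> where "\<phi> = (\<lambda>I. ent (comm A B) I I)"
  define S where "S = {I'. \<phi> I' = \<phi> I}"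
  have "of_nat (card S) * \<phi> I = (\<Sum>I'\<in>S. \<phi> I')" by (simp add: S_def)
  also have "\<dots> = (\<Sum>I'\<in>S. \<Sum>J\<in>UNIV. ent A I' J * ent B J I' - ent B I' J * ent A J I')"
    by (simp add: \<phi>_def comm_def ent_mult sum_subtractf)
  also have "\<dots> = (\<Sum>I'\<in>S. \<Sum>J\<in>S. ent A I' J * ent B J I' - ent B I' J * ent A J I')"
  proof (rule sum.cong[OF refl], rule sum.mono_neutral_right, goal_cases)
    case (3 I')
    show ?case
    proof
    fix J assume *: "J \<in> UNIV - S"
    with 3 have "\<phi> I' \<noteq> \<phi> J" by (simp add: S_def)
    then have "ent A I' J = 0" "ent B I' J = 0"
      using pres by (auto simp: preserves_def \<phi>_def)
    then show "ent A I' J * ent B J I' - ent B I' J * ent A J I' = 0" by simp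
    qed
  qed auto
  also have "\<dots> = 0"
  proof -
    have "(\<Sum>I'\<in>S. \<Sum>J\<in>S. ent B I' J * ent A J I') = (\<Sum>I'\<in>S. \<Sum>J\<in>S. ent A I' J * ent B J I')"
      by (subst sum.swap) (simp add: mult.commute)
    then show ?thesis by (simp add: sum_subtractf)
  qed
  finally have "of_nat (card S) * \<phi> I = 0" .
  moreover have "card S \<noteq> 0" by (auto simp: S_def card_eq_0_iff)
  ultimately have "\<phi> I = 0" by simp
  then show "ent (comm A B) I J = ent 0 I J"
    using diag[of I J] by (cases "I = J") (auto simp: \<phi>_def)
qed

lemma L_order_commute:
  fixes x :: "'N::finite point" and xs :: "'n::finite list"
  assumes "k \<noteq> 0" "regular_x x" "distinct xs" "set xs = UNIV"
  shows "L_order k \<alpha> \<beta> (order_pairs xs) x a y * L_order k \<alpha> \<beta> (order_pairs xs) x b y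
    = L_order k \<alpha> \<beta> (order_pairs xs) x b y * L_order k \<alpha> \<beta> (order_pairs xs) x a y"
proof -
  define C where "C = (\<lambda>xs :: 'n list. comm (L_zero k \<alpha> \<beta> x xs a) (L_zero k \<alpha> \<beta> x xs b))"
  have C_L_order: "comm (L_order k \<alpha> \<beta> (order_pairs xs) x a y) (L_order k \<alpha> \<beta> (order_pairs xs) x b y) = C xs"
    if "distinct xs" "set xs = UNIV" for xs y
    using comm_coeff_eq_0[OF assms(1,2) that] by (simp add: comm_L_order C_def)
  have swap: "C (us @ i # j # vs) = C (us @ j # i # vs)"
    "permop i j * C (us @ i # j # vs) = C (us @ j # i # vs) * permop i j"
    if xs: "distinct (us @ i # j # vs)" "set (us @ i # j # vs) = UNIV" for us i j vs
  proof -
    have ij: "i \<noteq> j" using xs(1) by auto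
    let ?xs = "us @ i # j # vs" and ?xs' = "us @ j # i # vs"
    have xs': "distinct ?xs'" "set ?xs' = UNIV" using xs by auto
    \<comment> \<open>Since the coefficients of y vanish, \<open>C\<close> is the commutator at
      every y. Hence z is a free parameter here, and z = 0 and z = 1 give the two claims as in
      \<open>L_zero_swap\<close>.\<close>
    have *: "R_num k i j z * C ?xs = C ?xs' * R_num k i j z" for z
    proof -
      let ?R = "R_num k i j z" and ?L = "\<lambda>xs a. L_order k \<alpha> \<beta> (order_pairs xs) x a (upd 0 i z)"
      have y: "upd 0 i z $ i - upd 0 i z $ j = z"
        using ij by simp
      have R: "?R * ?L ?xs a = ?L ?xs' a * ?R" for a
        using R_num_L_order_list_swap[OF assms(2) xs(1), of k "upd 0 i z" \<alpha> \<beta> a] unfolding y .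
      have "?R * (?L ?xs a * ?L ?xs b) = ?L ?xs' a * ?L ?xs' b * ?R" for a b
        by (subst mult.assoc[symmetric], subst R, subst mult.assoc, subst R, simp only: mult.assoc)
      then show ?thesis
        unfolding C_L_order[OF xs, of "upd 0 i z", symmetric] C_L_order[OF xs', of "upd 0 i z", symmetric]
        by (simp add: comm_def left_diff_distrib right_diff_distrib)
    qed
    have "k \<odot> (permop i j * C ?xs) = k \<odot> (C ?xs' * permop i j)"
      using *[of 0] by (simp add: R_num_def)
    then have "(1 / k) \<odot> (k \<odot> (permop i j * C ?xs)) = (1 / k) \<odot> (k \<odot> (C ?xs' * permop i j))" by simp
    then show 1: "permop i j * C ?xs = C ?xs' * permop i j" using assms(1) by simp
    show "C ?xs = C ?xs'"
      using *[of 1] by (simp add: R_num_def distrib_left distrib_right 1)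
  qed
  have T: "site m (T ones) * C xs = C xs * site m (T ones)" "site m (T x) * C xs = C xs * site m (T x)" for m
  proof -
    obtain us vs where xs: "xs = us @ m # vs" using assms(4) by (metis UNIV_I split_list)
    have dist: "distinct (us @ m # vs)" "set (us @ m # vs) = UNIV" using assms(3,4) xs by auto
    have last: "C xs = C ((us @ vs) @ [m])"
      using adjacent_invariant(1)[where \<phi> = C, OF swap(1) dist] by (simp add: xs)
    have first: "C xs = C (m # us @ vs)"
      using adjacent_invariant(2)[where \<phi> = C, OF swap(1) dist] by (simp add: xs)
    have d: "distinct ((us @ vs) @ [m])" "distinct (m # us @ vs)"
      "set ((us @ vs) @ [m]) = UNIV" "set (m # us @ vs) = UNIV" using dist by auto
    note T1 = T_L_zero[OF d(1), of k \<alpha> \<beta> x]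
    note T2 = T_L_zero_first[OF d(2) assms(2), of k \<alpha> \<beta>]
    note K = comm_coeff_eq_0[OF assms(1,2), unfolded comm_coeff_def]
    show "site m (T ones) * C xs = C xs * site m (T ones)"
      unfolding last unfolding C_def by (rule comm_commute_L[OF T1 T1 K[OF d(1,3)]])
    show "site m (T x) * C xs = C xs * site m (T x)"
      unfolding first unfolding C_def by (rule comm_commute_L[OF T2 T2 K[OF d(2,4)]])
  qed
  \<comment> \<open>The exchange relations are available for neighbours only. Moving j and then i to
    the front makes any two sites neighbours without changing \<open>C\<close>.\<close>
  have P: "permop i j * C xs = C xs * permop i j" if "i \<noteq> j" for i j
  proof -
    obtain us vs where xs: "xs = us @ j # vs" using assms(4) by (metis UNIV_I split_list)
    have 1: "C xs = C (j # us @ vs)"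
      using adjacent_invariant(2)[where \<phi> = C, OF swap(1)] assms(3,4) by (simp add: xs)
    have "i \<in> set (us @ vs)" using assms(4) that xs by auto
    then obtain us' vs' where xs': "us @ vs = us' @ i # vs'" by (metis split_list)
    have d: "distinct ((j # us') @ i # vs')" "set ((j # us') @ i # vs') = UNIV"
      using assms(3,4) xs xs'[symmetric] by auto
    have 2: "C (j # us @ vs) = C ([] @ i # j # us' @ vs')"
      using adjacent_invariant(2)[where \<phi> = C, OF swap(1) d] by (simp add: xs')
    have d': "distinct ([] @ i # j # us' @ vs')" "set ([] @ i # j # us' @ vs') = UNIV"
      using d by auto
    show ?thesis unfolding 1 2 using swap[OF d'] by simp
  qed
  have diag: "ent (C xs) I J = 0" if "I \<noteq> J" for I J
    by (rule diagonal_if_commute[OF assms(2) _ that]) (simp only: T(2), simp only: mult.assoc[symmetric] T(1))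
  have "symmetric_fun (\<lambda>I. ent (C xs) I I)"
    unfolding symmetric_fun_def
  proof (intro conjI allI impI)
    fix I :: "'n \<Rightarrow> 'N idx" and m
    let ?J = "I(m := bar (I m))"
    have "ent (site m (T ones) * C xs) I ?J = ent (C xs) ?J ?J"
    proof -
      have "ent (site m (T ones) * C xs) I ?J
        = (\<Sum>u\<in>UNIV. if u = bar (I m) then ent (C xs) ?J ?J else 0)"
        unfolding ent_site_mult ent_T by (intro sum.cong) auto
      then show ?thesis by simp
    qed
    moreover have "ent (C xs * site m (T ones)) I ?J = ent (C xs) I I"
    proof -
      have "ent (C xs * site m (T ones)) I ?J = (\<Sum>u\<in>UNIV. if u = I m then ent (C xs) I I else 0)"
        unfolding ent_mult_site ent_T by (intro sum.cong) auto
      then show ?thesis by simp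
    qed
    ultimately show "ent (C xs) ?J ?J = ent (C xs) I I" by (simp add: T)
  next
    fix I :: "'n \<Rightarrow> 'N idx" and i j :: 'n assume "i \<noteq> j"
    let ?t = "Transposition.transpose i j"
    have "ent (permop i j * C xs) I (I \<circ> ?t) = ent (C xs * permop i j) I (I \<circ> ?t)"
      using P[OF \<open>i \<noteq> j\<close>] by simp
    then show "ent (C xs) (I \<circ> ?t) (I \<circ> ?t) = ent (C xs) I I"
      by (simp add: ent_permop_mult ent_mult_permop comp_assoc)
  qed
  note pres = preserves_L_order[OF this assms(3), of k \<alpha> \<beta> x _ 0, folded L_zero_def]
  have "C xs = 0"
    unfolding C_def by (rule diagonal_comm_eq_0[OF diag[unfolded C_def] pres[unfolded C_def] pres[unfolded C_def]])
  with C_L_order[OF assms(3,4), of y] show ?thesis unfolding comm_def by simp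
qed

subsection \<open>The difference parts commute\<close>

lemma R_site_unitary:
  assumes "z + k \<noteq> 0" "- z + k \<noteq> 0"
  shows "R_site k i j z * R_site k i j (- z) = (1 :: ('n::finite \<Rightarrow> 'N::finite idx) opr)"
proof -
  have "R_num k i j z * R_num k i j (- z) = (((z + k) * (- z + k)) \<odot> 1 :: ('n \<Rightarrow> 'N idx) opr)"
    unfolding R_num_def distrib_left distrib_right cscale_simps permop_square
    by (rule opr_eqI) (simp add: algebra_simps)
  then show ?thesis using assms by (simp add: R_site_def)
qed

lemma Yang_Baxter:
  fixes i j l :: "'n::finite"
  assumes "i \<noteq> j" "j \<noteq> l" "i \<noteq> l"
  shows "R_site k i j u * (R_site k i l (u + v) * R_site k j l v)
    = (R_site k j l v * (R_site k i l (u + v) * R_site k i j u) :: ('n \<Rightarrow> 'N::finite idx) opr)"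
proof -
  define A where "A = (permop i j :: ('n \<Rightarrow> 'N idx) opr)"
  define B where "B = (permop i l :: ('n \<Rightarrow> 'N idx) opr)"
  define D where "D = (permop j l :: ('n \<Rightarrow> 'N idx) opr)"
  have AB: "A * B = D * A" "A * D = D * B" "D * D = 1"
    using permop_permop[OF assms] by (simp_all add: A_def B_def D_def permop_square)
  have BA: "B * D = D * A" "B * A = D * B"
    using permop_permop[of i l j] assms by (simp_all add: A_def B_def D_def permop_commute)
  \<comment> \<open>Moving \<open>D\<close> to the left leaves the normal forms 1, \<open>A\<close>,
    \<open>B\<close>, \<open>D\<close>, \<open>D * A\<close>, \<open>D * B\<close>, one for each
    permutation of the three sites; afterwards only scalar coefficients have to be compared.\<close>
  have left: "A * (B * X) = D * (A * X)" "A * (D * X) = D * (B * X)" "D * (D * X) = X" "B * (D * X) = D * (A * X)"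
    "B * (A * X) = D * (B * X)" for X
    by (simp_all add: AB BA mult.assoc[symmetric])
  have "R_num k i j u * (R_num k i l (u + v) * R_num k j l v)
    = (R_num k j l v * (R_num k i l (u + v) * R_num k i j u) :: ('n \<Rightarrow> 'N idx) opr)"
    unfolding R_num_def A_def[symmetric] B_def[symmetric] D_def[symmetric]
    by (simp add: distrib_left distrib_right AB BA left cscale_distrib) (rule opr_eqI, simp add: algebra_simps)
  then show ?thesis by (simp add: R_site_def mult_ac)
qed

lemma R_site_disjoint: "{i, j} \<inter> {l, m} = {} \<Longrightarrow> R_site k i j u * R_site k l m v = R_site k l m v * R_site k i j u"
  by (simp add: R_site_def R_num_def distrib_left distrib_right permop_permop_disjoint mult_ac cscale_distrib)

lemma R_site_K_site_disjoint: "m \<noteq> i \<Longrightarrow> m \<noteq> j \<Longrightarrow> R_site k i j u * K_site m v x b = K_site m v x b * R_site k i j u"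
  by (simp add: R_site_def R_num_def K_site_def K_num_def distrib_left distrib_right permop_site_simps mult_ac cscale_distrib)

text \<open>The only property of T(x) that enters is that its square is 1, so the equation covers
  the boundary matrices at both ends.\<close>

lemma K_site_reflection:
  fixes x :: "'N::finite point"
  assumes "i \<noteq> j" "\<And>a. x $ a \<noteq> 0"
  shows "R_site k i j (u - v) * (K_site i u x b * (R_site k i j (u + v) * K_site j v x b))
    = K_site j v x b * (R_site k i j (u + v) * (K_site i u x b * R_site k i j (u - v)))"
proof -
  define P where "P = (permop i j :: (_ \<Rightarrow> 'N idx) opr)"
  define A where "A = site i (T x)"
  define B where "B = site j (T x)"
  have rules: "P * A = B * P" "P * B = A * P" "B * A = A * B" "A * A = 1" "B * B = 1" "P * P = 1"
    using assms by (simp_all add: P_def A_def B_def permop_site_simps site_commute site_mult T_square site_one permop_square)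
  have left: "P * (A * X) = B * (P * X)" "P * (B * X) = A * (P * X)" "B * (A * X) = A * (B * X)" "A * (A * X) = X"
    "B * (B * X) = X" "P * (P * X) = X" for X
    by (simp_all add: rules mult.assoc[symmetric])
  have "R_num k i j (u - v) * (K_num i u x b * (R_num k i j (u + v) * K_num j v x b))
    = K_num j v x b * (R_num k i j (u + v) * (K_num i u x b * R_num k i j (u - v)))"
    unfolding R_num_def K_num_def A_def[symmetric] B_def[symmetric] P_def[symmetric]
    by (simp add: distrib_left distrib_right rules left cscale_distrib mult.assoc) (rule opr_eqI, simp add: algebra_simps)
  then show ?thesis by (simp add: R_site_def K_site_def mult_ac)
qed

lemma Rprod_commute:
  assumes "\<And>j. j \<in> set js \<Longrightarrow> A * R_site k m j (f j) = R_site k m j (f j) * A"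
  shows "A * Rprod k m js f = Rprod k m js f * A"
  using assms by (induction js) (auto intro!: commute_mult)

lemma Rprod_R_site_disjoint:
  assumes "{i, j} \<inter> insert m (set js) = {}"
  shows "R_site k i j u * Rprod k m js f = Rprod k m js f * R_site k i j u"
  using assms by (intro Rprod_commute R_site_disjoint) auto

text \<open>Sklyanin's dressing of the boundary matrix by the sites \<open>ws\<close>.\<close>

definition dressed_K :: "complex \<Rightarrow> complex \<Rightarrow> ('n::finite \<Rightarrow> complex) \<Rightarrow> 'n list \<Rightarrow> 'n \<Rightarrow> complex \<Rightarrow> ('n \<Rightarrow> 'N::finite idx) opr"
  where "dressed_K k \<alpha> f ws i u = Rprod k i ws (\<lambda>j. u + f j) * (K_site i u ones \<alpha> * Rprod k i (rev ws) (\<lambda>j. u - f j))"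

lemma dressed_K_Cons: "dressed_K k \<alpha> f (w # ws) i u = R_site k i w (u + f w) * (dressed_K k \<alpha> f ws i u * R_site k i w (u - f w))"
  by (simp add: dressed_K_def mult.assoc)

lemma dressed_K_R_site_disjoint:
  assumes "{i, j} \<inter> insert m (set ws) = {}"
  shows "R_site k i j v * dressed_K k \<alpha> f ws m u = dressed_K k \<alpha> f ws m u * R_site k i j v"
  unfolding dressed_K_def using assms
  by (intro commute_mult Rprod_R_site_disjoint R_site_K_site_disjoint) auto

text \<open>Here \<open>X\<close> and \<open>Y\<close> are the boundary matrices at two sites before
  the dressing by a further site w; \<open>A1\<close>, \<open>A2\<close> and \<open>B1\<close>,
  \<open>B2\<close> are the R-matrices that couple these sites to w. Hypotheses 1 to 4 are
  Yang-Baxter equations that bring the inner reflection equation \<open>IH\<close> into position and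
  restore the order of the factors afterwards.\<close>

lemma dressing_step:
  fixes R1 :: "'r::semigroup_mult"
  assumes 1: "A2 * (R2 * B1) = B1 * (R2 * A2)" and 2: "R1 * (A1 * B1) = B1 * (A1 * R1)"
    and 3: "R1 * (A2 * B2) = B2 * (A2 * R1)" and 4: "A1 * (R2 * B2) = B2 * (R2 * A1)"
    and XB1: "B1 * X = X * B1" and XB2: "B2 * X = X * B2" and YA1: "A1 * Y = Y * A1" and YA2: "A2 * Y = Y * A2"
    and IH: "R1 * (X * (R2 * Y)) = Y * (R2 * (X * R1))"
  shows "R1 * (A1 * (X * A2) * (R2 * (B1 * (Y * B2)))) = B1 * (Y * B2) * (R2 * (A1 * (X * A2) * R1))"
proof -
  have "R1 * (A1 * (X * A2) * (R2 * (B1 * (Y * B2)))) = R1 * A1 * X * (A2 * (R2 * B1)) * Y * B2"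
    by (simp add: mult.assoc)
  also have "\<dots> = R1 * A1 * (X * B1) * R2 * (A2 * Y) * B2" by (simp only: 1) (simp add: mult.assoc)
  also have "\<dots> = (R1 * (A1 * B1)) * X * R2 * Y * A2 * B2"
    by (simp only: XB1[symmetric] YA2) (simp add: mult.assoc)
  also have "\<dots> = B1 * A1 * (R1 * (X * (R2 * Y))) * A2 * B2" by (simp only: 2) (simp add: mult.assoc)
  also have "\<dots> = B1 * A1 * Y * R2 * X * (R1 * (A2 * B2))" by (simp only: IH) (simp add: mult.assoc)
  also have "\<dots> = B1 * (A1 * Y) * R2 * (X * B2) * A2 * R1" by (simp only: 3) (simp add: mult.assoc)
  also have "\<dots> = B1 * Y * (A1 * (R2 * B2)) * X * A2 * R1"
    by (simp only: XB2[symmetric] YA1) (simp add: mult.assoc)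
  also have "\<dots> = B1 * (Y * B2) * (R2 * (A1 * (X * A2) * R1))" by (simp only: 4) (simp add: mult.assoc)
  finally show ?thesis .
qed

lemma dressed_K_reflection:
  fixes i j :: "'n::finite"
  assumes "distinct (i # j # ws)"
  shows "R_site k i j (u - v) * (dressed_K k \<alpha> f ws i u * (R_site k i j (u + v) * dressed_K k \<alpha> f ws j v))
    = (dressed_K k \<alpha> f ws j v * (R_site k i j (u + v) * (dressed_K k \<alpha> f ws i u * R_site k i j (u - v))) :: ('n \<Rightarrow> 'N::finite idx) opr)"
  using assms
proof (induction ws)
  case Nil
  then show ?case by (simp add: dressed_K_def K_site_reflection)
next
  case (Cons w ws)
  have neq: "i \<noteq> j" "j \<noteq> w" "i \<noteq> w" "w \<notin> set ws" "i \<notin> set ws" "j \<notin> set ws" using Cons.prems by auto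
  let ?R = "R_site k :: 'n \<Rightarrow> 'n \<Rightarrow> complex \<Rightarrow> ('n \<Rightarrow> 'N idx) opr"
  let ?U = "dressed_K k \<alpha> f ws :: 'n \<Rightarrow> complex \<Rightarrow> ('n \<Rightarrow> 'N idx) opr"
  show ?case
    unfolding dressed_K_Cons
  proof (rule dressing_step)
    show "?R i w (u - f w) * (?R i j (u + v) * ?R j w (v + f w)) = ?R j w (v + f w) * (?R i j (u + v) * ?R i w (u - f w))"
      using Yang_Baxter[of i w j k "u - f w" "v + f w"] neq by (simp add: R_site_commute[of k w j])
    show "?R i w (u + f w) * (?R i j (u + v) * ?R j w (v - f w)) = ?R j w (v - f w) * (?R i j (u + v) * ?R i w (u + f w))"
      using Yang_Baxter[of i w j k "u + f w" "v - f w"] neq by (simp add: R_site_commute[of k w j])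
    show "?R i j (u - v) * (?R i w (u + f w) * ?R j w (v + f w)) = ?R j w (v + f w) * (?R i w (u + f w) * ?R i j (u - v))"
      using Yang_Baxter[of i j w k "u - v" "v + f w"] neq by simp
    show "?R i j (u - v) * (?R i w (u - f w) * ?R j w (v - f w)) = ?R j w (v - f w) * (?R i w (u - f w) * ?R i j (u - v))"
      using Yang_Baxter[of i j w k "u - v" "v - f w"] neq by simp
    show "?R i j (u - v) * (?U i u * (?R i j (u + v) * ?U j v))
      = ?U j v * (?R i j (u + v) * (?U i u * ?R i j (u - v)))"
      using Cons by simp
  qed (use neq in \<open>auto intro!: dressed_K_R_site_disjoint\<close>)
qed

text \<open>Only the two factors at i and j interact with the R-matrix, by the Yang-Baxter equation;
  all others act on disjoint sites.\<close>

lemma Rprod_swap: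
  fixes m i j :: "'n::finite"
  assumes "distinct (m # p @ i # j # q)"
  shows "R_site k i j (f i - f j) * Rprod k m (p @ i # j # q) f
    = (Rprod k m (p @ j # i # q) f * R_site k i j (f i - f j) :: ('n \<Rightarrow> 'N::finite idx) opr)"
proof -
  let ?R = "R_site k i j (f i - f j) :: ('n \<Rightarrow> 'N idx) opr"
  have p: "?R * Rprod k m p f = Rprod k m p f * ?R" and q: "?R * Rprod k m q f = Rprod k m q f * ?R"
    using assms by (auto intro!: Rprod_R_site_disjoint)
  have Y: "?R * (R_site k m i (f i) * R_site k m j (f j)) = R_site k m j (f j) * (R_site k m i (f i) * ?R)"
    using Yang_Baxter[of i j m k "f i - f j" "f j"] assms by (auto simp: R_site_commute[of k _ m])
  have "?R * Rprod k m (p @ i # j # q) f = Rprod k m p f * (?R * (R_site k m i (f i) * R_site k m j (f j))) * Rprod k m q f"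
    by (simp add: p mult.assoc[symmetric])
  also have "\<dots> = Rprod k m p f * R_site k m j (f j) * R_site k m i (f i) * (?R * Rprod k m q f)"
    unfolding Y by (simp add: mult.assoc)
  finally show ?thesis unfolding q by (simp add: mult.assoc)
qed

section \<open>Difference operators for an arbitrary order of the sites\<close>

definition Q_order :: "complex \<Rightarrow> complex \<Rightarrow> complex \<Rightarrow> complex \<Rightarrow> 'N::finite point \<Rightarrow> 'n list \<Rightarrow> 'n::finite \<Rightarrow> 'n point
    \<Rightarrow> ('n \<Rightarrow> 'N idx) opr"
  where "Q_order c k \<alpha> \<beta> x xs m y = Q_split c k \<alpha> \<beta> (takeWhile (\<lambda>j. j \<noteq> m) xs) m (tl (dropWhile (\<lambda>j. j \<noteq> m) xs)) x y"

lemma Q_order_append: "m \<notin> set us \<Longrightarrow> Q_order c k \<alpha> \<beta> x (us @ m # vs) m y = Q_split c k \<alpha> \<beta> us m vs x y"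
proof -
  assume "m \<notin> set us"
  then have "\<forall>j\<in>set us. j \<noteq> m" by blast
  then show ?thesis by (simp add: Q_order_def)
qed

definition shift :: "complex \<Rightarrow> 'n::finite \<Rightarrow> 'n point \<Rightarrow> 'n point"
  where "shift c m y = upd y m (y $ m - c)"

lemma shift_simps [simp]: "shift c m y $ m = y $ m - c" "j \<noteq> m \<Longrightarrow> shift c m y $ j = y $ j"
  by (simp_all add: shift_def)

lemma shift_commute: "shift c l (shift c m y) = shift c m (shift c l y)"
  by (auto simp: shift_def upd_def vec_eq_iff)

text \<open>Unitarity of the \<open>R\<close>-matrices needs shifts by all integer multiples of \<open>c\<close>, although admissible
  domains are closed under forward shifts only: a forward shift of \<open>y\<^sub>j\<close> is a backward shift of
  \<open>y\<^sub>i - y\<^sub>j\<close>.\<close>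

definition generic :: "complex \<Rightarrow> complex \<Rightarrow> 'n::finite point \<Rightarrow> bool"
  where "generic c k y \<longleftrightarrow> (\<forall>i j z. i \<noteq> j \<longrightarrow> y $ i - y $ j + c * of_int z + k \<noteq> 0)"

lemma genericD:
  assumes "generic c k y" "i \<noteq> j"
  shows "y $ i - y $ j + k \<noteq> 0" "y $ i - y $ j - c + k \<noteq> 0" "y $ i - y $ j + c + k \<noteq> 0"
proof -
  have *: "y $ i - y $ j + c * of_int z + k \<noteq> 0" for z
    using assms unfolding generic_def by blast
  show "y $ i - y $ j + k \<noteq> 0" "y $ i - y $ j - c + k \<noteq> 0" "y $ i - y $ j + c + k \<noteq> 0"
    using *[of 0] *[of "-1"] *[of 1] by simp_all
qed

lemma generic_shift:
  assumes "generic c k y"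
  shows "generic c k (shift c m y)"
  unfolding generic_def
proof (intro allI impI)
  fix i j :: 'a and z assume "i \<noteq> j"
  then have *: "y $ i - y $ j + c * of_int w + k \<noteq> 0" for w
    using assms unfolding generic_def by blast
  show "shift c m y $ i - shift c m y $ j + c * of_int z + k \<noteq> 0"
    using *[of z] *[of "z - 1"] *[of "z + 1"] \<open>i \<noteq> j\<close>
    by (cases "i = m"; cases "j = m") (auto simp: algebra_simps)
qed

lemma mult_move': "A * L = L' * A \<Longrightarrow> A * M = M' * A \<Longrightarrow> A * (L * M) = (L' * M') * (A :: 'r::semigroup_mult)"
  by (metis mult.assoc)

text \<open>Exchanging two neighbours in the order of the sites is a gauge transformation of the difference
  operators.\<close>

lemma gauge:
  fixes i j :: "'n::finite" and x :: "'N::finite point"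
  assumes dist: "distinct (us @ i # j # vs)" and m: "m \<in> set (us @ i # j # vs)" and gen: "generic c k y"
  shows "R_site k i j (shift c m y $ i - shift c m y $ j) * Q_order c k \<alpha> \<beta> x (us @ i # j # vs) m y
    = Q_order c k \<alpha> \<beta> x (us @ j # i # vs) m y * R_site k i j (y $ i - y $ j)"
proof -
  have neq: "i \<noteq> j" "i \<notin> set us" "j \<notin> set us" "i \<notin> set vs" "j \<notin> set vs" using dist by auto
  let ?R = "R_site k i j (y $ i - y $ j) :: ('n \<Rightarrow> 'N idx) opr"
  consider "m = i" | "m = j" | p q where "us = p @ m # q" | p q where "vs = p @ m # q"
    using m by (auto dest: split_list)
  then show ?thesis
  proof cases
    case 1
    have Q1: "Q_order c k \<alpha> \<beta> x (us @ i # j # vs) m y = Q_split c k \<alpha> \<beta> us i (j # vs) x y"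
      using Q_order_append[of i us c k \<alpha> \<beta> x "j # vs" y] neq 1 by simp
    have Q2: "Q_order c k \<alpha> \<beta> x (us @ j # i # vs) m y = Q_split c k \<alpha> \<beta> (us @ [j]) i vs x y"
      using Q_order_append[of i "us @ [j]" c k \<alpha> \<beta> x vs y] neq 1 by simp
    \<comment> \<open>The two orders differ only in where the R-matrix of i and j stands: at the far
      right, or at the far left with its argument shifted by -c. The gauge factors supply exactly
      the missing one on each side.\<close>
    have "shift c m y $ i - shift c m y $ j = y $ i - y $ j - c" using neq 1 by simp
    then show ?thesis
      unfolding Q1 Q2 by (simp add: Q_split_def Q_left_def Q_right_def mult.assoc)
  next
    case 2
    have Q1: "Q_order c k \<alpha> \<beta> x (us @ i # j # vs) m y = Q_split c k \<alpha> \<beta> (us @ [i]) j vs x y"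
      using Q_order_append[of j "us @ [i]" c k \<alpha> \<beta> x vs y] neq 2 by simp
    have Q2: "Q_order c k \<alpha> \<beta> x (us @ j # i # vs) m y = Q_split c k \<alpha> \<beta> us j (i # vs) x y"
      using Q_order_append[of j us c k \<alpha> \<beta> x "i # vs" y] neq 2 by simp
    \<comment> \<open>Now the gauge factors are the inverses of the R-matrices that have to
      disappear, so unitarity is used on both sides.\<close>
    have d: "shift c m y $ i - shift c m y $ j = - (y $ j - y $ i - c)" using neq 2 by simp
    have U1: "R_site k i j (- (y $ j - y $ i - c)) * R_site k j i (y $ j - y $ i - c) = (1 :: ('n \<Rightarrow> 'N idx) opr)"
      using R_site_unitary[of "- (y $ j - y $ i - c)" k i j] genericD[OF gen, of i j] genericD[OF gen, of j i] neq
      by (simp add: R_site_commute[of k j i] algebra_simps)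
    have U2: "R_site k j i (y $ j - y $ i) * R_site k i j (y $ i - y $ j) = (1 :: ('n \<Rightarrow> 'N idx) opr)"
      using R_site_unitary[of "y $ j - y $ i" k i j] genericD[OF gen, of i j] genericD[OF gen, of j i] neq
      by (simp add: R_site_commute[of k j i] algebra_simps)
    define Y where "Y = Rprod k j (rev us) (\<lambda>q. y $ j - y $ q - c) * K_site j (y $ j - c / 2) x \<beta> *
        (Rprod k j ((us @ [i]) @ vs) (\<lambda>q. y $ j + y $ q) * K_site j (y $ j) ones \<alpha> * Rprod k j (rev vs) (\<lambda>q. y $ j - y $ q))"
    have Y1: "Q_split c k \<alpha> \<beta> (us @ [i]) j vs x y = R_site k j i (y $ j - y $ i - c) * Y"
      by (simp add: Q_split_def Q_left_def Q_right_def Y_def mult.assoc)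
    have Y2: "Q_split c k \<alpha> \<beta> us j (i # vs) x y = Y * R_site k j i (y $ j - y $ i)"
      by (simp add: Q_split_def Q_left_def Q_right_def Y_def mult.assoc)
    show ?thesis
      unfolding Q1 Q2 d Y1 Y2 by (simp only: mult.assoc U2 mult_1_right) (simp only: mult.assoc[symmetric] U1 mult_1_left)
  next
    case (3 p q)
    have m': "m \<notin> set p" "m \<noteq> i" "m \<noteq> j" using dist 3 by auto
    have Q1: "Q_order c k \<alpha> \<beta> x (us @ i # j # vs) m y = Q_split c k \<alpha> \<beta> p m (q @ i # j # vs) x y"
      using Q_order_append[of m p c k \<alpha> \<beta> x "q @ i # j # vs" y] m' 3 by simp
    have Q2: "Q_order c k \<alpha> \<beta> x (us @ j # i # vs) m y = Q_split c k \<alpha> \<beta> p m (q @ j # i # vs) x y"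
      using Q_order_append[of m p c k \<alpha> \<beta> x "q @ j # i # vs" y] m' 3 by simp
    have d: "shift c m y $ i - shift c m y $ j = y $ i - y $ j" using m' by simp
    have 1: "?R * Q_left c k p m y = Q_left c k p m y * ?R"
      unfolding Q_left_def using dist 3 by (intro Rprod_R_site_disjoint) auto
    have 2: "?R * K_site m z w b = K_site m z w b * ?R" for z b and w :: "'N point"
      using m' by (intro R_site_K_site_disjoint) auto
    \<comment> \<open>For \<open>m\<close> outside the swapped pair, the gauge factor passes through
      \<open>Q_m\<close> and exchanges i and j in every product that contains both.\<close>
    have 3: "?R * Rprod k m (p @ q @ i # j # vs) (\<lambda>j. y $ m + y $ j) = Rprod k m (p @ q @ j # i # vs) (\<lambda>j. y $ m + y $ j) * ?R"
      using Rprod_swap[of m "p @ q" i j vs k "\<lambda>j. y $ m + y $ j"] dist 3 by auto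
    have 4: "?R * Rprod k m (rev (q @ i # j # vs)) (\<lambda>j. y $ m - y $ j) = Rprod k m (rev (q @ j # i # vs)) (\<lambda>j. y $ m - y $ j) * ?R"
      using Rprod_swap[of m "rev vs" j i "rev q" k "\<lambda>j. y $ m - y $ j"] dist \<open>us = p @ m # q\<close>
      by (auto simp: R_site_commute[of k j i])
    show ?thesis
      unfolding Q1 Q2 d Q_split_def Q_right_def
      by (intro mult_move' 1 2 3 4)
  next
    case (4 p q)
    have m': "m \<notin> set (us @ i # j # p)" "m \<noteq> i" "m \<noteq> j" using dist 4 by auto
    have Q1: "Q_order c k \<alpha> \<beta> x (us @ i # j # vs) m y = Q_split c k \<alpha> \<beta> (us @ i # j # p) m q x y"
      using Q_order_append[of m "us @ i # j # p" c k \<alpha> \<beta> x q y] m' 4 by simp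
    have Q2: "Q_order c k \<alpha> \<beta> x (us @ j # i # vs) m y = Q_split c k \<alpha> \<beta> (us @ j # i # p) m q x y"
      using Q_order_append[of m "us @ j # i # p" c k \<alpha> \<beta> x q y] m' 4 by simp
    have d: "shift c m y $ i - shift c m y $ j = y $ i - y $ j" using m' by simp
    have R1: "?R * Q_left c k (us @ i # j # p) m y = Q_left c k (us @ j # i # p) m y * ?R"
      using Rprod_swap[of m "rev p" j i "rev us" k "\<lambda>j. y $ m - y $ j - c"] dist 4
      by (auto simp: Q_left_def R_site_commute[of k j i])
    have R2: "?R * K_site m z w b = K_site m z w b * ?R" for z b and w :: "'N point"
      using m' by (intro R_site_K_site_disjoint) auto
    have R3: "?R * Rprod k m ((us @ i # j # p) @ q) (\<lambda>j. y $ m + y $ j)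
        = Rprod k m ((us @ j # i # p) @ q) (\<lambda>j. y $ m + y $ j) * ?R"
      using Rprod_swap[of m us i j "p @ q" k "\<lambda>j. y $ m + y $ j"] dist 4 by auto
    have R4: "?R * Rprod k m (rev q) (\<lambda>j. y $ m - y $ j) = Rprod k m (rev q) (\<lambda>j. y $ m - y $ j) * ?R"
      using dist 4 by (intro Rprod_R_site_disjoint) auto
    show ?thesis
      unfolding Q1 Q2 d Q_split_def Q_right_def
      by (intro mult_move' R1 R2 R3 R4)
  qed
qed

section \<open>Commutation for two sites at the front and reduction of the general case\<close>

lemma K_site_K_site_disjoint: "i \<noteq> j \<Longrightarrow> K_site i z x b * K_site j z' x' b' = K_site j z' x' b' * K_site i z x b"
  by (simp add: K_site_def K_num_def distrib_left distrib_right site_commute[of i j] mult_ac cscale_distrib add_ac)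

lemma dressed_K_K_site_disjoint:
  assumes "m \<notin> insert i (set ws)"
  shows "dressed_K k \<alpha> f ws i u * K_site m z x b = K_site m z x b * dressed_K k \<alpha> f ws i u"
proof -
  have "K_site m z x b * R_site k i j v = R_site k i j v * K_site m z x b" if "j \<in> set ws" for j v
    using assms that by (intro R_site_K_site_disjoint[symmetric]) auto
  then have "K_site m z x b * dressed_K k \<alpha> f ws i u = dressed_K k \<alpha> f ws i u * K_site m z x b"
    unfolding dressed_K_def using assms by (intro commute_mult Rprod_commute K_site_K_site_disjoint) auto
  then show ?thesis by simp
qed

text \<open>Unitarity removes the two inner R-matrices. The claim then splits into two reflection
  equations: one for K(x, \<beta>) with parameters u - c/2 and v - c/2, whose sum is u + v - c, and
  one for the dressed K(1, \<alpha>) with parameters u and v.\<close>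

lemma Q_split_commute_front:
  fixes l m :: "'n::finite" and x :: "'N::finite point"
  assumes "distinct (l # m # ws)" "\<And>a. x $ a \<noteq> 0" "generic c k y"
  shows "Q_order c k \<alpha> \<beta> x (l # m # ws) l (shift c m y) * Q_order c k \<alpha> \<beta> x (l # m # ws) m y
    = Q_order c k \<alpha> \<beta> x (l # m # ws) m (shift c l y) * Q_order c k \<alpha> \<beta> x (l # m # ws) l y"
proof -
  let ?f = "\<lambda>j. y $ j"
  define R where "R = (R_site k l m :: complex \<Rightarrow> ('n \<Rightarrow> 'N idx) opr)"
  define u v where "u = y $ l" and "v = y $ m"
  define Kl where "Kl = K_site l (u - c / 2) x \<beta>"
  define Km where "Km = K_site m (v - c / 2) x \<beta>"
  define Ul where "Ul = (dressed_K k \<alpha> ?f ws l u :: ('n \<Rightarrow> 'N idx) opr)"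
  define Um where "Um = (dressed_K k \<alpha> ?f ws m v :: ('n \<Rightarrow> 'N idx) opr)"
  have lm: "l \<noteq> m" "l \<notin> set ws" "m \<notin> set ws" using assms(1) by auto
  have U: "dressed_K k \<alpha> (\<lambda>j. shift c n y $ j) ws i w = (dressed_K k \<alpha> ?f ws i w :: ('n \<Rightarrow> 'N idx) opr)"
    if "n \<notin> set ws" for n i w
    unfolding dressed_K_def using that by (intro arg_cong2[of _ _ _ _ "(*)"] Rprod_cong refl) (auto intro!: shift_simps)
  have Ql: "Q_order c k \<alpha> \<beta> x (l # m # ws) l y' = K_site l (y' $ l - c / 2) x \<beta> * (R_site k l m (y' $ l + y' $ m)
      * (dressed_K k \<alpha> (\<lambda>j. y' $ j) ws l (y' $ l) * R_site k l m (y' $ l - y' $ m)))" for y'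
    using Q_order_append[of l "[]" c k \<alpha> \<beta> x "m # ws" y'] by (simp add: Q_split_def Q_left_def Q_right_def dressed_K_def mult.assoc)
  have Qm: "Q_order c k \<alpha> \<beta> x (l # m # ws) m y' = R_site k l m (y' $ m - y' $ l - c) * (K_site m (y' $ m - c / 2) x \<beta>
      * (R_site k l m (y' $ l + y' $ m) * dressed_K k \<alpha> (\<lambda>j. y' $ j) ws m (y' $ m)))" for y'
    using Q_order_append[of m "[l]" c k \<alpha> \<beta> x ws y'] lm
    by (simp add: Q_split_def Q_left_def Q_right_def dressed_K_def mult.assoc R_site_commute[of k m l] add.commute)
  have l1: "Q_order c k \<alpha> \<beta> x (l # m # ws) l (shift c m y) = Kl * (R (u + v - c) * (Ul * R (u - v + c)))"
    unfolding Ql using lm by (simp add: U Kl_def Ul_def R_def u_def v_def algebra_simps)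
  have m1: "Q_order c k \<alpha> \<beta> x (l # m # ws) m y = R (v - u - c) * (Km * (R (u + v) * Um))"
    unfolding Qm by (simp add: Km_def Um_def R_def u_def v_def)
  have m2: "Q_order c k \<alpha> \<beta> x (l # m # ws) m (shift c l y) = R (v - u) * (Km * (R (u + v - c) * Um))"
    unfolding Qm using lm by (simp add: U Km_def Um_def R_def u_def v_def algebra_simps)
  have l2: "Q_order c k \<alpha> \<beta> x (l # m # ws) l y = Kl * (R (u + v) * (Ul * R (u - v)))"
    unfolding Ql by (simp add: Kl_def Ul_def R_def u_def v_def)
  have unit: "R (u - v + c) * R (v - u - c) = 1" "R (v - u) * R (u - v) = 1"
    using R_site_unitary[of "u - v + c" k l m] R_site_unitary[of "v - u" k l m] genericD[OF assms(3), of l m] genericD[OF assms(3), of m l] lm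
    by (simp_all add: R_def u_def v_def algebra_simps)
  have refl_K: "R (u - v) * (Kl * (R (u + v - c) * Km)) = Km * (R (u + v - c) * (Kl * R (u - v)))"
    using K_site_reflection[of l m x k "u - c / 2" "v - c / 2" \<beta>] assms(2) lm
    by (simp add: R_def Kl_def Km_def add_diff_eq diff_add_eq diff_diff_eq)
  have refl_U: "R (u - v) * (Ul * (R (u + v) * Um)) = Um * (R (u + v) * (Ul * R (u - v)))"
    unfolding R_def Ul_def Um_def by (rule dressed_K_reflection[OF assms(1)])
  have KmUl: "Ul * Km = Km * Ul" and KlUm: "Um * Kl = Kl * Um"
    using lm by (auto simp: Ul_def Um_def Kl_def Km_def dressed_K_K_site_disjoint)
  have "Kl * (R (u + v - c) * (Ul * R (u - v + c))) * (R (v - u - c) * (Km * (R (u + v) * Um)))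
    = Kl * R (u + v - c) * Ul * (R (u - v + c) * R (v - u - c)) * Km * R (u + v) * Um"
    by (simp only: mult.assoc)
  \<comment> \<open>The inserted factor 1 = R(v - u) R(u - v) provides the R(u - v) that both
    reflection equations need; it travels through the whole product.\<close>
  also have "\<dots> = (R (v - u) * R (u - v)) * (Kl * (R (u + v - c) * (Ul * Km))) * R (u + v) * Um"
    unfolding unit by (simp only: mult.assoc mult_1_left mult_1_right)
  also have "\<dots> = R (v - u) * (R (u - v) * (Kl * (R (u + v - c) * Km))) * Ul * R (u + v) * Um"
    unfolding KmUl by (simp only: mult.assoc)
  also have "\<dots> = R (v - u) * Km * R (u + v - c) * Kl * (R (u - v) * (Ul * (R (u + v) * Um)))"
    unfolding refl_K by (simp only: mult.assoc)
  also have "\<dots> = R (v - u) * Km * R (u + v - c) * (Um * Kl) * (R (u + v) * (Ul * R (u - v)))"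
    unfolding refl_U KlUm by (simp only: mult.assoc)
  finally show ?thesis
    unfolding l1 m1 m2 l2 by (simp only: mult.assoc)
qed

lemma Q_order_commute:
  fixes l m :: "'n::finite" and x :: "'N::finite point"
  assumes "distinct xs" "l \<noteq> m" "l \<in> set xs" "m \<in> set xs" "\<And>a. x $ a \<noteq> 0" "generic c k y"
  shows "Q_order c k \<alpha> \<beta> x xs l (shift c m y) * Q_order c k \<alpha> \<beta> x xs m y
    = Q_order c k \<alpha> \<beta> x xs m (shift c l y) * Q_order c k \<alpha> \<beta> x xs l y"
proof -
  define \<phi> where "\<phi> xs \<longleftrightarrow> Q_order c k \<alpha> \<beta> x xs l (shift c m y) * Q_order c k \<alpha> \<beta> x xs m y
    = Q_order c k \<alpha> \<beta> x xs m (shift c l y) * Q_order c k \<alpha> \<beta> x xs l y" for xs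
  \<comment> \<open>One implication suffices, since the roles of i and j can be exchanged. It holds
    because the gauge factor is invertible for generic y.\<close>
  have impl: "\<phi> (us @ i # j # vs)" if d: "distinct (us @ i # j # vs)" "set (us @ i # j # vs) = set xs"
    and \<phi>: "\<phi> (us @ j # i # vs)" for us i j vs
  proof -
    let ?xs = "us @ i # j # vs" and ?xs' = "us @ j # i # vs"
    let ?R = "\<lambda>y. R_site k i j (y $ i - y $ j) :: ('n \<Rightarrow> 'N idx) opr"
    let ?y = "shift c l (shift c m y)"
    have lm: "l \<in> set ?xs" "m \<in> set ?xs" using assms(3,4) d(2) by auto
    note gen = assms(6) generic_shift[OF assms(6)]
    have 1: "?R ?y * (Q_order c k \<alpha> \<beta> x ?xs l (shift c m y) * Q_order c k \<alpha> \<beta> x ?xs m y)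
      = Q_order c k \<alpha> \<beta> x ?xs' l (shift c m y) * Q_order c k \<alpha> \<beta> x ?xs' m y * ?R y"
      using gauge[OF d(1) lm(1) gen(2)] gauge[OF d(1) lm(2) gen(1)]
      by (subst mult.assoc[symmetric], subst gauge[OF d(1) lm(1) gen(2)], subst mult.assoc,
          subst gauge[OF d(1) lm(2) gen(1)], simp only: mult.assoc)
    have 2: "?R ?y * (Q_order c k \<alpha> \<beta> x ?xs m (shift c l y) * Q_order c k \<alpha> \<beta> x ?xs l y)
      = Q_order c k \<alpha> \<beta> x ?xs' m (shift c l y) * Q_order c k \<alpha> \<beta> x ?xs' l y * ?R y"
      unfolding shift_commute[of c l m]
      by (subst mult.assoc[symmetric], subst gauge[OF d(1) lm(2) gen(2)], subst mult.assoc,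
          subst gauge[OF d(1) lm(1) gen(1)], simp only: mult.assoc)
    define z where "z = ?y $ i - ?y $ j"
    have "generic c k ?y" by (intro generic_shift assms(6))
    then have "z + k \<noteq> 0" "- z + k \<noteq> 0"
      using genericD(1)[of c k ?y i j] genericD(1)[of c k ?y j i] d(1) by (auto simp: z_def)
    then have inv: "R_site k i j (- z) * ?R ?y = 1"
      using R_site_unitary[of "- z" k i j] by (simp add: z_def)
    have "?R ?y * (Q_order c k \<alpha> \<beta> x ?xs l (shift c m y) * Q_order c k \<alpha> \<beta> x ?xs m y)
      = ?R ?y * (Q_order c k \<alpha> \<beta> x ?xs m (shift c l y) * Q_order c k \<alpha> \<beta> x ?xs l y)"
      unfolding 1 2 using \<phi> by (simp add: \<phi>_def)
    then have "(R_site k i j (- z) * ?R ?y) * (Q_order c k \<alpha> \<beta> x ?xs l (shift c m y) * Q_order c k \<alpha> \<beta> x ?xs m y)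
      = (R_site k i j (- z) * ?R ?y) * (Q_order c k \<alpha> \<beta> x ?xs m (shift c l y) * Q_order c k \<alpha> \<beta> x ?xs l y)"
      by (simp only: mult.assoc)
    then show ?thesis by (simp add: inv \<phi>_def)
  qed
  have swap: "\<phi> (us @ i # j # vs) = \<phi> (us @ j # i # vs)"
    if "distinct (us @ i # j # vs)" "set (us @ i # j # vs) = set xs" for us i j vs
  proof -
    have "distinct (us @ j # i # vs)" "set (us @ j # i # vs) = set xs" using that by auto
    then show ?thesis using impl that by blast
  qed
  obtain us vs where xs: "xs = us @ m # vs" using assms(4) by (metis split_list)
  have 1: "\<phi> xs = \<phi> (m # us @ vs)"
    using adjacent_invariant(2)[where \<phi> = \<phi>, OF swap] assms(1) by (simp add: xs)
  have "l \<in> set (us @ vs)" using assms(2,3) xs by auto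
  then obtain us' vs' where xs': "us @ vs = us' @ l # vs'" by (metis split_list)
  have sx: "set xs = insert m (set (us @ vs))" by (auto simp: xs)
  have dx: "distinct (m # us @ vs)" using assms(1) by (auto simp: xs)
  have d: "distinct ((m # us') @ l # vs')" "set ((m # us') @ l # vs') = set xs"
    using dx unfolding sx xs' by auto
  have 2: "\<phi> (m # us @ vs) = \<phi> (l # m # us' @ vs')"
    using adjacent_invariant(2)[where \<phi> = \<phi>, OF swap d] by (simp add: xs')
  have "\<phi> (l # m # us' @ vs')"
    unfolding \<phi>_def using d(1) by (intro Q_split_commute_front assms(5,6)) auto
  with 1 2 show ?thesis by (simp add: \<phi>_def)
qed

subsection \<open>The operators of the theorem\<close>

abbreviation sites :: "'n::{finite,linorder} list"
  where "sites \<equiv> sorted_list_of_set UNIV"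

lemma sites_eq: "(sites :: 'n::{finite,linorder} list) = sites_below m @ m # sites_above m"
proof (rule sorted_distinct_set_unique)
  show "sorted (sites_below m @ m # sites_above m)"
    by (auto simp: sorted_append sites_below_def sites_above_def)
  show "set (sites :: 'n list) = set (sites_below m @ m # sites_above m)"
    by (auto simp: sites_below_def sites_above_def)
qed (auto simp: sites_below_def sites_above_def)

lemma order_pairs_sorted:
  assumes "sorted xs" "distinct xs"
  shows "order_pairs xs = {(i, j). i \<in> set xs \<and> j \<in> set xs \<and> i < j}"
  using assms by (induction xs) (fastforce simp: less_le)+

lemma order_pairs_sites: "order_pairs (sites :: 'n::{finite,linorder} list) = {(i, j). i < j}"
  by (subst order_pairs_sorted) auto

section \<open>Identification of the differential part\<close>

lemma opr_of_basic:
  "opr_of (munit u v) = e u v" "opr_of (Emat a b) = E_mat a b" "opr_of (Ebarmat a b) = Ebar_mat a b"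
  by (simp_all add: e_def Emat_def Ebarmat_def E_mat_def Ebar_mat_def opr_of_simps)

lemma opr_of_XYZ:
  fixes a b :: "'N::finite"
  defines "S \<equiv> {(i, j). i < (j :: 'n::{finite,linorder})}"
  shows "opr_of (Xop a b) = (\<Sum>(i, j)\<in>S. X_pair a b i j)"
    "opr_of (Yop a b) = (\<Sum>(i, j)\<in>S. Y_pair a b i j)"
    "opr_of (Zop a b) = (\<Sum>(i, j)\<in>S. Z_pair a b i j)"
  by (simp_all add: S_def Xop_def Yop_def Zop_def opr_of_sum case_prod_unfold opr_of_simps opr_of_at1 opr_of_basic
      X_pair_def Y_pair_def Z_pair_def)

lemma sum_pair_term:
  "(\<Sum>(i, j)\<in>S. pair_term x a i j) =
    (\<Sum>p\<in>- {a}. (1 / (x $ a - x $ p)) \<odot> (x $ a \<odot> (\<Sum>(i, j)\<in>S. X_pair a p i j) + x $ p \<odot> (\<Sum>(i, j)\<in>S. X_pair p a i j)))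
  + (\<Sum>p\<in>UNIV. (1 / (x $ a * x $ p - 1)) \<odot> ((x $ a * x $ p) \<odot> (\<Sum>(i, j)\<in>S. Y_pair a p i j) + (\<Sum>(i, j)\<in>S. Z_pair a p i j)))"
  unfolding pair_term_def case_prod_unfold sum.distrib cscale_sum cscale_distrib
  by (simp add: sum.distrib sum.swap[of _ S])

text \<open>The constants of \<open>Aop\<close> are absorbed into the coefficients of
  \<open>Bop\<close>: \<open>x_a\<close>/(\<open>x_a\<close> - \<open>x_p\<close>) - 1 =
  \<open>x_p\<close>/(\<open>x_a\<close> - \<open>x_p\<close>) for p < a,
  \<open>x_p\<close>/(\<open>x_a\<close> - \<open>x_p\<close>) + 1 =
  \<open>x_a\<close>/(\<open>x_a\<close> - \<open>x_p\<close>) for p > a, and similarly for the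
  terms with Y. Both ranges of p thus end with the same expression.\<close>

lemma opr_of_Lop:
  fixes x :: "'N::{finite,linorder} point" and y :: "'n::{finite,linorder} point"
  assumes "regular_x x"
  shows "opr_of (Lop k \<alpha> \<beta> a x y) = L_order k \<alpha> \<beta> (order_pairs sites) x a y"
proof -
  define X where "X a b = (\<Sum>(i, j)\<in>{(i, j). i < (j :: 'n)}. X_pair a b i j)" for a b :: 'N
  define Y where "Y a b = (\<Sum>(i, j)\<in>{(i, j). i < (j :: 'n)}. Y_pair a b i j)" for a b :: 'N
  define Z where "Z a b = (\<Sum>(i, j)\<in>{(i, j). i < (j :: 'n)}. Z_pair a b i j)" for a b :: 'N
  define x1 where "x1 p = (1 / (x $ a - x $ p)) \<odot> (x $ a \<odot> X a p + x $ p \<odot> X p a)" for p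
  define y1 where "y1 p = (1 / (x $ a * x $ p - 1)) \<odot> ((x $ a * x $ p) \<odot> Y a p + Z a p)" for p
  have nz: "x $ a \<noteq> x $ p" if "p \<noteq> a" for p using assms that unfolding regular_x_def by blast
  have nz': "x $ a * x $ p \<noteq> 1" for p using assms unfolding regular_x_def by blast
  have below: "(x $ a / (x $ a - x $ p)) \<odot> (X a p + X p a) - X p a = x1 p" if "p \<noteq> a" for p
    unfolding x1_def using nz[OF that] by (intro opr_eqI) (simp add: divide_simps, simp add: algebra_simps)
  have above: "X a p + (x $ p / (x $ a - x $ p)) \<odot> (X a p + X p a) = x1 p" if "p \<noteq> a" for p
    unfolding x1_def using nz[OF that] by (intro opr_eqI) (simp add: divide_simps, simp add: algebra_simps)
  have yz: "Y a p + (1 / (x $ a * x $ p - 1)) \<odot> (Y a p + Z a p) = y1 p" for p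
    unfolding y1_def using nz'[of p] by (intro opr_eqI) (simp add: divide_simps, simp add: algebra_simps)
  have b: "(\<Sum>p | p < a. (x $ a / (x $ a - x $ p)) \<odot> (X a p + X p a)) = (\<Sum>p | p < a. x1 p) + (\<Sum>p | p < a. X p a)"
    unfolding sum.distrib[symmetric] by (intro sum.cong) (auto simp: below[symmetric])
  have c: "(\<Sum>p | a < p. X a p) = (\<Sum>p | a < p. x1 p) - (\<Sum>p | a < p. (x $ p / (x $ a - x $ p)) \<odot> (X a p + X p a))"
    unfolding sum_subtractf[symmetric] by (intro sum.cong) (auto simp: above[symmetric])
  have d: "(\<Sum>p\<in>UNIV. Y a p) = (\<Sum>p\<in>UNIV. y1 p) - (\<Sum>p\<in>UNIV. (1 / (x $ a * x $ p - 1)) \<odot> (Y a p + Z a p))"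
    unfolding sum_subtractf[symmetric] by (intro sum.cong) (auto simp: yz[symmetric])
  have Compl_eq: "- {a} = {p. p < a} \<union> {p. a < p}" by auto
  have e: "(\<Sum>p\<in>- {a}. x1 p) = (\<Sum>p | p < a. x1 p) + (\<Sum>p | a < p. x1 p)"
    unfolding Compl_eq by (rule sum.union_disjoint) auto
  have pair_term: "(\<Sum>(i, j)\<in>order_pairs sites. pair_term x a i j) = (\<Sum>p\<in>- {a}. x1 p) + (\<Sum>p\<in>UNIV. y1 p)"
    unfolding order_pairs_sites sum_pair_term x1_def y1_def X_def Y_def Z_def ..
  have A: "opr_of (Aop k \<alpha> a y) = (\<Sum>j\<in>UNIV. y $ j \<odot> site j (h_mat a))
      + (\<Sum>j\<in>UNIV. (2 * \<alpha>) \<odot> site j (e (Inl a) (Inr a)))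
      + k \<odot> (- (\<Sum>p | p < a. X p a) + (\<Sum>p | a < p. X a p) + (\<Sum>p\<in>UNIV. Y a p))"
    by (simp add: Aop_def opr_of_simps opr_of_sum opr_of_at1 opr_of_basic opr_of_XYZ X_def Y_def h_mat_def cscale_sum)
  have B: "opr_of (Bop k \<alpha> \<beta> a x) =
      (\<Sum>j\<in>UNIV. (2 * ((\<alpha> + \<beta> * x $ a) / ((x $ a)\<^sup>2 - 1))) \<odot> site j (Ebar_mat a a))
      + k \<odot> ((\<Sum>p | p < a. (x $ a / (x $ a - x $ p)) \<odot> (X a p + X p a))
        + (\<Sum>p | a < p. (x $ p / (x $ a - x $ p)) \<odot> (X a p + X p a))
        + (\<Sum>p\<in>UNIV. (1 / (x $ a * x $ p - 1)) \<odot> (Y a p + Z a p)))"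
    by (simp add: Bop_def opr_of_simps opr_of_sum opr_of_at1 opr_of_basic opr_of_XYZ X_def Y_def Z_def cscale_sum)
  show ?thesis
    unfolding Lop_def opr_of_simps A B L_order_def pair_term e b c d
    by (simp add: site_term_def site_linear sum.distrib cscale_distrib algebra_simps)
qed

section \<open>Identification of the difference part\<close>

lemma opr_of_oprod: "opr_of (oprod F js) = prod_list (map (\<lambda>j. opr_of (F j)) js)"
  by (induction js) (simp_all add: oprod_def opr_of_simps)

lemma opr_of_Rmat: "i \<noteq> j \<Longrightarrow> opr_of (at2 i j (Rmat k z)) = R_site k i j z"
proof -
  assume "i \<noteq> j"
  have "opr_of (at2 i j (mat 1)) = (1 :: ('a \<Rightarrow> 'b idx) opr)"
  proof (rule opr_eqI)
    fix I J :: "'a \<Rightarrow> 'b idx"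
    have "I = J \<longleftrightarrow> (\<forall>l. l \<noteq> i \<and> l \<noteq> j \<longrightarrow> I l = J l) \<and> I i = J i \<and> I j = J j"
      by (auto simp: fun_eq_iff)
    then show "ent (opr_of (at2 i j (mat 1))) I J = ent 1 I J"
      by (auto simp: ent_opr_of at2_def mat_def ent_one)
  qed
  moreover have "at2 i j (Rmat k z) = (1 / (z + k)) *m (z *m at2 i j (mat 1) + k *m (at2 i j flip :: ('b, 'a) tensor_op))"
    by (auto simp: vec_eq_iff at2_def Rmat_def)
  ultimately show ?thesis
    using \<open>i \<noteq> j\<close> by (simp add: R_site_def R_num_def opr_of_simps opr_of_at2_flip)
qed

lemma opr_of_Kmat: "opr_of (at1 j (Kmat z x b)) = K_site j z x b"
  by (simp add: Kmat_def K_site_def K_num_def opr_of_at1 opr_of_simps site_linear site_one T_def)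

lemma Rprod_oprod:
  assumes "m \<notin> set js"
  shows "opr_of (oprod (\<lambda>j. at2 m j (Rmat k (f j))) js) = Rprod k m js f"
    "opr_of (oprod (\<lambda>j. at2 j m (Rmat k (f j))) js) = Rprod k m js f"
proof -
  have *: "opr_of (at2 m j (Rmat k (f j))) = R_site k m j (f j)" "opr_of (at2 j m (Rmat k (f j))) = R_site k m j (f j)"
    if "j \<in> set js" for j
  proof -
    have "m \<noteq> j" using assms that by auto
    then show "opr_of (at2 m j (Rmat k (f j))) = R_site k m j (f j)" "opr_of (at2 j m (Rmat k (f j))) = R_site k m j (f j)"
      by (simp_all add: opr_of_Rmat R_site_commute[of k j m])
  qed
  show "opr_of (oprod (\<lambda>j. at2 m j (Rmat k (f j))) js) = Rprod k m js f"
    "opr_of (oprod (\<lambda>j. at2 j m (Rmat k (f j))) js) = Rprod k m js f"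
    unfolding opr_of_oprod Rprod_def
    by (rule arg_cong[of _ _ prod_list], rule map_cong[OF refl], rule *, assumption)+
qed

lemma opr_of_Qmat:
  fixes x :: "'N::finite point" and y :: "'n::{finite,linorder} point"
  shows "opr_of (Qmat c k \<alpha> \<beta> m x y) = Q_order c k \<alpha> \<beta> x sites m y"
    "Q_order c k \<alpha> \<beta> x sites m y = Q_split c k \<alpha> \<beta> (sites_below m) m (sites_above m) x y"
proof -
  have m: "m \<notin> set (sites_below m)" "m \<notin> set (sites_above m)"
    by (auto simp: sites_below_def sites_above_def)
  show 1: "Q_order c k \<alpha> \<beta> x sites m y = Q_split c k \<alpha> \<beta> (sites_below m) m (sites_above m) x y"
    unfolding sites_eq[of m] using m(1) by (rule Q_order_append)
  show "opr_of (Qmat c k \<alpha> \<beta> m x y) = Q_order c k \<alpha> \<beta> x sites m y"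
    unfolding 1 using m
    by (simp add: Qmat_def Q_split_def Q_left_def Q_right_def opr_of_simps Rprod_oprod opr_of_Kmat mult.assoc add.commute)
qed

subsection \<open>Mixed partial derivatives\<close>

lemma first_order_Taylor_bound:
  fixes f :: "complex \<Rightarrow> complex"
  assumes holo: "f holomorphic_on ball 0 r" and B: "\<And>z. z \<in> ball 0 r \<Longrightarrow> cmod (f z) \<le> B" and r: "0 < r"
    and h: "cmod h < r / 2"
  shows "cmod (f h - f 0 - deriv f 0 * h) \<le> 32 * B / r\<^sup>2 * cmod h ^ 2"
proof -
  define F where "F i = (deriv ^^ i) f" for i
  have "cmod (F 0 h - (\<Sum>i\<le>1. F i 0 * (h - 0) ^ i / fact i)) \<le> 32 * B / r\<^sup>2 * cmod (h - 0) ^ Suc 1 / fact 1"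
  proof (rule complex_Taylor)
    show "convex (ball (0::complex) (r / 2))" by simp
    show "(F i has_field_derivative F (Suc i) z) (at z within ball 0 (r / 2))" if "z \<in> ball 0 (r / 2)" for i z
    proof -
      have "z \<in> ball 0 r" using that r by auto
      then show ?thesis
        unfolding F_def using has_field_derivative_higher_deriv[OF holo open_ball]
        by (auto intro: has_field_derivative_at_within)
    qed
    show "cmod (F (Suc 1) z) \<le> 32 * B / r\<^sup>2" if z: "z \<in> ball 0 (r / 2)" for z
    proof -
      have sub: "cball z (r / 4) \<subseteq> ball 0 r"
      proof
        fix w assume "w \<in> cball z (r / 4)"
        then have "cmod w \<le> r / 4 + cmod z" by (metis add.commute dist_norm mem_cball norm_minus_commute norm_triangle_sub order_trans add_left_mono)
        with z r show "w \<in> ball 0 r" by auto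
      qed
      \<comment> \<open>Cauchy's estimate on circles of radius r/4, which stay inside the disc for
        centres of modulus below r/2; 2 B / (r/4)^2 is the constant 32 B / r^2.\<close>
      have "cmod ((deriv ^^ 2) f z) \<le> fact 2 * B / (r / 4) ^ 2"
      proof (rule Cauchy_inequality)
        show "f holomorphic_on ball z (r / 4)"
          by (rule holomorphic_on_subset[OF holo]) (use sub in auto)
        show "continuous_on (cball z (r / 4)) f"
          using holomorphic_on_imp_continuous_on[OF holomorphic_on_subset[OF holo sub]] .
        show "cmod (f w) \<le> B" if "cmod (z - w) = r / 4" for w
        proof (rule B)
          have "w \<in> cball z (r / 4)" using that by (simp add: dist_norm)
          then show "w \<in> ball 0 r" using sub by auto
        qed
      qed (use r in simp)
      then show ?thesis by (simp add: F_def numeral_2_eq_2 power_divide)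
    qed
  qed (use r h in auto)
  then show ?thesis by (simp add: F_def power2_eq_square algebra_simps)
qed

text \<open>Differentiability is required in each variable separately. Continuity on the closed
  bidisc gives a common bound, which makes the Taylor estimate uniform in the other
  variable.\<close>

definition hol2 :: "real \<Rightarrow> (complex \<Rightarrow> complex \<Rightarrow> complex) \<Rightarrow> bool"
  where "hol2 r G \<longleftrightarrow> 0 < r \<and> continuous_on (cball 0 r \<times> cball 0 r) (\<lambda>(s, t). G s t)
    \<and> (\<forall>s\<in>cball 0 r. \<forall>t\<in>cball 0 r. (\<lambda>s. G s t) field_differentiable at s \<and> (\<lambda>t. G s t) field_differentiable at t)"

lemma hol2_flip: "hol2 r G \<Longrightarrow> hol2 r (\<lambda>s t. G t s)"
proof -
  assume G: "hol2 r G"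
  have "continuous_on (cball 0 r \<times> cball 0 r) ((\<lambda>(s, t). G s t) \<circ> prod.swap)"
    by (rule continuous_on_compose) (use G in \<open>auto simp: hol2_def product_swap intro!: continuous_on_swap\<close>)
  then show ?thesis using G by (simp add: hol2_def o_def case_prod_unfold)
qed

text \<open>The difference quotients in \<open>t\<close> are holomorphic in \<open>s\<close> and converge uniformly, so their
  \<open>s\<close>-derivatives converge as well.\<close>

lemma hol2_mixed_half:
  assumes "hol2 r G"
  shows "\<exists>D h. ((\<lambda>s. deriv (G s) 0) has_field_derivative D) (at 0) \<and> h \<longlonglongrightarrow> 0 \<and> (\<forall>n. h n \<noteq> 0)
    \<and> (\<lambda>n. (deriv (\<lambda>s. G s (h n)) 0 - deriv (\<lambda>s. G s 0) 0) / h n) \<longlonglongrightarrow> D"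
proof -
  have r: "0 < r" using assms by (simp add: hol2_def)
  have diff: "(\<lambda>s. G s t) field_differentiable at s" "G s field_differentiable at t"
    if "s \<in> cball 0 r" "t \<in> cball 0 r" for s t
    using assms that unfolding hol2_def by blast+
  have "compact ((\<lambda>(s, t). G s t) ` (cball 0 r \<times> cball 0 r))"
    using assms by (intro compact_continuous_image compact_Times) (auto simp: hol2_def)
  from compact_imp_bounded[OF this] obtain B where "\<forall>z\<in>(\<lambda>(s, t). G s t) ` (cball 0 r \<times> cball 0 r). cmod z \<le> B"
    unfolding bounded_iff by blast
  then have B: "cmod (G s t) \<le> B" if "s \<in> cball 0 r" "t \<in> cball 0 r" for s t
    using that by force
  have "cmod (G 0 0) \<le> B" using B r by simp
  then have B0: "0 \<le> B" using norm_ge_zero order_trans by blast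
  \<comment> \<open>The factor r/4 keeps the increments within the range r/2 of the Taylor estimate,
    and \<open>Suc n\<close> keeps them finite and nonzero from the start.\<close>
  define h :: "nat \<Rightarrow> complex" where "h n = of_real (r / 4 / real (Suc n))" for n
  have h0: "h n \<noteq> 0" for n using r unfolding h_def by (simp del: of_nat_Suc)
  have hr: "cmod (h n) < r / 2" for n
  proof -
    have "cmod (h n) = r / 4 / real (Suc n)"
      unfolding h_def norm_of_real by (rule abs_of_nonneg) (use r in simp)
    also have "\<dots> \<le> r / 4 / 1" using r by (intro divide_left_mono) auto
    finally show ?thesis using r by simp
  qed
  have "(\<lambda>n. r / 4 / real (Suc n)) \<longlonglongrightarrow> 0"
    by (rule LIMSEQ_Suc[OF lim_const_over_n])
  from tendsto_of_real[OF this, where ?'a = complex] have hlim: "h \<longlonglongrightarrow> 0"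
    unfolding h_def by simp
  define F where "F n s = (G s (h n) - G s 0) / h n" for n s
  define F' where "F' n s = (deriv (\<lambda>s. G s (h n)) s - deriv (\<lambda>s. G s 0) s) / h n" for n s
  define g where "g s = deriv (G s) 0" for s
  have hin: "h n \<in> cball 0 r" for n using hr[of n] r by simp
  have "\<exists>g'. \<forall>x \<in> ball 0 r. (g has_field_derivative g' x) (at x) \<and> (\<lambda>n. F' n x) \<longlonglongrightarrow> g' x"
  proof (rule has_complex_derivative_uniform_sequence)
    show "open (ball (0::complex) r)" by simp
    show "(F n has_field_derivative F' n s) (at s)" if s: "s \<in> ball 0 r" for n s
    proof -
      have "((\<lambda>s. G s t) has_field_derivative deriv (\<lambda>s. G s t) s) (at s)" if "t \<in> cball 0 r" for t
      proof (rule field_differentiable_derivI)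
        have "s \<in> cball 0 r" using s by simp
        then show "(\<lambda>s. G s t) field_differentiable at s" using diff that by blast
      qed
      from this[OF hin[of n]] this[of 0] show ?thesis
        unfolding F_def F'_def using r by (intro DERIV_cdivide DERIV_diff) auto
    qed
    fix s assume s: "s \<in> ball (0::complex) r"
    then obtain d where d: "0 < d" "cball s d \<subseteq> ball 0 r" using open_contains_cball open_ball by blast
    have est: "dist (F n s') (g s') \<le> 32 * B / r\<^sup>2 * cmod (h n)" if "s' \<in> ball 0 r" for n s'
    proof -
      have "cmod (G s' (h n) - G s' 0 - deriv (G s') 0 * h n) \<le> 32 * B / r\<^sup>2 * cmod (h n) ^ 2"
      proof (rule first_order_Taylor_bound[OF _ _ r hr])
        show "G s' holomorphic_on ball 0 r"
          unfolding holomorphic_on_def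
        proof
          fix z :: complex assume "z \<in> ball 0 r"
          then have "z \<in> cball 0 r" "s' \<in> cball 0 r" using that by simp_all
          then show "G s' field_differentiable at z within ball 0 r"
            using diff field_differentiable_at_within by blast
        qed
        show "cmod (G s' z) \<le> B" if "z \<in> ball 0 r" for z
          by (rule B) (use \<open>s' \<in> ball 0 r\<close> that in simp_all)
      qed
      moreover have "F n s' - g s' = (G s' (h n) - G s' 0 - deriv (G s') 0 * h n) / h n"
        using h0[of n] by (simp add: F_def g_def field_simps)
      ultimately have "cmod (F n s' - g s') \<le> 32 * B / r\<^sup>2 * cmod (h n) ^ 2 / cmod (h n)"
        by (simp only: norm_divide) (rule divide_right_mono, simp_all)
      then show ?thesis using h0[of n] by (simp add: dist_norm power2_eq_square)
    qed
    have lim: "(\<lambda>n. 32 * B / r\<^sup>2 * cmod (h n)) \<longlonglongrightarrow> 0"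
      using tendsto_mult_right_zero[OF tendsto_norm_zero[OF hlim]] by blast
    have "uniform_limit (cball s d) F g sequentially"
    proof (rule uniform_limitI)
      fix \<epsilon> :: real assume "\<epsilon> > 0"
      with lim have "\<forall>\<^sub>F n in sequentially. 32 * B / r\<^sup>2 * cmod (h n) < \<epsilon>"
        by (rule order_tendstoD(2))
      then show "\<forall>\<^sub>F n in sequentially. \<forall>x\<in>cball s d. dist (F n x) (g x) < \<epsilon>"
      proof (rule eventually_mono, intro ballI)
        fix n x assume "32 * B / r\<^sup>2 * cmod (h n) < \<epsilon>" "x \<in> cball s d"
        moreover from this(2) have "x \<in> ball 0 r" using d(2) by (rule subsetD[rotated])
        ultimately show "dist (F n x) (g x) < \<epsilon>" using est[of x n] by linarith
      qed
    qed
    with d show "\<exists>d>0. cball s d \<subseteq> ball 0 r \<and> uniform_limit (cball s d) F g sequentially" by blast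
  qed
  then obtain g' where "\<forall>x \<in> ball 0 r. (g has_field_derivative g' x) (at x) \<and> (\<lambda>n. F' n x) \<longlonglongrightarrow> g' x" ..
  moreover have "0 \<in> ball (0::complex) r" using r by simp
  ultimately have "(g has_field_derivative g' 0) (at 0)" "(\<lambda>n. F' n 0) \<longlonglongrightarrow> g' 0" by blast+
  from this[unfolded g_def F'_def] show ?thesis
    using hlim h0 by (intro exI conjI allI)
qed

text \<open>Both mixed derivatives exist by symmetry. They agree because the second one is in
  particular the limit of its difference quotients along \<open>h\<close>, which is known to be the
  first one.\<close>

lemma hol2_mixed:
  assumes "hol2 r G"
  obtains D where "((\<lambda>s. deriv (G s) 0) has_field_derivative D) (at 0)"
    "((\<lambda>t. deriv (\<lambda>s. G s t) 0) has_field_derivative D) (at 0)"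
proof -
  obtain D h where D: "((\<lambda>s. deriv (G s) 0) has_field_derivative D) (at 0) \<and> h \<longlonglongrightarrow> 0 \<and> (\<forall>n. h n \<noteq> 0)
    \<and> (\<lambda>n. (deriv (\<lambda>s. G s (h n)) 0 - deriv (\<lambda>s. G s 0) 0) / h n) \<longlonglongrightarrow> D"
    using hol2_mixed_half[OF assms] by (elim exE)
  obtain D' where D': "((\<lambda>t. deriv (\<lambda>s. G s t) 0) has_field_derivative D') (at 0)"
    using hol2_mixed_half[OF hol2_flip[OF assms]] by (elim exE conjE)
  have h: "filterlim h (at 0) sequentially"
    unfolding filterlim_at using D by simp
  have "(\<lambda>n. (deriv (\<lambda>s. G s (0 + h n)) 0 - deriv (\<lambda>s. G s 0) 0) / h n) \<longlonglongrightarrow> D'"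
    by (rule filterlim_compose[OF D'[unfolded DERIV_def] h])
  then have "D' = D" using LIMSEQ_unique D by auto
  show ?thesis using that[of D] D D' \<open>D' = D\<close> by simp
qed

section \<open>Partial derivatives of holomorphic functions of several variables\<close>

definition holo_on :: "('N::finite) point set \<Rightarrow> ('N point \<Rightarrow> complex) \<Rightarrow> bool"
  where "holo_on U g \<longleftrightarrow> (\<forall>x\<in>U. \<exists>g'. (g has_derivative g') (at x) \<and> (\<forall>z v. g' (z *s v) = z * g' v))"

lemma axis_scale: "axis a t = t *s axis a (1::complex)"
  by (simp add: vec_eq_iff axis_def)

lemma axis_zero: "axis a (0::complex) = 0"
  by (simp add: vec_eq_iff axis_def)

lemma norm_axis_complex: "norm (axis a (t::complex)) = cmod t"
proof -
  have "(\<Sum>i\<in>UNIV. (cmod (axis a t $ i))\<^sup>2) = (\<Sum>i\<in>UNIV. if i = a then (cmod t)\<^sup>2 else 0)"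
    by (intro sum.cong) (auto simp: axis_def)
  then show ?thesis by (simp add: norm_vec_def L2_set_def)
qed

definition dax :: "'N::finite \<Rightarrow> ('N point \<Rightarrow> complex) \<Rightarrow> 'N point \<Rightarrow> complex"
  where "dax a g x = deriv (\<lambda>t. g (x + axis a t)) 0"

lemma has_derivative_axis: "((\<lambda>s. p + axis a (s :: complex)) has_derivative axis a) (at s)"
proof -
  have "linear (axis a :: complex \<Rightarrow> complex ^ 'a)"
    by (rule linearI) (simp_all add: vec_eq_iff axis_def)
  then have "bounded_linear (axis a :: complex \<Rightarrow> complex ^ 'a)" by (rule linear_conv_bounded_linear[THEN iffD1])
  then have "(axis a has_derivative (axis a :: complex \<Rightarrow> complex ^ 'a)) (at s)"
    by (rule bounded_linear_imp_has_derivative)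
  from has_derivative_add[OF has_derivative_const this] show ?thesis by simp
qed

lemma holo_on_field_differentiable:
  assumes "holo_on U g" "p + axis a s \<in> U"
  shows "(\<lambda>s. g (p + axis a s)) field_differentiable at s"
proof -
  obtain g' where g': "(g has_derivative g') (at (p + axis a s)) \<and> (\<forall>z v. g' (z *s v) = z * g' v)"
    using bspec[OF assms(1)[unfolded holo_on_def] assms(2)] by (elim exE)
  have "((\<lambda>s. g (p + axis a s)) has_derivative (\<lambda>h. g' (axis a h))) (at s)"
    using has_derivative_compose[OF has_derivative_axis] g' by blast
  moreover have "(\<lambda>h. g' (axis a h)) = (*) (g' (axis a 1))"
  proof
    fix h
    have "g' (h *s axis a 1) = h * g' (axis a 1)" using g' by blast
    then show "g' (axis a h) = g' (axis a 1) * h" unfolding axis_scale[of a h] by (simp only: mult.commute)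
  qed
  ultimately have "((\<lambda>s. g (p + axis a s)) has_field_derivative g' (axis a 1)) (at s)"
    by (simp only: has_field_derivative_def)
  then show ?thesis unfolding field_differentiable_def ..
qed

lemma has_field_derivative_dax:
  assumes "holo_on U g" "x \<in> U"
  shows "((\<lambda>t. g (x + axis a t)) has_field_derivative dax a g x) (at 0)"
  unfolding dax_def using assms
  by (intro field_differentiable_derivI holo_on_field_differentiable) (simp_all add: axis_zero)

text \<open>Functions in \<open>fun_space\<close> are only assumed to be differentiable once; that
  the second derivatives exist at all is a consequence of holomorphy and has to be part of the
  conclusion.\<close>

lemma dax_dax:
  fixes g :: "('N::finite) point \<Rightarrow> complex"
  assumes U: "open U" "x \<in> U" and g: "holo_on U g"
  obtains D where "((\<lambda>t. dax b g (x + axis a t)) has_field_derivative D) (at 0)"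
    "((\<lambda>t. dax a g (x + axis b t)) has_field_derivative D) (at 0)"
proof -
  obtain \<epsilon> where \<epsilon>: "\<epsilon> > 0" "ball x \<epsilon> \<subseteq> U" using U open_contains_ball by blast
  \<comment> \<open>Two displacements of modulus at most \<epsilon>/3 stay strictly inside the ball
    of radius \<epsilon>.\<close>
  define r where "r = \<epsilon> / 3"
  define G where "G s t = g (x + axis a s + axis b t)" for s t
  have inU: "x + axis a s + axis b t \<in> U" if "s \<in> cball 0 r" "t \<in> cball 0 r" for s t
  proof -
    have "norm (axis a s + axis b t) \<le> cmod s + cmod t"
      using norm_triangle_ineq[of "axis a s" "axis b t"] by (simp add: norm_axis_complex)
    also have "\<dots> < \<epsilon>" using that \<epsilon>(1) by (simp add: r_def)
    finally have "x + (axis a s + axis b t) \<in> ball x \<epsilon>" unfolding mem_ball dist_norm norm_minus_commute[of x] by simp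
    then show ?thesis using \<epsilon>(2) by (auto simp: add.assoc)
  qed
  have cont: "continuous_on U g"
    using g unfolding holo_on_def
    by (intro continuous_at_imp_continuous_on ballI) (blast intro: has_derivative_continuous)
  have axis: "continuous_on S (axis c :: complex \<Rightarrow> complex ^ 'N)" for S c
    using has_derivative_continuous[OF has_derivative_axis[of 0 c]]
    by (intro continuous_at_imp_continuous_on) auto
  have "hol2 r G"
    unfolding hol2_def
  proof (intro conjI ballI)
    show "0 < r" using \<epsilon>(1) by (simp add: r_def)
    have "continuous_on (cball 0 r \<times> cball 0 r) (\<lambda>p. g (x + axis a (fst p) + axis b (snd p)))"
    proof (rule continuous_on_compose2[OF cont])
      show "continuous_on (cball 0 r \<times> cball 0 r) (\<lambda>p. x + axis a (fst p) + axis b (snd p))"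
        by (intro continuous_intros continuous_on_compose2[OF axis[of UNIV]]) auto
    qed (use inU in auto)
    then show "continuous_on (cball 0 r \<times> cball 0 r) (\<lambda>(s, t). G s t)"
      by (simp add: G_def case_prod_unfold)
    fix s t :: complex assume st: "s \<in> cball 0 r" "t \<in> cball 0 r"
    show "G s field_differentiable at t"
      unfolding G_def by (rule holo_on_field_differentiable[OF g inU[OF st]])
    have "(\<lambda>s. g ((x + axis b t) + axis a s)) field_differentiable at s"
      by (rule holo_on_field_differentiable[OF g]) (use inU[OF st] in \<open>simp add: add_ac\<close>)
    then show "(\<lambda>s. G s t) field_differentiable at s"
      by (simp add: G_def add_ac)
  qed
  from hol2_mixed[OF this] obtain D where "((\<lambda>s. deriv (G s) 0) has_field_derivative D) (at 0)"
    "((\<lambda>t. deriv (\<lambda>s. G s t) 0) has_field_derivative D) (at 0)" .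
  moreover have "deriv (G s) 0 = dax b g (x + axis a s)" for s by (simp add: G_def[abs_def] dax_def)
  moreover have "deriv (\<lambda>s. G s t) 0 = dax a g (x + axis b t)" for t by (simp add: G_def dax_def add_ac)
  ultimately show ?thesis using that by simp
qed

section \<open>Derivatives of operator- and vector-valued functions\<close>

definition app :: "'i::finite opr \<Rightarrow> complex ^ 'i \<Rightarrow> complex ^ 'i"
  where "app A v = mat_of A *v v"

lemma app_nth: "app A v $ I = (\<Sum>J\<in>UNIV. ent A I J * v $ J)"
  by (simp add: app_def matrix_vector_mult_def ent.rep_eq)

lemma app_opr_of: "M *v v = app (opr_of M) v"
  by (simp add: app_def opr_of_inverse)

lemma app_simps:
  "app (A * B) v = app A (app B v)" "app (A + B) v = app A v + app B v" "app (z \<odot> A) v = z *s app A v"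
  "app A (v + w) = app A v + app A w" "app A (z *s v) = z *s app A v"
proof -
  show "app (A * B) v = app A (app B v)"
    by (simp add: app_def times_opr.rep_eq matrix_vector_mul_assoc)
qed (simp_all add: vec_eq_iff app_nth sum.distrib sum_distrib_left algebra_simps)

definition has_odv :: "(complex \<Rightarrow> 'i::finite opr) \<Rightarrow> 'i opr \<Rightarrow> bool"
  where "has_odv F F' \<longleftrightarrow> (\<forall>I J. ((\<lambda>t. ent (F t) I J) has_field_derivative ent F' I J) (at 0))"

definition has_vdv :: "(complex \<Rightarrow> complex ^ 'i::finite) \<Rightarrow> complex ^ 'i \<Rightarrow> bool"
  where "has_vdv v v' \<longleftrightarrow> (\<forall>I. ((\<lambda>t. v t $ I) has_field_derivative v' $ I) (at 0))"

lemma has_odv_const: "has_odv (\<lambda>t. A) 0"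
  by (simp add: has_odv_def)

lemma has_odv_add: "has_odv F F' \<Longrightarrow> has_odv G G' \<Longrightarrow> has_odv (\<lambda>t. F t + G t) (F' + G')"
  by (simp add: has_odv_def DERIV_add)

lemma has_odv_scale: "(\<phi> has_field_derivative d) (at 0) \<Longrightarrow> has_odv (\<lambda>t. \<phi> t \<odot> A) (d \<odot> A)"
  by (auto simp: has_odv_def intro!: DERIV_cmult_right)

lemma has_odv_cscale: "has_odv F F' \<Longrightarrow> has_odv (\<lambda>t. z \<odot> F t) (z \<odot> F')"
  by (auto simp: has_odv_def intro!: DERIV_cmult)

lemma has_odv_mult_left: "has_odv F F' \<Longrightarrow> has_odv (\<lambda>t. A * F t) (A * F')"
  by (auto simp: has_odv_def ent_mult intro!: DERIV_sum DERIV_cmult)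

lemma has_odv_mult_right: "has_odv F F' \<Longrightarrow> has_odv (\<lambda>t. F t * A) (F' * A)"
  by (auto simp: has_odv_def ent_mult intro!: DERIV_sum DERIV_cmult_right)

lemma has_odv_sum: "(\<And>s. s \<in> S \<Longrightarrow> has_odv (F s) (F' s)) \<Longrightarrow> has_odv (\<lambda>t. \<Sum>s\<in>S. F s t) (\<Sum>s\<in>S. F' s)"
  by (auto simp: has_odv_def ent_sum intro!: DERIV_sum)

lemma has_odv_site: "has_odv F F' \<Longrightarrow> has_odv (\<lambda>t. site m (F t)) (site m F')"
proof -
  assume F: "has_odv F F'"
  show "has_odv (\<lambda>t. site m (F t)) (site m F')"
    unfolding has_odv_def
  proof (intro allI)
    fix I J :: "'b \<Rightarrow> 'a idx"
    define b where "b \<longleftrightarrow> (\<forall>l. l \<noteq> m \<longrightarrow> I l = J l)"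
    show "((\<lambda>t. ent (site m (F t)) I J) has_field_derivative ent (site m F') I J) (at 0)"
      unfolding ent_site b_def[symmetric] using F by (cases b) (simp_all add: has_odv_def)
  qed
qed

lemma has_vdv_add: "has_vdv v v' \<Longrightarrow> has_vdv w w' \<Longrightarrow> has_vdv (\<lambda>t. v t + w t) (v' + w')"
  by (simp add: has_vdv_def DERIV_add)

lemma has_vdv_scale: "has_vdv v v' \<Longrightarrow> has_vdv (\<lambda>t. z *s v t) (z *s v')"
  by (auto simp: has_vdv_def intro!: DERIV_cmult)

lemma has_vdv_app:
  assumes "has_odv F F'" "has_vdv v v'"
  shows "has_vdv (\<lambda>t. app (F t) (v t)) (app F' (v 0) + app (F 0) v')"
  unfolding has_vdv_def
proof
  fix I
  have "((\<lambda>t. \<Sum>J\<in>UNIV. ent (F t) I J * v t $ J) has_field_derivative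
      (\<Sum>J\<in>UNIV. ent F' I J * v 0 $ J + v' $ J * ent (F 0) I J)) (at 0)"
    using assms unfolding has_odv_def has_vdv_def by (intro DERIV_sum DERIV_mult) auto
  then show "((\<lambda>t. app (F t) (v t) $ I) has_field_derivative (app F' (v 0) + app (F 0) v') $ I) (at 0)"
    by (simp add: app_nth sum.distrib mult.commute)
qed

text \<open>Local agreement has to suffice, because \<open>Lop\<close> is identified with
  \<open>L_order\<close> at regular points only, that is, for small t.\<close>

lemma has_vdv_cong:
  assumes "has_vdv v v'" "\<forall>\<^sub>F t in nhds 0. v t = w t"
  shows "has_vdv w v'"
  unfolding has_vdv_def
proof
  fix I
  have "\<forall>\<^sub>F t in nhds 0. v t $ I = w t $ I" using assms(2) by (rule eventually_mono) simp
  moreover have "((\<lambda>t. v t $ I) has_field_derivative v' $ I) (at 0)"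
    using assms(1) by (simp add: has_vdv_def)
  ultimately show "((\<lambda>t. w t $ I) has_field_derivative v' $ I) (at 0)"
    by (rule DERIV_cong_ev[OF refl _ refl, THEN iffD1])
qed

lemma pderiv_x_eqI: "has_vdv (\<lambda>t. f (x + axis a t) y) v' \<Longrightarrow> pderiv_x a f x y = v'"
  by (simp add: pderiv_x_def has_vdv_def vec_eq_iff DERIV_imp_deriv)

lemma add_axis_nth: "((x :: 'N::finite point) + axis a t) $ b = (if b = a then x $ b + t else x $ b)"
  by (auto simp: axis_def)

lemma has_odv_T:
  assumes "x $ a \<noteq> 0"
  shows "has_odv (\<lambda>t. T (x + axis a t)) ((1 / x $ a) \<odot> (h_mat a * T x))"
  unfolding has_odv_def
proof (intro allI)
  fix p q
  have hT: "ent ((1 / x $ a) \<odot> (h_mat a * T x)) p q = (1 / x $ a) * (ent (h_mat a) p p * ent (T x) p q)"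
  proof -
    have "ent (h_mat a * T x) p q = (\<Sum>r\<in>UNIV. if r = p then ent (h_mat a) p p * ent (T x) p q else 0)"
      unfolding ent_mult by (subst ent_h_mat) (intro sum.cong, auto)
    then show ?thesis by simp
  qed
  have inv: "((\<lambda>t. inverse (x $ a + t)) has_field_derivative - inverse (x $ a * x $ a)) (at 0)"
    using assms by (auto intro!: derivative_eq_intros simp: power2_eq_square)
  have id: "((\<lambda>t. x $ a + t) has_field_derivative 1) (at 0)"
    by (auto intro!: derivative_eq_intros)
  have h: "ent (h_mat a) (Inl b) (Inl b) = (if b = a then 1 else 0)" "ent (h_mat a) (Inr b) (Inr b) = (if b = a then - 1 else 0)" for b
    by (simp_all add: h_mat_def ent_e)
  show "((\<lambda>t. ent (T (x + axis a t)) p q) has_field_derivative ent ((1 / x $ a) \<odot> (h_mat a * T x)) p q) (at 0)"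
  proof (cases "p = bar q")
    case False
    then show ?thesis unfolding hT by (simp add: ent_T)
  next
    case True
    show ?thesis
    proof (cases q)
      case (Inl b)
      with True inv assms show ?thesis
        unfolding hT by (cases "b = a") (simp_all add: ent_T h add_axis_nth del: vector_add_component, simp add: field_simps)
    next
      case (Inr b)
      with True id assms show ?thesis
        unfolding hT by (cases "b = a") (simp_all add: ent_T h add_axis_nth del: vector_add_component)
    qed
  qed
qed

lemma has_odv_Q_split:
  assumes "x $ a \<noteq> 0"
  shows "has_odv (\<lambda>t. Q_split c k \<alpha> \<beta> us m vs (x + axis a t) y)
    (Q_left c k us m y * (((y $ m - c / 2) / (y $ m - c / 2 + \<beta>) / x $ a) \<odot> site m (h_mat a * T x)) * Q_right k \<alpha> us m vs y)"
proof -
  define z where "z = y $ m - c / 2"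
  have "has_odv (\<lambda>t. K_site m z (x + axis a t) \<beta>)
      ((1 / (z + \<beta>)) \<odot> (z \<odot> site m ((1 / x $ a) \<odot> (h_mat a * T x)) + 0))"
    unfolding K_site_def K_num_def
    by (intro has_odv_cscale has_odv_add has_odv_site has_odv_T has_odv_const assms)
  then have "has_odv (\<lambda>t. Q_split c k \<alpha> \<beta> us m vs (x + axis a t) y)
    (Q_left c k us m y * ((1 / (z + \<beta>)) \<odot> (z \<odot> site m ((1 / x $ a) \<odot> (h_mat a * T x)) + 0)) * Q_right k \<alpha> us m vs y)"
    unfolding Q_split_def z_def[symmetric] by (intro has_odv_mult_left has_odv_mult_right)
  then show ?thesis by (simp add: z_def site_linear mult_ac)
qed

text \<open>\<open>x\<^sub>a\<close> times the derivative of \<open>L\<^sub>b\<close> in \<open>x\<^sub>a\<close>, for \<open>a \<noteq> b\<close>.\<close>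

definition cross_deriv :: "complex \<Rightarrow> 'N::finite point \<Rightarrow> 'N \<Rightarrow> 'N \<Rightarrow> ('n \<times> 'n) set \<Rightarrow> ('n::finite \<Rightarrow> 'N idx) opr"
  where "cross_deriv k x a b S = k \<odot> (\<Sum>(i, j)\<in>S. (x $ a * x $ b / (x $ a - x $ b)\<^sup>2) \<odot> (X_pair a b i j + X_pair b a i j)
    + (- (x $ a * x $ b) / (x $ a * x $ b - 1)\<^sup>2) \<odot> (Y_pair a b i j + Z_pair a b i j))"

lemma cross_deriv_commute: "cross_deriv k x a b S = cross_deriv k x b a S"
  by (simp add: cross_deriv_def add.commute mult.commute power2_commute Y_pair_def Z_pair_def)

text \<open>Only the summands with p = a depend on \<open>x_a\<close>. The coefficients of
  \<open>X_pair b a\<close> and \<open>X_pair a b\<close> in them differ by the constant 1, and so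
  do those of Y and Z. Equal derivatives are what makes the result symmetric in a and b.\<close>

lemma has_odv_pair_term:
  fixes x :: "'N::finite point" and i j :: "'n::finite"
  assumes "regular_x x" "a \<noteq> b"
  shows "has_odv (\<lambda>t. pair_term (x + axis a t) b i j)
    ((1 / x $ a) \<odot> ((x $ a * x $ b / (x $ a - x $ b)\<^sup>2) \<odot> (X_pair a b i j + X_pair b a i j)
      + (- (x $ a * x $ b) / (x $ a * x $ b - 1)\<^sup>2) \<odot> (Y_pair a b i j + Z_pair a b i j)))"
proof -
  have nz: "x $ a \<noteq> 0" "x $ b - x $ a \<noteq> 0" "x $ b * x $ a - 1 \<noteq> 0" "x $ a - x $ b \<noteq> 0" "x $ a * x $ b - 1 \<noteq> 0"
    using assms unfolding regular_x_def by (auto simp: mult.commute)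
  define X where "X t p = (1 / ((x + axis a t) $ b - (x + axis a t) $ p)) \<odot>
    ((x + axis a t) $ b \<odot> X_pair b p i j + (x + axis a t) $ p \<odot> X_pair p b i j)" for t p
  define Y where "Y t p = (1 / ((x + axis a t) $ b * (x + axis a t) $ p - 1)) \<odot>
    (((x + axis a t) $ b * (x + axis a t) $ p) \<odot> Y_pair b p i j + Z_pair b p i j)" for t p
  define dX where "dX = (x $ b / (x $ a - x $ b)\<^sup>2) \<odot> (X_pair a b i j + X_pair b a i j)"
  define dY where "dY = (- x $ b / (x $ a * x $ b - 1)\<^sup>2) \<odot> (Y_pair a b i j + Z_pair a b i j)"
  have X: "has_odv (\<lambda>t. X t p) (if p = a then dX else 0)" for p
  proof (cases "p = a")
    case True
    have 1: "((\<lambda>t. x $ b / (x $ b - (x $ a + t))) has_field_derivative x $ b / (x $ a - x $ b)\<^sup>2) (at 0)"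
      using nz by (auto intro!: derivative_eq_intros simp: power2_eq_square field_simps)
    have 2: "((\<lambda>t. (x $ a + t) / (x $ b - (x $ a + t))) has_field_derivative x $ b / (x $ a - x $ b)\<^sup>2) (at 0)"
      using nz by (auto intro!: derivative_eq_intros simp: power2_eq_square field_simps)
    have "has_odv (\<lambda>t. (x $ b / (x $ b - (x $ a + t))) \<odot> X_pair b a i j + ((x $ a + t) / (x $ b - (x $ a + t))) \<odot> X_pair a b i j)
      ((x $ b / (x $ a - x $ b)\<^sup>2) \<odot> X_pair b a i j + (x $ b / (x $ a - x $ b)\<^sup>2) \<odot> X_pair a b i j)"
      by (intro has_odv_add has_odv_scale 1 2)
    then show ?thesis
      using True assms(2) by (simp add: X_def dX_def add_axis_nth cscale_distrib(1) add.commute del: vector_add_component)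
  next
    case False
    then have eq: "(\<lambda>t. X t p) = (\<lambda>t. X 0 p)"
      using assms(2) by (simp add: X_def add_axis_nth fun_eq_iff del: vector_add_component)
    show ?thesis unfolding eq using False by (simp add: has_odv_const)
  qed
  have Y: "has_odv (\<lambda>t. Y t p) (if p = a then dY else 0)" for p
  proof (cases "p = a")
    case True
    have 1: "((\<lambda>t. x $ b * (x $ a + t) / (x $ b * (x $ a + t) - 1)) has_field_derivative - x $ b / (x $ a * x $ b - 1)\<^sup>2) (at 0)"
      using nz by (auto intro!: derivative_eq_intros simp: power2_eq_square divide_simps) (simp_all add: algebra_simps)
    have 2: "((\<lambda>t. 1 / (x $ b * (x $ a + t) - 1)) has_field_derivative - x $ b / (x $ a * x $ b - 1)\<^sup>2) (at 0)"
      using nz by (auto intro!: derivative_eq_intros simp: power2_eq_square divide_simps) (simp_all add: algebra_simps)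
    have "has_odv (\<lambda>t. (x $ b * (x $ a + t) / (x $ b * (x $ a + t) - 1)) \<odot> Y_pair b a i j + (1 / (x $ b * (x $ a + t) - 1)) \<odot> Z_pair b a i j)
      ((- x $ b / (x $ a * x $ b - 1)\<^sup>2) \<odot> Y_pair b a i j + (- x $ b / (x $ a * x $ b - 1)\<^sup>2) \<odot> Z_pair b a i j)"
      by (intro has_odv_add has_odv_scale 1 2)
    moreover have "Y_pair b a i j = Y_pair a b i j" "Z_pair b a i j = Z_pair a b i j"
      by (simp_all add: Y_pair_def Z_pair_def add.commute)
    ultimately show ?thesis
      using True assms(2) by (simp add: Y_def dY_def add_axis_nth cscale_distrib(1) del: vector_add_component)
  next
    case False
    then have eq: "(\<lambda>t. Y t p) = (\<lambda>t. Y 0 p)"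
      using assms(2) by (simp add: Y_def add_axis_nth fun_eq_iff del: vector_add_component)
    show ?thesis unfolding eq using False by (simp add: has_odv_const)
  qed
  have "has_odv (\<lambda>t. (\<Sum>p\<in>- {b}. X t p) + (\<Sum>p\<in>UNIV. Y t p))
     ((\<Sum>p\<in>- {b}. if p = a then dX else 0) + (\<Sum>p\<in>UNIV. if p = a then dY else 0))"
    by (intro has_odv_add has_odv_sum X Y)
  moreover have "(\<Sum>p\<in>- {b}. if p = a then dX else 0) = dX" "(\<Sum>p\<in>UNIV. if p = a then dY else 0) = dY"
    using assms(2) by simp_all
  moreover have "dX = (1 / x $ a) \<odot> (x $ a * x $ b / (x $ a - x $ b)\<^sup>2) \<odot> (X_pair a b i j + X_pair b a i j)"
    "dY = (1 / x $ a) \<odot> (- (x $ a * x $ b) / (x $ a * x $ b - 1)\<^sup>2) \<odot> (Y_pair a b i j + Z_pair a b i j)"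
    unfolding dX_def dY_def cscale_simps(7) using nz(1) by simp_all
  ultimately show ?thesis
    unfolding pair_term_def X_def Y_def cscale_distrib(1)[of "1 / x $ a"] by simp
qed

lemma has_odv_L_order:
  fixes x :: "'N::finite point" and y :: "'n::finite point"
  assumes "regular_x x" "a \<noteq> b"
  shows "has_odv (\<lambda>t. L_order k \<alpha> \<beta> S (x + axis a t) b y) ((1 / x $ a) \<odot> cross_deriv k x a b S)"
proof -
  have m: "site_term \<alpha> \<beta> (x + axis a t) b = site_term \<alpha> \<beta> x b" for t
    using assms(2) by (simp add: site_term_def add_axis_nth del: vector_add_component)
  have "has_odv (\<lambda>t. L_order k \<alpha> \<beta> S (x + axis a t) b y)
    (0 + k \<odot> (\<Sum>s\<in>S. case s of (i, j) \<Rightarrow> (1 / x $ a) \<odot> ((x $ a * x $ b / (x $ a - x $ b)\<^sup>2) \<odot> (X_pair a b i j + X_pair b a i j)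
      + (- (x $ a * x $ b) / (x $ a * x $ b - 1)\<^sup>2) \<odot> (Y_pair a b i j + Z_pair a b i j))))"
    unfolding L_order_def m
    by (intro has_odv_add has_odv_const has_odv_cscale has_odv_sum)
      (simp only: case_prod_unfold, rule has_odv_pair_term[OF assms])
  then show ?thesis
    by (simp only: cross_deriv_def case_prod_unfold cscale_sum[symmetric] cscale_simps(7) add_0 mult.commute[of k])
qed

text \<open>Forward shifts at i raise the difference \<open>y_i\<close> - \<open>y_j\<close> by
  multiples of c, and forward shifts at j lower it; every integer multiple is reached by one of the
  two.\<close>

lemma generic_if_admissible:
  fixes x :: "'N::finite point" and y :: "'n::{finite,linorder} point"
  assumes adm: "admissible_domain c k \<alpha> \<beta> \<Omega>" and xy: "(x, y) \<in> \<Omega>"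
  shows "generic c k y"
  unfolding generic_def
proof (intro allI impI)
  fix i j :: 'n and z :: int
  assume "i \<noteq> j"
  have step: "(x, y' + axis m (c * of_nat p)) \<in> \<Omega>" if "(x, y') \<in> \<Omega>" for m y' p
  proof (induction p)
    case 0
    then show ?case using that by (simp add: axis_zero)
  next
    case (Suc p)
    then have "(x, y' + axis m (c * of_nat p) + axis m c) \<in> \<Omega>"
      using adm unfolding admissible_domain_def by fast
    moreover have "axis m (c * of_nat (Suc p)) = axis m (c * of_nat p) + axis m c"
      by (auto simp: vec_eq_iff axis_def algebra_simps)
    ultimately show ?case by (simp add: add.assoc)
  qed
  have reg: "regular_Q c k \<alpha> \<beta> i (y + axis i (c * of_nat p) + axis j (c * of_nat q))" for p q
    using step[OF step[OF xy]] adm unfolding admissible_domain_def by fast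
  have nth: "(y + axis i (c * of_nat p) + axis j (c * of_nat q)) $ i = y $ i + c * of_nat p"
    "(y + axis i (c * of_nat p) + axis j (c * of_nat q)) $ j = y $ j + c * of_nat q" for p q
    using \<open>i \<noteq> j\<close> by (simp_all add: axis_def)
  show "y $ i - y $ j + c * of_int z + k \<noteq> 0"
  proof (cases "i < j")
    case True
    have "(y + axis i (c * of_nat p) + axis j (c * of_nat q)) $ i
        - (y + axis i (c * of_nat p) + axis j (c * of_nat q)) $ j + k \<noteq> 0" for p q
      using reg[of p q] True unfolding regular_Q_def by blast
    then have "y $ i + c * of_nat p - (y $ j + c * of_nat q) + k \<noteq> 0" for p q
      unfolding nth .
    from this[of "nat z" "nat (- z)"] show ?thesis
      by (cases "z \<ge> 0") (simp_all add: algebra_simps)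
  next
    case False
    then have "j < i" using \<open>i \<noteq> j\<close> by simp
    then have "(y + axis i (c * of_nat p) + axis j (c * of_nat q)) $ i
        - (y + axis i (c * of_nat p) + axis j (c * of_nat q)) $ j - c + k \<noteq> 0" for p q
      using reg[of p q] unfolding regular_Q_def by blast
    then have "y $ i + c * of_nat p - (y $ j + c * of_nat q) - c + k \<noteq> 0" for p q
      unfolding nth .
    \<comment> \<open>For j < i the denominator already contains -c, so z + 1 steps are needed
      instead of z.\<close>
    from this[of "nat (z + 1)" "nat (- (z + 1))"] show ?thesis
      by (cases "z + 1 \<ge> 0") (simp_all add: algebra_simps)
  qed
qed


subsection \<open>Compatibility\<close>

lemma DeltaQ_app:
  "DeltaQ c k \<alpha> \<beta> m f x y = app (Q_order c k \<alpha> \<beta> x sites m (y + axis m c)) (f x (y + axis m c))"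
  by (simp add: DeltaQ_def Delta_inv_def app_opr_of opr_of_Qmat(1))

lemma Dop_app:
  assumes "regular_x x"
  shows "Dop c k \<alpha> \<beta> a f x y = (c * x $ a) *s pderiv_x a f x y + app (L_order k \<alpha> \<beta> (order_pairs sites) x a y) (f x y)"
  by (simp add: Dop_def app_opr_of opr_of_Lop[OF assms])

context
  fixes c k \<alpha> \<beta> :: complex
    and \<Omega> :: "(('N::{finite,linorder}) point \<times> ('n::{finite,linorder}) point) set"
  assumes adm: "admissible_domain c k \<alpha> \<beta> \<Omega>"
begin

lemma admissibleD:
  assumes "(x, y) \<in> \<Omega>"
  shows "regular_x x" "(x, y + axis m c) \<in> \<Omega>" "open {x. (x, y) \<in> \<Omega>}"
  using adm assms unfolding admissible_domain_def by fast+

lemma holo_on_component: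
  assumes "f \<in> fun_space \<Omega>"
  shows "holo_on {x. (x, y) \<in> \<Omega>} (\<lambda>x. f x y $ I)"
  unfolding holo_on_def
proof
  fix x assume "x \<in> {x. (x, y) \<in> \<Omega>}"
  then obtain f' where "((\<lambda>x. f x y) has_derivative f') (at x) \<and> (\<forall>z v. f' (z *s v) = z *s f' v)"
    using assms unfolding fun_space_def by fast
  then have "((\<lambda>x. f x y $ I) has_derivative (\<lambda>h. f' h $ I)) (at x)" "\<forall>z v. f' (z *s v) $ I = z * f' v $ I"
    by (auto intro: bounded_linear.has_derivative[OF bounded_linear_vec_nth])
  then show "\<exists>g'. ((\<lambda>x. f x y $ I) has_derivative g') (at x) \<and> (\<forall>z v. g' (z *s v) = z * g' v)"
    by blast
qed

lemma pderiv_x_nth: "pderiv_x a f x y $ I = dax a (\<lambda>x. f x y $ I) x"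
  by (simp add: pderiv_x_def dax_def)

lemma has_vdv_pderiv_x:
  assumes "f \<in> fun_space \<Omega>" "(x, y) \<in> \<Omega>"
  shows "has_vdv (\<lambda>t. f (x + axis a t) y) (pderiv_x a f x y)"
  unfolding has_vdv_def pderiv_x_nth
  using has_field_derivative_dax[OF holo_on_component[OF assms(1)]] assms(2) by blast

lemma mixed_pderiv_x:
  assumes "f \<in> fun_space \<Omega>" "(x, y) \<in> \<Omega>"
  obtains M where "has_vdv (\<lambda>t. pderiv_x b f (x + axis a t) y) M" "has_vdv (\<lambda>t. pderiv_x a f (x + axis b t) y) M"
proof -
  have "\<exists>D. ((\<lambda>t. dax b (\<lambda>x. f x y $ I) (x + axis a t)) has_field_derivative D) (at 0)
    \<and> ((\<lambda>t. dax a (\<lambda>x. f x y $ I) (x + axis b t)) has_field_derivative D) (at 0)" for I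
    using dax_dax[OF admissibleD(3)[OF assms(2)] _ holo_on_component[OF assms(1)]] assms(2) by blast
  then obtain D where "\<forall>I. ((\<lambda>t. dax b (\<lambda>x. f x y $ I) (x + axis a t)) has_field_derivative D I) (at 0)
    \<and> ((\<lambda>t. dax a (\<lambda>x. f x y $ I) (x + axis b t)) has_field_derivative D I) (at 0)"
    by metis
  then show ?thesis
    using that[of "\<chi> I. D I"] by (simp add: has_vdv_def pderiv_x_nth)
qed

lemma eventually_regular_x:
  assumes "(x, y) \<in> \<Omega>"
  shows "\<forall>\<^sub>F t in nhds 0. regular_x (x + axis a t)"
proof -
  have "isCont (\<lambda>t. x + axis a t) 0"
    using has_derivative_continuous[OF has_derivative_axis[of x a 0]] by simp
  then have "((\<lambda>t. x + axis a t) \<longlongrightarrow> x) (nhds 0)"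
    by (simp add: continuous_at tendsto_nhds_iff axis_zero)
  moreover have "\<forall>\<^sub>F x' in nhds x. x' \<in> {x. (x, y) \<in> \<Omega>}"
    using admissibleD(3)[OF assms] assms by (intro eventually_nhds_in_open) auto
  ultimately have "\<forall>\<^sub>F t in nhds 0. x + axis a t \<in> {x. (x, y) \<in> \<Omega>}"
    by (rule filterlim_iff[THEN iffD1, rule_format])
  then show ?thesis by (rule eventually_mono) (use admissibleD(1) in blast)
qed

text \<open>For distinct a and b the factor c \<open>x_b\<close> is constant in \<open>x_a\<close>,
  so four groups of terms have to match: the mixed derivatives M, the derivatives of L, the products
  of L with first derivatives, and the products of two L.\<close>

lemma Dop_Dop:
  assumes f: "f \<in> fun_space \<Omega>" and xy: "(x, y) \<in> \<Omega>" and "k \<noteq> 0" "a \<noteq> b"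
  shows "Dop c k \<alpha> \<beta> a (Dop c k \<alpha> \<beta> b f) x y = Dop c k \<alpha> \<beta> b (Dop c k \<alpha> \<beta> a f) x y"
proof -
  note reg = admissibleD(1)[OF xy]
  obtain M where M: "has_vdv (\<lambda>t. pderiv_x b f (x + axis a t) y) M" "has_vdv (\<lambda>t. pderiv_x a f (x + axis b t) y) M"
    by (rule mixed_pderiv_x[OF f xy])
  let ?L = "\<lambda>a. L_order k \<alpha> \<beta> (order_pairs sites) x a y" and ?W = "\<lambda>a b. cross_deriv k x a b (order_pairs sites)"
  have pd: "pderiv_x a (Dop c k \<alpha> \<beta> b f) x y
      = (c * x $ b) *s M + ((1 / x $ a) *s app (?W a b) (f x y) + app (?L b) (pderiv_x a f x y))"
    if ab: "a \<noteq> b" and M: "has_vdv (\<lambda>t. pderiv_x b f (x + axis a t) y) M" for a b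
  proof (rule pderiv_x_eqI, rule has_vdv_cong)
    show "has_vdv (\<lambda>t. (c * x $ b) *s pderiv_x b f (x + axis a t) y + app (L_order k \<alpha> \<beta> (order_pairs sites) (x + axis a t) b y) (f (x + axis a t) y))
      ((c * x $ b) *s M + ((1 / x $ a) *s app (?W a b) (f x y) + app (?L b) (pderiv_x a f x y)))"
      using has_vdv_add[OF has_vdv_scale[OF M] has_vdv_app[OF has_odv_L_order[OF reg ab] has_vdv_pderiv_x[OF f xy]]]
      by (simp add: axis_zero app_simps)
    show "\<forall>\<^sub>F t in nhds 0. (c * x $ b) *s pderiv_x b f (x + axis a t) y
        + app (L_order k \<alpha> \<beta> (order_pairs sites) (x + axis a t) b y) (f (x + axis a t) y) = Dop c k \<alpha> \<beta> b f (x + axis a t) y"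
      using eventually_regular_x[OF xy]
    proof (rule eventually_mono)
      fix t assume "regular_x (x + axis a t)"
      from Dop_app[OF this, of c k \<alpha> \<beta> b f y] show "(c * x $ b) *s pderiv_x b f (x + axis a t) y
        + app (L_order k \<alpha> \<beta> (order_pairs sites) (x + axis a t) b y) (f (x + axis a t) y) = Dop c k \<alpha> \<beta> b f (x + axis a t) y"
        using ab by (simp add: add_axis_nth del: vector_add_component)
    qed
  qed
  have x0: "x $ a \<noteq> 0" "x $ b \<noteq> 0" using reg by (auto simp: regular_x_def)
  have L_order: "app (?L a) (app (?L b) (f x y)) = app (?L b) (app (?L a) (f x y))"
    unfolding app_simps(1)[symmetric] by (subst L_order_commute[OF assms(3) reg]) auto
  have D: "Dop c k \<alpha> \<beta> a (Dop c k \<alpha> \<beta> b f) x y =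
      (c * x $ a) *s ((c * x $ b) *s M + ((1 / x $ a) *s app (?W a b) (f x y) + app (?L b) (pderiv_x a f x y)))
      + app (?L a) ((c * x $ b) *s pderiv_x b f x y + app (?L b) (f x y))"
    by (simp only: Dop_app[OF reg] pd[OF assms(4) M(1)])
  have D': "Dop c k \<alpha> \<beta> b (Dop c k \<alpha> \<beta> a f) x y =
      (c * x $ b) *s ((c * x $ a) *s M + ((1 / x $ b) *s app (?W b a) (f x y) + app (?L a) (pderiv_x b f x y)))
      + app (?L b) ((c * x $ a) *s pderiv_x a f x y + app (?L a) (f x y))"
    by (simp only: Dop_app[OF reg] pd[OF assms(4)[symmetric] M(2)])
  show ?thesis
    unfolding D D' app_simps(4,5) L_order cross_deriv_commute[of k x b a] using x0
    by (simp add: vec_eq_iff algebra_simps)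
qed

lemma Dop_DeltaQ:
  assumes f: "f \<in> fun_space \<Omega>" and xy: "(x, y) \<in> \<Omega>"
  shows "Dop c k \<alpha> \<beta> a (DeltaQ c k \<alpha> \<beta> m f) x y = DeltaQ c k \<alpha> \<beta> m (Dop c k \<alpha> \<beta> a f) x y"
proof -
  note reg = admissibleD(1)[OF xy]
  \<comment> \<open>\<open>Delta_inv\<close> evaluates at the forward point, so \<open>y\<close> is
    \<open>y1\<close> shifted back: L on the left of Q sees \<open>y\<close>, L on the right sees
    \<open>y1\<close>.\<close>
  define y1 where "y1 = y + axis m c"
  have xy1: "(x, y1) \<in> \<Omega>" unfolding y1_def by (rule admissibleD(2)[OF xy])
  have y: "y = shift c m y1" by (auto simp: y1_def shift_def upd_def vec_eq_iff axis_def)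
  have x0: "x $ a \<noteq> 0" using reg by (auto simp: regular_x_def)
  let ?us = "sites_below m" and ?vs = "sites_above m"
  let ?L = "\<lambda>y. L_order k \<alpha> \<beta> (order_pairs sites) x a y" and ?Q = "Q_split c k \<alpha> \<beta> ?us m ?vs x y1"
  define z where "z = y1 $ m - c / 2"
  define w where "w = z / (z + \<beta>)"
  define E where "E = Q_left c k ?us m y1 * site m (h_mat a * T x) * Q_right k \<alpha> ?us m ?vs y1"
  have dQ: "has_odv (\<lambda>t. Q_split c k \<alpha> \<beta> ?us m ?vs (x + axis a t) y1) ((w / x $ a) \<odot> E)"
    using has_odv_Q_split[OF x0, of c k \<alpha> \<beta> ?us m ?vs y1] by (simp add: w_def z_def E_def)
  have DQ: "DeltaQ c k \<alpha> \<beta> m g x' y = app (Q_split c k \<alpha> \<beta> ?us m ?vs x' y1) (g x' y1)" for g x'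
    by (simp add: DeltaQ_app y1_def opr_of_Qmat(2))
  have pd: "pderiv_x a (DeltaQ c k \<alpha> \<beta> m f) x y
      = (w / x $ a) *s app E (f x y1) + app ?Q (pderiv_x a f x y1)"
  proof (rule pderiv_x_eqI)
    show "has_vdv (\<lambda>t. DeltaQ c k \<alpha> \<beta> m f (x + axis a t) y)
      ((w / x $ a) *s app E (f x y1) + app ?Q (pderiv_x a f x y1))"
      using has_vdv_app[OF dQ has_vdv_pderiv_x[OF f xy1]] unfolding DQ by (simp add: axis_zero app_simps)
  qed
  have Q_left: "(c * w) \<odot> E + ?L y * ?Q = ?Q * ?L y1"
  proof -
    have "distinct (?us @ m # ?vs)" unfolding sites_eq[symmetric] by simp
    from Q_split_L_order[OF reg this, of c k y1 \<beta> a \<alpha>] show ?thesis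
      unfolding sites_eq[symmetric] y shift_def w_def z_def E_def by simp
  qed
  have "Dop c k \<alpha> \<beta> a (DeltaQ c k \<alpha> \<beta> m f) x y
      = app ((c * w) \<odot> E + ?L y * ?Q) (f x y1) + (c * x $ a) *s app ?Q (pderiv_x a f x y1)"
    unfolding Dop_app[OF reg] pd DQ app_simps using x0 by (simp add: vec_eq_iff algebra_simps)
  also have "\<dots> = DeltaQ c k \<alpha> \<beta> m (Dop c k \<alpha> \<beta> a f) x y"
    unfolding Q_left DQ Dop_app[OF reg] app_simps by (simp add: add.commute)
  finally show ?thesis .
qed

lemma DeltaQ_DeltaQ:
  assumes xy: "(x, y) \<in> \<Omega>" and "l \<noteq> m"
  shows "DeltaQ c k \<alpha> \<beta> l (DeltaQ c k \<alpha> \<beta> m f) x y = DeltaQ c k \<alpha> \<beta> m (DeltaQ c k \<alpha> \<beta> l f) x y"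
proof -
  \<comment> \<open>Seen from the doubly shifted point, the two intermediate points are the backward
    shifts in \<open>Q_order_commute\<close>.\<close>
  define y2 where "y2 = y + axis l c + axis m c"
  have xy2: "(x, y2) \<in> \<Omega>" unfolding y2_def by (intro admissibleD(2) xy)
  have y: "y + axis l c = shift c m y2" "y + axis m c = shift c l y2"
    using assms(2) by (auto simp: y2_def shift_def upd_def vec_eq_iff axis_def)
  have y2: "y + axis l c + axis m c = y2" "y + axis m c + axis l c = y2"
    by (simp_all add: y2_def add_ac)
  have x0: "x $ a \<noteq> 0" for a using admissibleD(1)[OF xy] by (auto simp: regular_x_def)
  have "Q_order c k \<alpha> \<beta> x sites l (shift c m y2) * Q_order c k \<alpha> \<beta> x sites m y2
      = Q_order c k \<alpha> \<beta> x sites m (shift c l y2) * Q_order c k \<alpha> \<beta> x sites l y2"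
    by (rule Q_order_commute) (use assms(2) x0 generic_if_admissible[OF adm xy2] in auto)
  then show ?thesis
    unfolding DeltaQ_app y2 unfolding y app_simps(1)[symmetric] by simp
qed

end

theorem theorem3p3:
  fixes c k \<alpha> \<beta> :: complex
    and \<Omega> :: "(('N::{finite,linorder}) point \<times> ('n::{finite,linorder}) point) set"
  assumes "c \<noteq> 0" "k \<noteq> 0" "\<alpha> \<noteq> 0" "\<beta> \<noteq> 0"
    and "admissible_domain c k \<alpha> \<beta> \<Omega>"
  shows "(\<forall>a m. commute_on \<Omega> (Dop c k \<alpha> \<beta> a) (DeltaQ c k \<alpha> \<beta> m))
    \<and> compatible \<Omega> (range (Dop c k \<alpha> \<beta>) \<union> range (DeltaQ c k \<alpha> \<beta>))"
proof -
  have 1: "commute_on \<Omega> (Dop c k \<alpha> \<beta> a) (DeltaQ c k \<alpha> \<beta> m)"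
    and 2: "commute_on \<Omega> (DeltaQ c k \<alpha> \<beta> m) (Dop c k \<alpha> \<beta> a)" for a m
    using Dop_DeltaQ[OF assms(5)] by (auto simp: commute_on_def commutator_def)
  have 3: "commute_on \<Omega> (Dop c k \<alpha> \<beta> a) (Dop c k \<alpha> \<beta> b)" for a b
    using Dop_Dop[OF assms(5) _ _ assms(2), of _ _ _ a b]
    by (cases "a = b") (auto simp: commute_on_def commutator_def)
  have 4: "commute_on \<Omega> (DeltaQ c k \<alpha> \<beta> l) (DeltaQ c k \<alpha> \<beta> m)" for l m
    using DeltaQ_DeltaQ[OF assms(5), of _ _ l m]
    by (cases "l = m") (auto simp: commute_on_def commutator_def)
  from 1 2 3 4 show ?thesis by (auto simp: compatible_def)
qed

end
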